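(* Let $T:X\to X$ be an ergodic automorphism (invertible measure-preserving transformation) of a probability space $(X,\mathscr A,\mu)$ and let $A$ be a $\mu$-integrable linear cocycle on a measurable bundle $\mathcal B\subseteq X\times\mathbb R^m$ over $T$. Then there exist $k\ge1$, numbers $\lambda_1>\lambda_2>\dots>\lambda_k\ge-\infty$ and measurable functions $F_j:X\to\mathrm{Gr}(\mathbb R^m)$, $1\le j\le k$, such that, putting $F_{k+1}(x)=\{0\}$, for $\mu$-a.e. $x\in X$: (a) $A(x)F_j(x)\subseteq F_j(Tx)$ for $j=1,\dots,k$; (b) $\{0\}=F_{k+1}(x)\subsetneq F_k(x)\subsetneq\dots\subsetneq F_2(x)\subsetneq F_1(x)=\mathcal B(x)$; (c) for every $1\le j\le k$ and every $v\in F_j(x)\setminus F_{j+1}(x)$, $\displaystyle\lim_{n\to+\infty}\frac1n\log\|A^{(n)}(x)v\|=\lambda_j$.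
   Context: $\mathrm{Gr}(\mathbb R^m)$ is the Grassmannian of all linear subspaces of $\mathbb R^m$. A measurable bundle is $\mathcal B=\{(x,v):x\in X,\ v\in E(x)\}$ for a measurable $E:X\to\mathrm{Gr}(\mathbb R^m)$; its fibers $\mathcal B(x)=E(x)$ have constant dimension $\ge1$. A linear cocycle on $\mathcal B$ over $T$ is a measurable family of linear maps $A(x):E(x)\to E(Tx)$; $A^{(n)}(x)=A(T^{n-1}x)\cdots A(Tx)A(x)$. It is $\mu$-integrable if $\int_X\log^+\|A(x)\|\,d\mu(x)<\infty$. Convention: $\log0=-\infty$. No invertibility of the maps $A(x)$ is assumed. *)

theory Defs
  imports "HOL-Probability.Probability"
begin

definition ergodic_automorphism :: "'x measure \<Rightarrow> ('x \<Rightarrow> 'x) \<Rightarrow> bool" where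
  "ergodic_automorphism M T \<longleftrightarrow>
     bij_betw T (space M) (space M) \<and>
     T \<in> measurable M M \<and>
     inv_into (space M) T \<in> measurable M M \<and>
     distr M M T = M \<and>
     (\<forall>B\<in>sets M. T -` B \<inter> space M = B \<longrightarrow> measure M B = 0 \<or> measure M B = 1)"

(* For a linear subspace S, closest_point S is the orthogonal projection onto S.  Gr(R^m)
   carries its usual topology, that of the gap metric (the norm of the difference of the
   orthogonal projections), and the Borel sigma-algebra of this topology. *)
definition grassmann_topology :: "(real ^ 'm) set topology" where
  "grassmann_topology =
     pullback_topology {S. subspace S} (\<lambda>S. matrix (closest_point S)) euclidean"

definition grassmannian :: "(real ^ 'm) set measure" where
  "grassmannian = sigma {S. subspace S} {U. openin grassmann_topology U}"

lemma topspace_grassmann_topology [simp]: "topspace grassmann_topology = {S. subspace S}"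
  unfolding grassmann_topology_def by (simp add: topspace_pullback_topology)

lemma space_grassmannian [simp]: "space grassmannian = {S. subspace S}"
  unfolding grassmannian_def
  by (rule space_measure_of) (use openin_subset[of grassmann_topology] in auto)

lemma sets_grassmannian:
  "sets grassmannian = sigma_sets {S. subspace S} {U. openin grassmann_topology U}"
  unfolding grassmannian_def
  by (rule sets_measure_of) (use openin_subset[of grassmann_topology] in auto)

(* The bundle is given by its fibre map E. *)
definition measurable_bundle :: "'x measure \<Rightarrow> ('x \<Rightarrow> (real ^ 'm) set) \<Rightarrow> bool" where
  "measurable_bundle M E \<longleftrightarrow>
     E \<in> measurable M grassmannian \<and> (\<exists>d\<ge>1. \<forall>x\<in>space M. dim (E x) = d)"

definition bundle_set :: "'x measure \<Rightarrow> ('x \<Rightarrow> (real ^ 'm) set) \<Rightarrow> ('x \<times> (real ^ 'm)) set" where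
  "bundle_set M E = {(x, v). x \<in> space M \<and> v \<in> E x}"

(* A x is a total function on R^m of which only the restriction to E x is meaningful.
   Measurability of the family is joint measurability of (x, v) |-> A(x)v on the bundle. *)
definition linear_cocycle ::
  "'x measure \<Rightarrow> ('x \<Rightarrow> 'x) \<Rightarrow> ('x \<Rightarrow> (real ^ 'm) set) \<Rightarrow> ('x \<Rightarrow> real ^ 'm \<Rightarrow> real ^ 'm) \<Rightarrow> bool" where
  "linear_cocycle M T E A \<longleftrightarrow>
     (\<forall>x\<in>space M.
        A x ` E x \<subseteq> E (T x) \<and>
        (\<forall>u\<in>E x. \<forall>v\<in>E x. A x (u + v) = A x u + A x v) \<and>
        (\<forall>c. \<forall>v\<in>E x. A x (c *\<^sub>R v) = c *\<^sub>R A x v)) \<and>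
     (\<lambda>(x, v). A x v) \<in> borel_measurable (restrict_space (M \<Otimes>\<^sub>M borel) (bundle_set M E))"

primrec cocycle_iterate ::
  "('x \<Rightarrow> 'x) \<Rightarrow> ('x \<Rightarrow> real ^ 'm \<Rightarrow> real ^ 'm) \<Rightarrow> nat \<Rightarrow> 'x \<Rightarrow> real ^ 'm \<Rightarrow> real ^ 'm" where
  "cocycle_iterate T A 0 x v = v"
| "cocycle_iterate T A (Suc n) x v = A ((T ^^ n) x) (cocycle_iterate T A n x v)"

definition norm_on :: "(real ^ 'm) set \<Rightarrow> (real ^ 'm \<Rightarrow> real ^ 'm) \<Rightarrow> real" where
  "norm_on S L = (SUP v\<in>{v\<in>S. norm v \<le> 1}. norm (L v))"

(* ln (max 1 t) is log^+ t, with log^+ 0 = 0. *)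
definition integrable_cocycle ::
  "'x measure \<Rightarrow> ('x \<Rightarrow> (real ^ 'm) set) \<Rightarrow> ('x \<Rightarrow> real ^ 'm \<Rightarrow> real ^ 'm) \<Rightarrow> bool" where
  "integrable_cocycle M E A \<longleftrightarrow>
     (\<integral>\<^sup>+ x. ennreal (ln (max 1 (norm_on (E x) (A x)))) \<partial>M) < \<infinity>"

(* The logarithm of a nonnegative real number with log 0 = -infinity, unlike ln, where ln 0 = 0. *)
definition elog :: "real \<Rightarrow> ereal" where
  "elog t = (if t = 0 then -\<infinity> else ereal (ln t))"

end

theory Submission
  imports Defs
begin

text \<open>
  Extended by \<open>0\<close> on the orthogonal complements of the fibres, the cocycle becomes a cocycle of matrices
  \<open>B x\<close> on \<open>\<real>\<^sup>m\<close>, and a measurable sub-bundle becomes a measurable family of orthogonal projections.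
  Write \<open>L n\<close> for the \<open>n\<close>-th iterate at a given point.

  Growth rates. For real \<open>t\<close> put \<open>C = exp (- n t) L n\<close> and consider \<open>ln (det (1 + C\<^sup>T C))\<close>. If
  \<open>exp (n a\<^sub>i)\<close> are the singular values of \<open>L n\<close>, this is the sum of the \<open>2 n max 0 (a\<^sub>i - t)\<close> up to a
  bounded error. Now \<open>det (1 + C\<^sup>T C)\<close> is the squared Hilbert-Schmidt norm of the action of \<open>C\<close> on the
  whole exterior algebra, so it is submultiplicative (\<open>gram_det_mult\<close>), and it is at least \<open>1\<close>
  even when \<open>L n\<close> is singular. Hence Kingman's theorem for nonnegative subadditive processes
  (\<open>kingman\<close>) applies for every \<open>t\<close> and gives a limit \<open>G t\<close>, the same for almost every
  point. The function \<open>G\<close> determines the limiting exponents of the singular values, with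
  multiplicity (\<open>spectral_gap_exists\<close>): either \<open>G = 0\<close>, and all vectors decay faster than any
  exponential, so the only exponent is \<open>-\<infinity>\<close>; or there are \<open>l' < l\<close> such that, for some \<open>p \<ge> 1\<close>,
  exactly \<open>p\<close> singular values grow like \<open>exp (n l)\<close> and the others at most like \<open>exp (n l')\<close>.

  The slow subspace. Let \<open>\<Pi> n\<close> be the projection onto the slow singular directions of \<open>L n\<close>. A
  unit vector that is slow at time \<open>n\<close> and has a component of size \<open>c\<close> in the fast directions of time
  \<open>n + 1\<close> is stretched at time \<open>n + 1\<close> by at least \<open>c exp (n (l - \<epsilon>))\<close> and by at most \<open>exp (n (l' + \<epsilon>))\<close>,
  because \<open>L (n + 1) = B n ** L n\<close> with \<open>B n\<close> subexponential. So \<open>\<Pi> n\<close> converges to a projection \<open>P\<close> with an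
  error of order \<open>exp (- n (l - l' - \<epsilon>))\<close>. This rate compensates the factor \<open>exp (n l)\<close> by which \<open>L n\<close>
  can stretch the error: vectors in the range of \<open>P\<close> grow at most like \<open>exp (n l')\<close>, and all other vectors
  grow exactly like \<open>exp (n l)\<close> (\<open>splits_growth_P\<close>). The projection \<open>P\<close> depends measurably on
  the point since it is also the limit of the resolvents \<open>(1 + exp (- 2 n \<theta>) L\<^sup>T L)\<^sup>-\<^sup>1\<close> for \<open>\<theta>\<close>
  halfway between \<open>l'\<close> and \<open>l\<close> (\<open>resolvent_tendsto\<close>).

  Induction. Within a given bundle, the vectors growing more slowly than \<open>exp (n l)\<close> form an invariant
  measurable sub-bundle of smaller constant dimension (\<open>slow_subbundle\<close>). Restricting the cocycle
  to it and repeating the argument yields the filtration (\<open>filtration_exists\<close>).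
\<close>

section \<open>Measure-preserving maps and the maximal ergodic inequality\<close>

locale measure_preserving = prob_space M for M :: "'a measure" +
  fixes T :: "'a \<Rightarrow> 'a"
  assumes T_measurable[measurable]: "T \<in> measurable M M"
    and distr_T: "distr M M T = M"
begin

lemma T_pow_measurable[measurable]: "T ^^ n \<in> measurable M M"
  by (induction n) (auto intro: measurable_comp[OF _ T_measurable] simp: id_def)

lemma T_pow_space: "x \<in> space M \<Longrightarrow> (T ^^ n) x \<in> space M"
  using measurable_space[OF T_pow_measurable] .

lemma distr_T_pow: "distr M M (T ^^ n) = M"
proof (induction n)
  case 0
  show ?case by (simp add: id_def distr_id)
next
  case (Suc n)
  have "distr M M (T ^^ Suc n) = distr (distr M M (T ^^ n)) M T"
    by (subst distr_distr) auto
  then show ?case unfolding Suc distr_T .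
qed

lemma measure_preserving_pow: "measure_preserving M (T ^^ n)"
  by unfold_locales (auto simp: distr_T_pow)

lemma integrable_comp_pow:
  fixes f :: "'a \<Rightarrow> real"
  assumes "integrable M f"
  shows "integrable M (\<lambda>x. f ((T ^^ n) x))"
proof -
  have "integrable (distr M M (T ^^ n)) f" using assms by (simp add: distr_T_pow)
  then show ?thesis by (rule integrable_distr[OF T_pow_measurable])
qed

lemma integral_comp_pow:
  fixes f :: "'a \<Rightarrow> real"
  assumes [measurable]: "f \<in> borel_measurable M"
  shows "(\<integral>x. f ((T ^^ n) x) \<partial>M) = (\<integral>x. f x \<partial>M)"
  using integral_distr[OF T_pow_measurable[of n], of f] by (simp add: distr_T_pow)

lemma AE_comp_pow:
  assumes "AE x in M. P x"
  shows "AE x in M. P ((T ^^ n) x)"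
proof -
  have "AE x in distr M M (T ^^ n). P x" unfolding distr_T_pow by (fact assms)
  then show ?thesis by (rule AE_distrD[OF T_pow_measurable])
qed

lemma AE_all_iterates:
  assumes "AE x in M. P x"
  shows "AE x in M. \<forall>n. P ((T ^^ n) x)"
  by (subst AE_all_countable) (use AE_comp_pow[OF assms] in blast)

text \<open>
  \<open>max_sum g n\<close> is the maximum of \<open>0\<close> and of the first \<open>n\<close> Birkhoff sums of \<open>g\<close>. The recursion
  is the identity on which Garsia's proof of the maximal inequality rests.
\<close>

primrec max_sum :: "('a \<Rightarrow> real) \<Rightarrow> nat \<Rightarrow> 'a \<Rightarrow> real" where
  "max_sum g 0 x = 0"
| "max_sum g (Suc n) x = max 0 (g x + max_sum g n (T x))"

lemma max_sum_mono: "max_sum g n x \<le> max_sum g (Suc n) x"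
proof (induction n arbitrary: x)
  case (Suc n)
  show ?case using Suc[of "T x"] by (simp add: max_def)
qed auto

lemma max_sum_mono': "m \<le> n \<Longrightarrow> max_sum g m x \<le> max_sum g n x"
  by (rule lift_Suc_mono_le[of "\<lambda>n. max_sum g n x"]) (rule max_sum_mono)

lemma max_sum_nonneg: "0 \<le> max_sum g n x"
  by (cases n) auto

lemma sum_le_max_sum: "(\<Sum>i<n. g ((T ^^ i) x)) \<le> max_sum g n x"
proof (induction n arbitrary: x)
  case (Suc n)
  have "(\<Sum>i<Suc n. g ((T ^^ i) x)) = g x + (\<Sum>i<n. g ((T ^^ i) (T x)))"
    by (subst sum.lessThan_Suc_shift) (simp add: funpow_swap1)
  then show ?case using Suc[of "T x"] by simp
qed auto

lemma max_sum_integrable: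
  assumes "integrable M g"
  shows "integrable M (max_sum g n)"
proof (induction n)
  case (Suc n)
  have "integrable M (\<lambda>x. max_sum g n (T x))"
    using integrable_comp_pow[OF Suc, of 1] by simp
  then show ?case using assms by (simp add: integrable_max)
qed auto

text \<open>
  Garsia's argument. Where the maximal sum \<open>m\<^sub>n\<^sub>+\<^sub>1\<close> is positive, it equals \<open>g + m\<^sub>n \<circ> T\<close>;
  elsewhere it vanishes while \<open>m\<^sub>n \<circ> T\<close> is nonnegative. Integrating and using \<open>m\<^sub>n \<le> m\<^sub>n\<^sub>+\<^sub>1\<close> shows that \<open>g\<close> has nonnegative
  integral over the set where \<open>m\<^sub>n\<^sub>+\<^sub>1\<close> is positive, and these sets exhaust the space.
  The inequality will be applied to powers of an ergodic map, which need not be ergodic.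
\<close>

lemma maximal_ergodic:
  fixes g :: "'a \<Rightarrow> real"
  assumes g: "integrable M g"
    and pos: "AE x in M. \<exists>n. (\<Sum>i<n. g ((T ^^ i) x)) > 0"
  shows "(\<integral>x. g x \<partial>M) \<ge> 0"
proof -
  have [measurable]: "g \<in> borel_measurable M" using g by auto
  have int: "integrable M (max_sum g n)" for n by (rule max_sum_integrable[OF g])
  have [measurable]: "max_sum g n \<in> borel_measurable M" for n using int by auto
  let ?f = "\<lambda>n x. g x * indicator {x \<in> space M. max_sum g (Suc n) x > 0} x"
  have fint: "integrable M (?f n)" for n
    by (rule integrable_real_mult_indicator) (auto simp: g)
  have ge: "(\<integral>x. ?f n x \<partial>M) \<ge> 0" for n
  proof -
    have intT: "integrable M (\<lambda>x. max_sum g n (T x))"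
      using integrable_comp_pow[OF int[of n], of 1] by simp
    have "(\<integral>x. max_sum g n x \<partial>M) \<le> (\<integral>x. max_sum g (Suc n) x \<partial>M)"
      by (rule integral_mono[OF int[of n] int[of "Suc n"] max_sum_mono])
    moreover have "(\<integral>x. max_sum g n (T x) \<partial>M) = (\<integral>x. max_sum g n x \<partial>M)"
      using integral_comp_pow[of "max_sum g n" 1] by simp
    moreover have "(\<integral>x. max_sum g (Suc n) x - max_sum g n (T x) \<partial>M)
      = (\<integral>x. max_sum g (Suc n) x \<partial>M) - (\<integral>x. max_sum g n (T x) \<partial>M)"
      by (rule Bochner_Integration.integral_diff[OF int[of "Suc n"] intT])
    moreover have "(\<integral>x. max_sum g (Suc n) x - max_sum g n (T x) \<partial>M) \<le> (\<integral>x. ?f n x \<partial>M)"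
    proof (rule integral_mono[OF _ fint])
      show "integrable M (\<lambda>x. max_sum g (Suc n) x - max_sum g n (T x))"
        by (rule Bochner_Integration.integrable_diff[OF int[of "Suc n"] intT])
      fix x assume "x \<in> space M"
      then show "max_sum g (Suc n) x - max_sum g n (T x) \<le> ?f n x"
        using max_sum_nonneg[of g n "T x"] by (auto simp: indicator_def max_def)
    qed
    ultimately show ?thesis by linarith
  qed
  have "(\<lambda>n. \<integral>x. ?f n x \<partial>M) \<longlonglongrightarrow> (\<integral>x. g x \<partial>M)"
  proof (rule integral_dominated_convergence[where w="\<lambda>x. \<bar>g x\<bar>"])
    show "AE x in M. (\<lambda>n. ?f n x) \<longlonglongrightarrow> g x"
      using pos AE_space
    proof eventually_elim
      case (elim x)
      then obtain k where k: "(\<Sum>i<k. g ((T ^^ i) x)) > 0" by blast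
      have "max_sum g (Suc n) x > 0" if "n \<ge> k" for n
        using k sum_le_max_sum[of g x k] max_sum_mono'[of k "Suc n" g x] that by linarith
      then have "\<forall>\<^sub>F n in sequentially. ?f n x = g x"
        using elim by (auto simp: eventually_sequentially intro!: exI[of _ k])
      then show ?case by (rule tendsto_eventually)
    qed
  qed (use g in \<open>auto simp: indicator_def\<close>)
  then show ?thesis using ge by (meson LIMSEQ_le_const)
qed

end

section \<open>Ergodic maps: the theorems of Birkhoff and Kingman\<close>

locale ergodic_map = measure_preserving +
  assumes ergodic: "B \<in> sets M \<Longrightarrow> T -` B \<inter> space M = B \<Longrightarrow> measure M B = 0 \<or> measure M B = 1"
begin

text \<open>
  The increasing union of the preimages of \<open>B\<close> is strictly invariant and has the measure of \<open>B\<close>.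
\<close>

lemma ergodic_sub:
  assumes B[measurable]: "B \<in> sets M" and sub: "\<And>x. x \<in> B \<Longrightarrow> T x \<in> B"
  shows "(AE x in M. x \<in> B) \<or> (AE x in M. x \<notin> B)"
proof -
  define C where "C = (\<Union>n. (T ^^ n) -` B \<inter> space M)"
  have C[measurable]: "C \<in> sets M" unfolding C_def by measurable
  have "T -` C \<inter> space M = C"
  proof (intro set_eqI iffI)
    fix x assume "x \<in> T -` C \<inter> space M"
    then obtain n where "(T ^^ n) (T x) \<in> B" "x \<in> space M" unfolding C_def by auto
    then show "x \<in> C" unfolding C_def using funpow_swap1[of T n x] by (auto intro!: exI[of _ "Suc n"])
  next
    fix x assume "x \<in> C"
    then obtain n where n: "(T ^^ n) x \<in> B" "x \<in> space M" unfolding C_def by auto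
    then have "(T ^^ n) (T x) \<in> B" using sub[of "(T ^^ n) x"] funpow_swap1[of T n x] by simp
    then show "x \<in> T -` C \<inter> space M" unfolding C_def using n measurable_space[OF T_measurable] by auto
  qed
  then have C01: "measure M C = 0 \<or> measure M C = 1" by (rule ergodic[OF C])
  have step: "measure M ((T ^^ n) -` B \<inter> space M) = measure M B" for n
    using measure_distr[OF T_pow_measurable[of n] B] by (simp add: distr_T_pow)
  have inc: "incseq (\<lambda>n. (T ^^ n) -` B \<inter> space M)"
    by (rule incseq_SucI) (use sub in auto)
  have "(\<lambda>n. measure M ((T ^^ n) -` B \<inter> space M)) \<longlonglongrightarrow> measure M C"
    unfolding C_def by (rule finite_Lim_measure_incseq) (use inc in auto)
  then have "measure M C = measure M B"
    unfolding step by (simp add: LIMSEQ_const_iff)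
  with C01 have "measure M B = 0 \<or> measure M B = 1" by simp
  then show ?thesis
  proof
    assume "measure M B = 0"
    then have "AE x in M. x \<notin> B"
      using AE_iff_null_sets[OF B] B by (auto simp: emeasure_eq_measure)
    then show ?thesis ..
  next
    assume "measure M B = 1"
    then have "AE x in M. x \<in> B" using prob_eq_1[of B] B by auto
    then show ?thesis ..
  qed
qed

text \<open>
  Growth rates of subadditive processes can only be compared with their values at the image point
  by an inequality; monotonicity along orbits is enough for ergodicity to make them constant.
\<close>

lemma AE_const:
  fixes f :: "'a \<Rightarrow> ereal"
  assumes [measurable]: "f \<in> borel_measurable M" and le: "\<And>x. x \<in> space M \<Longrightarrow> f x \<le> f (T x)"
  shows "\<exists>c. AE x in M. f x = c"
proof -
  have "(AE x in M. f x > ereal (real_of_rat q)) \<or> (AE x in M. \<not> f x > ereal (real_of_rat q))" for q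
  proof -
    let ?B = "{x \<in> space M. f x > ereal (real_of_rat q)}"
    have "(AE x in M. x \<in> ?B) \<or> (AE x in M. x \<notin> ?B)"
      by (rule ergodic_sub) (auto intro: less_le_trans[OF _ le] measurable_space[OF T_measurable])
    then show ?thesis by auto
  qed
  then have "AE x in M. f x > ereal (real_of_rat q) \<longleftrightarrow> (AE x in M. f x > ereal (real_of_rat q))" for q
    by (cases "AE x in M. f x > ereal (real_of_rat q)") auto
  then have ae: "AE x in M. \<forall>q. f x > ereal (real_of_rat q) \<longleftrightarrow> (AE x in M. f x > ereal (real_of_rat q))"
    by (simp add: AE_all_countable)
  then obtain x0 where x0: "\<forall>q. f x0 > ereal (real_of_rat q) \<longleftrightarrow> (AE x in M. f x > ereal (real_of_rat q))"
    using AE_False eventually_mono[OF ae, of "\<lambda>_. False"] by blast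
  have "AE x in M. f x = f x0"
    using ae
  proof eventually_elim
    case (elim x)
    have eq: "f x > ereal (real_of_rat q) \<longleftrightarrow> f x0 > ereal (real_of_rat q)" for q
      using elim x0 by blast
    show ?case
    proof (rule ccontr)
      assume "f x \<noteq> f x0"
      then obtain a b where "a < b" and ab: "{a, b} = {f x, f x0}"
        using linorder_neqE[of "f x" "f x0"] insert_commute[of "f x" "f x0"] by metis
      obtain r where r: "a < ereal r" "ereal r < b" using ereal_dense2[OF \<open>a < b\<close>] by blast
      obtain r' where r': "ereal r < ereal r'" "ereal r' < b" using ereal_dense2[OF r(2)] by blast
      obtain q where q: "r < real_of_rat q" "real_of_rat q < r'" using of_rat_dense[of r r'] r'(1) by auto
      have "a < ereal (real_of_rat q)" "ereal (real_of_rat q) < b"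
        using r r' q by (meson less_ereal.simps(1) less_trans)+
      then show False using eq[of q] ab by (auto simp: doubleton_eq_iff)
    qed
  qed
  then show ?thesis ..
qed

lemma subadditive_le_sum:
  fixes h :: "nat \<Rightarrow> 'a \<Rightarrow> real"
  assumes sub: "\<And>n m x. x \<in> space M \<Longrightarrow> h (n + m) x \<le> h n x + h m ((T ^^ n) x)"
    and "x \<in> space M" "n \<ge> 1"
  shows "h n x \<le> (\<Sum>i<n. h 1 ((T ^^ i) x))"
  using \<open>n \<ge> 1\<close>
proof (induction n rule: dec_induct)
  case (step n)
  then show ?case using sub[of x n 1] assms(2) by simp
qed simp

text \<open>
  The covering argument of Katznelson and Weiss. Walk along the orbit of \<open>x\<close>: from a point
  outside \<open>B\<close> jump over a block of length at most \<open>N\<close> on which \<open>h\<close> is at most \<open>a\<close> times the length; from a point of \<open>B\<close>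
  make a single step, at the cost \<open>h 1\<close>. The walk stops within the last \<open>N\<close> steps, which are paid for by
  the last sum.
\<close>

lemma subadditive_cover:
  fixes h :: "nat \<Rightarrow> 'a \<Rightarrow> real"
  assumes sub: "\<And>n m x. x \<in> space M \<Longrightarrow> h (n + m) x \<le> h n x + h m ((T ^^ n) x)"
    and nonneg: "\<And>n x. x \<in> space M \<Longrightarrow> h n x \<ge> 0"
    and a: "a \<ge> 0"
    and good: "\<And>x. x \<in> space M \<Longrightarrow> x \<notin> B \<Longrightarrow> \<exists>n\<ge>1. n \<le> N \<and> h n x \<le> real n * a"
    and N: "N \<ge> 1" and x: "x \<in> space M" and n: "n \<ge> 1"
  shows "h n x \<le> real n * a + (\<Sum>i<n. indicator B ((T ^^ i) x) * h 1 ((T ^^ i) x))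
     + (\<Sum>i | i < n \<and> n \<le> i + N. h 1 ((T ^^ i) x))"
  using x n
proof (induction n arbitrary: x rule: less_induct)
  case (less n)
  note x = \<open>x \<in> space M\<close>
  have nn: "h k ((T ^^ i) x) \<ge> 0" for k i using nonneg[OF T_pow_space[OF x]] .
  have shift: "(T ^^ i) ((T ^^ k) x) = (T ^^ (i + k)) x" for i k by (simp add: funpow_add)
  have tail: "(\<Sum>i | i < n - k \<and> n - k \<le> i + N. h 1 ((T ^^ i) ((T ^^ k) x)))
     \<le> (\<Sum>i | i < n \<and> n \<le> i + N. h 1 ((T ^^ i) x))" if "k \<le> n" for k
  proof -
    have "(\<Sum>i | i < n - k \<and> n - k \<le> i + N. h 1 ((T ^^ i) ((T ^^ k) x)))
      = (\<Sum>i \<in> (\<lambda>i. i + k) ` {i. i < n - k \<and> n - k \<le> i + N}. h 1 ((T ^^ i) x))"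
      by (subst sum.reindex) (auto simp: shift)
    also have "\<dots> \<le> (\<Sum>i | i < n \<and> n \<le> i + N. h 1 ((T ^^ i) x))"
      by (rule sum_mono2) (use nn that in auto)
    finally show ?thesis .
  qed
  let ?b = "\<lambda>i. indicator B ((T ^^ i) x) * h 1 ((T ^^ i) x) :: real"
  have split: "(\<Sum>i<k. ?b i) + (\<Sum>i<n - k. indicator B ((T ^^ i) ((T ^^ k) x)) * h 1 ((T ^^ i) ((T ^^ k) x)))
      = (\<Sum>i<n. ?b i)" if "k \<le> n" for k
  proof -
    have "(\<Sum>i<n. ?b i) = (\<Sum>i<k. ?b i) + (\<Sum>i\<in>{k..<n}. ?b i)"
      using sum.atLeastLessThan_concat[of 0 k n ?b] that by (simp add: lessThan_atLeast0)
    also have "(\<Sum>i\<in>{k..<n}. ?b i) = (\<Sum>i<n - k. ?b (i + k))"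
      by (rule sum.reindex_bij_witness[of _ "\<lambda>i. i + k" "\<lambda>i. i - k"]) (use that in auto)
    finally show ?thesis by (simp add: shift)
  qed
  have bnn: "(\<Sum>i<k. ?b i) \<ge> 0" for k using nn by (intro sum_nonneg) auto
  show ?case
  proof (cases "n \<le> N")
    case True
    then have eq: "{i. i < n \<and> n \<le> i + N} = {..<n}" by auto
    have "h n x \<le> (\<Sum>i<n. h 1 ((T ^^ i) x))"
      by (rule subadditive_le_sum) (use sub x \<open>n \<ge> 1\<close> in auto)
    moreover have "0 \<le> real n * a" using a by simp
    ultimately show ?thesis unfolding eq using bnn[of n] by linarith
  next
    case False
    have "\<exists>k\<ge>1. k < n \<and> h k x \<le> real k * a + (\<Sum>i<k. ?b i)"
    proof (cases "x \<in> B")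
      case True
      have "1 < n" using False N by simp
      then show ?thesis using True a by (intro exI[of _ 1]) auto
    next
      case xB: False
      obtain k where k: "k \<ge> 1" "k \<le> N" "h k x \<le> real k * a" using good[OF x xB] by blast
      then have "k < n" "h k x \<le> real k * a + (\<Sum>i<k. ?b i)" using bnn[of k] False by auto
      with k show ?thesis by blast
    qed
    then obtain k where k: "k \<ge> 1" "k < n" "h k x \<le> real k * a + (\<Sum>i<k. ?b i)" by blast
    have 1: "h n x \<le> h k x + h (n - k) ((T ^^ k) x)" using sub[OF x, of k "n - k"] k(2) by simp
    have "real n = real k + real (n - k)" using k(2) by simp
    then have 2: "real n * a = real k * a + real (n - k) * a" by (metis distrib_right)
    have 3: "h (n - k) ((T ^^ k) x) \<le> real (n - k) * a
      + (\<Sum>i<n - k. indicator B ((T ^^ i) ((T ^^ k) x)) * h 1 ((T ^^ i) ((T ^^ k) x)))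
      + (\<Sum>i | i < n - k \<and> n - k \<le> i + N. h 1 ((T ^^ i) ((T ^^ k) x)))"
      by (rule less.IH) (use k T_pow_space[OF x] in auto)
    have combine: "u \<le> na + b + t"
      if "u \<le> p + q" "p \<le> ka + bk" "q \<le> na' + b' + t'" "na = ka + na'" "t' \<le> t" "bk + b' = b"
      for u p q ka bk na na' b b' t t' :: real
      using that by linarith
    show ?thesis
      by (rule combine[OF 1 k(3) 3 2 tail[OF less_imp_le[OF k(2)]] split[OF less_imp_le[OF k(2)]]])
  qed
qed

text \<open>
  Integrate the covering estimate, with \<open>B\<close> the set of points at which no block of length up to
  \<open>N\<close> is good. This set shrinks to a null set as \<open>N\<close> grows, and the contribution of the end of the orbit is bounded by
  \<open>N\<close> times the integral of \<open>h 1\<close>, which is negligible against \<open>n\<close>.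
\<close>

lemma kingman_lower:
  fixes h :: "nat \<Rightarrow> 'a \<Rightarrow> real"
  assumes meas[measurable]: "\<And>n. h n \<in> borel_measurable M"
    and sub: "\<And>n m x. x \<in> space M \<Longrightarrow> h (n + m) x \<le> h n x + h m ((T ^^ n) x)"
    and nonneg: "\<And>n x. x \<in> space M \<Longrightarrow> h n x \<ge> 0"
    and int: "integrable M (h 1)"
    and a: "a \<ge> 0" and ae: "AE x in M. \<exists>n\<ge>1. h n x \<le> real n * a" and e: "e > 0"
  shows "\<exists>n\<ge>1. (\<integral>x. h n x \<partial>M) \<le> real n * (a + e)"
proof -
  define B where "B N = {x \<in> space M. \<forall>n\<in>{1..N}. h n x > real n * a}" for N :: nat
  have B[measurable]: "B N \<in> sets M" for N unfolding B_def by measurable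
  have "(\<lambda>N. \<integral>x. indicator (B N) x * h 1 x \<partial>M) \<longlonglongrightarrow> (\<integral>x. 0 \<partial>M)"
  proof (rule integral_dominated_convergence[where w="h 1"])
    show "AE x in M. (\<lambda>N. indicator (B N) x * h 1 x) \<longlonglongrightarrow> 0"
      using ae
    proof eventually_elim
      case (elim x)
      then obtain n where n: "n \<ge> 1" "h n x \<le> real n * a" by blast
      have "x \<notin> B N" if "N \<ge> n" for N
        using that n unfolding B_def by (auto simp: not_less intro!: bexI[of _ n])
      then have "\<forall>\<^sub>F N in sequentially. indicator (B N) x * h 1 x = 0"
        unfolding eventually_sequentially by (intro exI[of _ n]) auto
      then show ?case by (rule tendsto_eventually)
    qed
    show "AE x in M. norm (indicator (B N) x * h 1 x) \<le> h 1 x" for N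
      by (rule AE_I2) (auto simp: nonneg indicator_def)
  qed (use int in auto)
  then have "\<forall>\<^sub>F N in sequentially. (\<integral>x. indicator (B N) x * h 1 x \<partial>M) < e / 2"
    using e by (intro order_tendstoD(2)) auto
  then obtain N0 where "\<And>N. N \<ge> N0 \<Longrightarrow> (\<integral>x. indicator (B N) x * h 1 x \<partial>M) < e / 2"
    unfolding eventually_sequentially by blast
  note N0 = this
  \<comment> \<open>The block length has to be positive for the covering estimate.\<close>
  define N where "N = max N0 1"
  have N: "N \<ge> 1" "(\<integral>x. indicator (B N) x * h 1 x \<partial>M) < e / 2"
    using N0[of N] by (auto simp: N_def)
  let ?I = "\<integral>x. h 1 x \<partial>M"
  have I: "?I \<ge> 0" by (rule integral_nonneg_AE) (auto simp: nonneg)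
  obtain n0 where n0: "real N * ?I / (e / 2) < real n0" using reals_Archimedean2 by blast
  define n where "n = max n0 1"
  have n: "real n > real N * ?I / (e / 2)" "n \<ge> 1" using n0 by (auto simp: n_def)
  define b where "b x = indicator (B N) x * h 1 x" for x
  have bint: "integrable M b"
    unfolding b_def using integrable_real_mult_indicator[OF B int] by (simp add: mult.commute)
  have [measurable]: "b \<in> borel_measurable M" using bint by auto
  let ?J = "{i. i < n \<and> n \<le> i + N}"
  define g where "g x = real n * a + (\<Sum>i<n. b ((T ^^ i) x)) + (\<Sum>i\<in>?J. h 1 ((T ^^ i) x))" for x
  have hg: "h n x \<le> g x" if x: "x \<in> space M" for x
  proof -
    have "\<exists>n\<ge>1. n \<le> N \<and> h n x \<le> real n * a" if "x \<in> space M" "x \<notin> B N" for x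
    proof -
      obtain m where "m \<in> {1..N}" "\<not> h m x > real m * a" using \<open>x \<in> space M\<close> \<open>x \<notin> B N\<close> unfolding B_def by blast
      then show ?thesis by (intro exI[of _ m]) auto
    qed
    note good = this
    have "h n x \<le> real n * a + (\<Sum>i<n. indicator (B N) ((T ^^ i) x) * h 1 ((T ^^ i) x))
     + (\<Sum>i | i < n \<and> n \<le> i + N. h 1 ((T ^^ i) x))"
      by (rule subadditive_cover) (fact sub nonneg a good N(1) x n(2))+
    then show ?thesis by (simp only: b_def g_def)
  qed
  have gint: "integrable M g" unfolding g_def
    using integrable_comp_pow[OF bint] integrable_comp_pow[OF int]
    by (intro Bochner_Integration.integrable_add Bochner_Integration.integrable_sum) auto
  have hint: "integrable M (h n)"
  proof (rule Bochner_Integration.integrable_bound[OF gint])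
    show "AE x in M. norm (h n x) \<le> norm (g x)"
      by (rule AE_I2) (use hg nonneg[of _ n] in \<open>auto intro: order_trans[OF _ abs_ge_self]\<close>)
  qed auto
  have "(\<integral>x. h n x \<partial>M) \<le> (\<integral>x. g x \<partial>M)"
    by (rule integral_mono[OF hint gint hg])
  also have "\<dots> = real n * a + real n * (\<integral>x. b x \<partial>M) + real (card ?J) * ?I"
    unfolding g_def
    using integral_comp_pow[of b] integral_comp_pow[of "h 1"] integrable_comp_pow[OF bint] integrable_comp_pow[OF int]
    by (simp add: Bochner_Integration.integral_add Bochner_Integration.integral_sum prob_space)
  also have "\<dots> \<le> real n * a + real n * (e / 2) + real N * ?I"
  proof (intro add_mono mult_left_mono mult_right_mono order_refl)
    have "?J \<subseteq> {n - N..<n}" by auto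
    from card_mono[OF _ this] show "real (card ?J) \<le> real N" by simp
  qed (use N I in \<open>auto simp: b_def\<close>)
  also have "\<dots> \<le> real n * (a + e)"
    using n(1) e by (simp add: field_simps)
  finally show ?thesis using n(2) by blast
qed

text \<open>
  Both limits are monotone along orbits, because \<open>h (n + 1) x\<close> is at most \<open>h 1 x + h n (T x)\<close>.
\<close>

lemma limits_subadditive:
  fixes h :: "nat \<Rightarrow> 'a \<Rightarrow> real"
  assumes meas[measurable]: "\<And>n. h n \<in> borel_measurable M"
    and sub: "\<And>n m x. x \<in> space M \<Longrightarrow> h (n + m) x \<le> h n x + h m ((T ^^ n) x)"
    and nonneg: "\<And>n x. x \<in> space M \<Longrightarrow> h n x \<ge> 0"
  shows "\<exists>c. AE x in M. liminf (\<lambda>n. ereal (h n x / real n)) = c" (is ?inf)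
    and "\<exists>c. AE x in M. limsup (\<lambda>n. ereal (h n x / real n)) = c" (is ?sup)
proof -
  have *: "ereal (h (n + 1) x / real (n + 1)) \<le> ereal (h 1 x / real (n + 1)) + ereal (h n (T x) / real n)"
    if x: "x \<in> space M" and n: "n \<ge> 1" for x n
  proof -
    have "h (n + 1) x / real (n + 1) \<le> h 1 x / real (n + 1) + h n (T x) / real (n + 1)"
      using sub[OF x, of 1 n] by (simp add: add_divide_distrib[symmetric] divide_right_mono add.commute)
    also have "h n (T x) / real (n + 1) \<le> h n (T x) / real n"
      using n nonneg[OF measurable_space[OF T_measurable x]] by (intro divide_left_mono) auto
    finally show ?thesis by simp
  qed
  have lim0: "(\<lambda>n. ereal (h 1 x / real (n + 1))) \<longlonglongrightarrow> ereal 0" for x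
    by (intro tendsto_ereal) (rule LIMSEQ_ignore_initial_segment[OF lim_const_over_n])
  have ev: "\<forall>\<^sub>F n in sequentially. ereal (h (n + 1) x / real (n + 1)) \<le> ereal (h 1 x / real (n + 1)) + ereal (h n (T x) / real n)"
    if "x \<in> space M" for x
    using *[OF that] by (auto simp: eventually_sequentially)
  show ?inf
  proof (rule AE_const)
    fix x assume x: "x \<in> space M"
    have "liminf (\<lambda>n. ereal (h n x / real n)) = liminf (\<lambda>n. ereal (h (n + 1) x / real (n + 1)))"
      using liminf_shift[of "\<lambda>n. ereal (h n x / real n)"] by simp
    also have "\<dots> \<le> liminf (\<lambda>n. ereal (h 1 x / real (n + 1)) + ereal (h n (T x) / real n))"
      by (rule Liminf_mono[OF ev[OF x]])
    also have "\<dots> = ereal 0 + liminf (\<lambda>n. ereal (h n (T x) / real n))"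
      by (rule ereal_liminf_lim_add[OF lim0]) auto
    finally show "liminf (\<lambda>n. ereal (h n x / real n)) \<le> liminf (\<lambda>n. ereal (h n (T x) / real n))"
      by (simp add: zero_ereal_def[symmetric])
  qed measurable
  show ?sup
  proof (rule AE_const)
    fix x assume x: "x \<in> space M"
    have "limsup (\<lambda>n. ereal (h n x / real n)) = limsup (\<lambda>n. ereal (h (n + 1) x / real (n + 1)))"
      using limsup_shift[of "\<lambda>n. ereal (h n x / real n)"] by simp
    also have "\<dots> \<le> limsup (\<lambda>n. ereal (h 1 x / real (n + 1)) + ereal (h n (T x) / real n))"
      by (rule Limsup_mono[OF ev[OF x]])
    also have "\<dots> = ereal 0 + limsup (\<lambda>n. ereal (h n (T x) / real n))"
      by (rule ereal_limsup_lim_add[OF lim0]) auto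
    finally show "limsup (\<lambda>n. ereal (h n x / real n)) \<le> limsup (\<lambda>n. ereal (h n (T x) / real n))"
      by (simp add: zero_ereal_def[symmetric])
  qed measurable
qed

lemma ex_small_of_liminf:
  fixes h :: "nat \<Rightarrow> real"
  assumes "liminf (\<lambda>n. ereal (h n / real n)) < ereal a"
  shows "\<exists>n\<ge>1. h n \<le> real n * a"
proof -
  have "\<exists>n\<ge>1. ereal (h n / real n) < ereal a"
  proof (rule ccontr)
    assume "\<not> ?thesis"
    then have "ereal a \<le> liminf (\<lambda>n. ereal (h n / real n))"
      by (intro Liminf_bounded) (auto simp: eventually_sequentially not_less)
    then show False using assms by simp
  qed
  then obtain n where "n \<ge> 1" "h n / real n < a" by auto
  then show ?thesis by (intro exI[of _ n]) (auto simp: field_simps)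
qed

lemma ex_large_of_limsup:
  fixes h :: "nat \<Rightarrow> real"
  assumes "limsup (\<lambda>n. ereal (h n / real n)) > ereal a"
  shows "\<exists>n\<ge>n0. h n > real n * a"
proof -
  have "\<exists>n\<ge>max n0 1. ereal (h n / real n) > ereal a"
  proof (rule ccontr)
    assume "\<not> ?thesis"
    then have "limsup (\<lambda>n. ereal (h n / real n)) \<le> ereal a"
      by (intro Limsup_bounded) (auto simp: eventually_sequentially not_less intro!: exI[of _ "max n0 1"])
    then show False using assms by simp
  qed
  then obtain n where "n \<ge> max n0 1" "h n / real n > a" by auto
  then show ?thesis by (intro exI[of _ n]) (auto simp: field_simps)
qed

lemma tendsto_of_liminf_limsup:
  fixes h :: "nat \<Rightarrow> real"
  assumes "liminf (\<lambda>n. ereal (h n)) \<ge> ereal c" "limsup (\<lambda>n. ereal (h n)) \<le> ereal c"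
  shows "h \<longlonglongrightarrow> c"
proof -
  have "(\<lambda>n. ereal (h n)) \<longlonglongrightarrow> ereal c"
    using assms Liminf_le_Limsup[of sequentially "\<lambda>n. ereal (h n)"]
    by (intro Liminf_eq_Limsup) auto
  then show ?thesis by simp
qed

lemma AE_imp_ex_space:
  assumes "AE x in M. P x"
  shows "\<exists>x\<in>space M. P x"
proof (rule ccontr)
  assume "\<not> ?thesis"
  then have "\<And>x. x \<in> space M \<Longrightarrow> P x \<longrightarrow> False" by blast
  then have "AE x in M. P x \<longrightarrow> False" by (rule AE_I2)
  with assms have "AE x in M. False" by (rule AE_mp)
  then show False using AE_False by simp
qed

text \<open>
  The lower bound is the covering estimate for the additive process of Birkhoff sums; the upper
  bound is the maximal inequality applied to \<open>f - a\<close>.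
\<close>

lemma birkhoff:
  fixes f :: "'a \<Rightarrow> real"
  assumes f: "integrable M f" and nonneg: "\<And>x. x \<in> space M \<Longrightarrow> f x \<ge> 0"
  shows "AE x in M. (\<lambda>n. (\<Sum>i<n. f ((T ^^ i) x)) / real n) \<longlonglongrightarrow> (\<integral>x. f x \<partial>M)"
proof -
  define h where "h n x = (\<Sum>i<n. f ((T ^^ i) x))" for n x
  let ?I = "\<integral>x. f x \<partial>M"
  have [measurable]: "f \<in> borel_measurable M" using f by auto
  have hm[measurable]: "h n \<in> borel_measurable M" for n unfolding h_def by measurable
  have hnn: "h n x \<ge> 0" if "x \<in> space M" for n x
    unfolding h_def by (intro sum_nonneg nonneg T_pow_space that)
  have hadd: "h (n + m) x = h n x + h m ((T ^^ n) x)" for n m x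
  proof -
    have "h (n + m) x = (\<Sum>i<n. f ((T ^^ i) x)) + (\<Sum>i\<in>{n..<n+m}. f ((T ^^ i) x))"
      unfolding h_def using sum.atLeastLessThan_concat[of 0 n "n + m" "\<lambda>i. f ((T ^^ i) x)"] by (simp add: lessThan_atLeast0)
    also have "(\<Sum>i\<in>{n..<n+m}. f ((T ^^ i) x)) = (\<Sum>i<m. f ((T ^^ (i + n)) x))"
      by (rule sum.reindex_bij_witness[of _ "\<lambda>i. i + n" "\<lambda>i. i - n"]) auto
    finally show ?thesis by (simp add: h_def funpow_add)
  qed
  have h1: "h 1 = f" by (auto simp: h_def)
  have hint: "(\<integral>x. h n x \<partial>M) = real n * ?I" for n
    unfolding h_def using integral_comp_pow[of f] integrable_comp_pow[OF f]
    by (simp add: Bochner_Integration.integral_sum)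
  have I: "?I \<ge> 0" by (rule integral_nonneg_AE) (auto simp: nonneg)
  have "\<exists>c. AE x in M. liminf (\<lambda>n. ereal (h n x / real n)) = c"
    by (rule limits_subadditive(1)) (use hm hadd hnn in auto)
  then obtain l where l: "AE x in M. liminf (\<lambda>n. ereal (h n x / real n)) = l" by blast
  have "\<exists>c. AE x in M. limsup (\<lambda>n. ereal (h n x / real n)) = c"
    by (rule limits_subadditive(2)) (use hm hadd hnn in auto)
  then obtain u where u: "AE x in M. limsup (\<lambda>n. ereal (h n x / real n)) = u" by blast
  have l0: "l \<ge> 0"
  proof -
    obtain x where "x \<in> space M" "liminf (\<lambda>n. ereal (h n x / real n)) = l" using AE_imp_ex_space[OF l] by blast
    then show ?thesis using hnn by (auto intro!: Liminf_bounded)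
  qed
  have "ereal ?I \<le> l"
  proof (rule ccontr)
    assume "\<not> ?thesis"
    then obtain a where a: "l < ereal a" "ereal a < ereal ?I" using ereal_dense2[of l "ereal ?I"] by (auto simp: not_le)
    have a0: "a \<ge> 0" using a(1) l0 by (metis ereal_less_eq(5) less_imp_le order_trans)
    have "AE x in M. \<exists>n\<ge>1. h n x \<le> real n * a"
      using l by eventually_elim (rule ex_small_of_liminf, use a in simp)
    then have "\<exists>n\<ge>1. (\<integral>x. h n x \<partial>M) \<le> real n * (a + (?I - a) / 2)"
      by (intro kingman_lower[of h a "(?I - a) / 2"]) (use hm hnn hadd h1 f a a0 in auto)
    then obtain n where "n \<ge> 1" "(\<integral>x. h n x \<partial>M) \<le> real n * (a + (?I - a) / 2)" by auto
    then have "?I \<le> a + (?I - a) / 2" unfolding hint by simp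
    moreover have "a < ?I" using a(2) by simp
    ultimately show False by (simp add: field_simps)
  qed
  moreover have "u \<le> ereal ?I"
  proof (rule ccontr)
    assume "\<not> ?thesis"
    then obtain a where a: "ereal ?I < ereal a" "ereal a < u" using ereal_dense2[of "ereal ?I" u] by (auto simp: not_le)
    have "(\<integral>x. f x - a \<partial>M) \<ge> 0"
    proof (rule maximal_ergodic)
      show "AE x in M. \<exists>n. (\<Sum>i<n. f ((T ^^ i) x) - a) > 0"
        using u
      proof eventually_elim
        case (elim x)
        then obtain n where "h n x > real n * a" using ex_large_of_limsup[of a "\<lambda>n. h n x" 0] a by auto
        then show ?case by (intro exI[of _ n]) (simp add: h_def sum_subtractf)
      qed
    qed (use f in auto)
    then show False using a f by (simp add: Bochner_Integration.integral_diff prob_space)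
  qed
  ultimately have lu: "ereal ?I \<le> l" "u \<le> ereal ?I" by auto
  have "AE x in M. (\<lambda>n. h n x / real n) \<longlonglongrightarrow> ?I"
    using l u by eventually_elim (rule tendsto_of_liminf_limsup, use lu in auto)
  then show ?thesis by (simp add: h_def)
qed

text \<open>
  The difference of consecutive Birkhoff averages tends to \<open>0\<close>.
\<close>

lemma iterate_over_n_tendsto_0:
  fixes f :: "'a \<Rightarrow> real"
  assumes f: "integrable M f" and nonneg: "\<And>x. x \<in> space M \<Longrightarrow> f x \<ge> 0"
  shows "AE x in M. (\<lambda>n. f ((T ^^ n) x) / real n) \<longlonglongrightarrow> 0"
proof -
  have "AE x in M. (\<lambda>n. (\<Sum>i<n. f ((T ^^ i) x)) / real n) \<longlonglongrightarrow> (\<integral>x. f x \<partial>M)"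
    by (rule birkhoff) (fact f nonneg)+
  then show ?thesis
  proof eventually_elim
    case (elim x)
    let ?s = "\<lambda>n. (\<Sum>i<n. f ((T ^^ i) x))" and ?I = "\<integral>x. f x \<partial>M"
    have "(\<lambda>n. ?s (Suc n) / real (Suc n) * (real (Suc n) / real n) - ?s n / real n) \<longlonglongrightarrow> ?I * 1 - ?I"
      by (intro tendsto_intros LIMSEQ_Suc[OF elim] elim LIMSEQ_Suc_n_over_n)
    moreover have "\<forall>\<^sub>F n in sequentially. ?s (Suc n) / real (Suc n) * (real (Suc n) / real n) - ?s n / real n = f ((T ^^ n) x) / real n"
      by (rule eventually_sequentiallyI[of 1]) (simp add: field_simps del: of_nat_Suc)
    ultimately show ?case by (simp add: tendsto_cong)
  qed
qed

text \<open>
  The constant is the infimum of the normalised integrals of the \<open>h n\<close>. The lower limit is at least that by the covering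
  estimate. If the upper limit were larger, some \<open>h N\<close> would have an integral below \<open>N a\<close> although, along the
  multiples of \<open>N\<close>, the Birkhoff sums of \<open>h N\<close> for the map \<open>T ^^ N\<close> exceed those of \<open>N a\<close> at some time; this contradicts
  the maximal inequality for \<open>T ^^ N\<close>, which need not be ergodic.
\<close>

theorem kingman:
  fixes h :: "nat \<Rightarrow> 'a \<Rightarrow> real"
  assumes meas[measurable]: "\<And>n. h n \<in> borel_measurable M"
    and sub: "\<And>n m x. x \<in> space M \<Longrightarrow> h (n + m) x \<le> h n x + h m ((T ^^ n) x)"
    and nonneg: "\<And>n x. x \<in> space M \<Longrightarrow> h n x \<ge> 0"
    and int: "integrable M (h 1)"
  shows "\<exists>c. AE x in M. (\<lambda>n. h n x / real n) \<longlonglongrightarrow> c"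
proof -
  have "\<exists>c. AE x in M. liminf (\<lambda>n. ereal (h n x / real n)) = c"
    by (rule limits_subadditive(1)) (use meas sub nonneg in auto)
  then obtain l where l: "AE x in M. liminf (\<lambda>n. ereal (h n x / real n)) = l" by blast
  have "\<exists>c. AE x in M. limsup (\<lambda>n. ereal (h n x / real n)) = c"
    by (rule limits_subadditive(2)) (use meas sub nonneg in auto)
  then obtain u where u: "AE x in M. limsup (\<lambda>n. ereal (h n x / real n)) = u" by blast
  have l0: "l \<ge> 0"
  proof -
    obtain x where "x \<in> space M" "liminf (\<lambda>n. ereal (h n x / real n)) = l" using AE_imp_ex_space[OF l] by blast
    then show ?thesis using nonneg by (auto intro!: Liminf_bounded)
  qed
  have hint: "integrable M (h n)" if "n \<ge> 1" for n
  proof (rule Bochner_Integration.integrable_bound[where f="\<lambda>x. \<Sum>i<n. h 1 ((T ^^ i) x)"])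
    show "integrable M (\<lambda>x. \<Sum>i<n. h 1 ((T ^^ i) x))"
      by (rule Bochner_Integration.integrable_sum) (rule integrable_comp_pow[OF int])
    show "AE x in M. norm (h n x) \<le> norm (\<Sum>i<n. h 1 ((T ^^ i) x))"
    proof (rule AE_I2)
      fix x assume x: "x \<in> space M"
      have "h n x \<le> (\<Sum>i<n. h 1 ((T ^^ i) x))"
        by (rule subadditive_le_sum) (use sub x that in auto)
      then show "norm (h n x) \<le> norm (\<Sum>i<n. h 1 ((T ^^ i) x))" using nonneg[OF x, of n] by simp
    qed
  qed measurable
  define c where "c = (INF n\<in>{1::nat..}. (\<integral>x. h n x \<partial>M) / real n)"
  have I0: "(\<integral>x. h n x \<partial>M) \<ge> 0" for n by (rule integral_nonneg_AE) (auto simp: nonneg)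
  have bdd: "bdd_below ((\<lambda>n. (\<integral>x. h n x \<partial>M) / real n) ` {1::nat..})"
    by (rule bdd_belowI[of _ 0]) (auto simp: I0)
  have c_le: "c \<le> (\<integral>x. h n x \<partial>M) / real n" if "n \<ge> 1" for n
    unfolding c_def by (rule cINF_lower[OF bdd]) (use that in auto)
  have lower: "ereal c \<le> l"
  proof (rule ccontr)
    assume "\<not> ?thesis"
    then obtain a where a: "l < ereal a" "ereal a < ereal c" using ereal_dense2[of l "ereal c"] by (auto simp: not_le)
    have a0: "a \<ge> 0" using a(1) l0 by (metis ereal_less_eq(5) less_imp_le order_trans)
    have "AE x in M. \<exists>n\<ge>1. h n x \<le> real n * a"
      using l by eventually_elim (rule ex_small_of_liminf, use a in simp)
    then have "\<exists>n\<ge>1. (\<integral>x. h n x \<partial>M) \<le> real n * (a + (c - a) / 2)"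
      by (intro kingman_lower[of h a "(c - a) / 2"]) (use meas nonneg sub int a a0 in auto)
    then obtain n where n: "n \<ge> 1" "(\<integral>x. h n x \<partial>M) \<le> real n * (a + (c - a) / 2)" by auto
    have "(\<integral>x. h n x \<partial>M) / real n \<le> a + (c - a) / 2" using n by (simp add: field_simps)
    then have "c \<le> a + (c - a) / 2" using c_le[OF n(1)] by linarith
    moreover have "a < c" using a(2) by simp
    ultimately show False by (simp add: field_simps)
  qed
  have upper: "u \<le> ereal c"
  proof (rule ccontr)
    assume "\<not> ?thesis"
    then obtain b where b: "ereal c < ereal b" "ereal b < u" using ereal_dense2[of "ereal c" u] by (auto simp: not_le)
    have "\<exists>n\<in>{1::nat..}. (\<integral>x. h n x \<partial>M) / real n < b"
      using b(1) bdd unfolding c_def by (subst (asm) less_ereal.simps, subst (asm) cINF_less_iff) auto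
    then obtain N where N: "N \<ge> 1" "(\<integral>x. h N x \<partial>M) / real N < b" by auto
    obtain a where a: "(\<integral>x. h N x \<partial>M) / real N < a" "a < b" using dense[OF N(2)] by blast
    have a0: "a \<ge> 0"
      using a(1) I0[of N] by (meson divide_nonneg_nonneg less_imp_le of_nat_0_le_iff order_trans)
    \<comment> \<open>The allowance per step for replacing \<open>n\<close> by the largest multiple of \<open>N\<close> below it.\<close>
    define e where "e = (b - a) / real N"
    have e: "e > 0" using a N by (simp add: e_def)
    interpret pow: measure_preserving M "T ^^ N" by (rule measure_preserving_pow)
    have "AE x in M. (\<lambda>n. h 1 ((T ^^ n) x) / real n) \<longlonglongrightarrow> 0"
      by (rule iterate_over_n_tendsto_0) (use int nonneg in auto)
    then have ae: "AE x in M. \<exists>q. (\<Sum>i<q. h N (((T ^^ N) ^^ i) x) - real N * a) > 0"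
      using u AE_space
    proof eventually_elim
      case (elim x)
      have "\<forall>\<^sub>F n in sequentially. h 1 ((T ^^ n) x) / real n < e"
        by (rule order_tendstoD(2)[OF elim(1) e])
      then obtain n0 where n0: "\<And>n. n \<ge> n0 \<Longrightarrow> h 1 ((T ^^ n) x) / real n < e"
        unfolding eventually_sequentially by blast
      obtain n where n: "n \<ge> n0 + 2 * N" "h n x > real n * b"
        using ex_large_of_limsup[of b "\<lambda>n. h n x" "n0 + 2 * N"] elim(2) b(2) by auto
      define q where "q = n div N"
      define r where "r = n mod N"
      have nqr: "n = N * q + r" by (simp add: q_def r_def)
      have r: "r < N" using N(1) by (simp add: r_def)
      have q: "N * q \<ge> n0 + 1" using nqr r n(1) N(1) by linarith
      then have q1: "q \<ge> 1" by (cases q) auto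
      have powmult: "((T ^^ N) ^^ i) x = (T ^^ (N * i)) x" for i x
        by (simp add: funpow_mult mult.commute)
      have "h (N * q) x \<le> (\<Sum>i<q. h N (((T ^^ N) ^^ i) x))"
        using q1
      proof (induction q rule: dec_induct)
        case (step k)
        then show ?case using sub[OF elim(3), of "N * k" N] by (simp add: powmult add.commute)
      qed simp
      moreover have "h n x \<le> h (N * q) x + e * real N * real n"
      proof (cases "r = 0")
        case True
        then show ?thesis using nqr e by simp
      next
        case False
        have "h n x \<le> h (N * q) x + h r ((T ^^ (N * q)) x)"
          using sub[OF elim(3), of "N * q" r] nqr by simp
        also have "h r ((T ^^ (N * q)) x) \<le> (\<Sum>i<r. h 1 ((T ^^ i) ((T ^^ (N * q)) x)))"
          by (rule subadditive_le_sum) (use sub T_pow_space[OF elim(3)] False in auto)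
        also have "\<dots> \<le> (\<Sum>i<r. e * real n)"
        proof (rule sum_mono)
          fix i assume "i \<in> {..<r}"
          then have i: "i + N * q \<le> n" "i + N * q \<ge> n0" "i + N * q \<ge> 1" using nqr q by auto
          have "0 < real (i + N * q)" using i(3) by linarith
          from n0[OF i(2), unfolded pos_divide_less_eq[OF this]]
          have "h 1 ((T ^^ (i + N * q)) x) \<le> e * real (i + N * q)" by (rule less_imp_le)
          also have "\<dots> \<le> e * real n" using i(1) e by (intro mult_left_mono) (auto simp only: of_nat_le_iff)
          finally show "h 1 ((T ^^ i) ((T ^^ (N * q)) x)) \<le> e * real n" by (simp add: funpow_add)
        qed
        also have "\<dots> = real r * (e * real n)" by simp
        also have "\<dots> \<le> real N * (e * real n)" using r e by (intro mult_right_mono) auto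
        finally show ?thesis by (simp add: mult_ac)
      qed
      moreover have "e * real N * real n = (b - a) * real n" using N(1) by (simp add: e_def)
      ultimately have "(\<Sum>i<q. h N (((T ^^ N) ^^ i) x)) > real n * a"
        using n(2) by (simp add: algebra_simps)
      moreover have "real (N * q) * a \<le> real n * a"
        using a0 nqr by (intro mult_right_mono) (simp_all only: of_nat_le_iff)
      ultimately have "(\<Sum>i<q. h N (((T ^^ N) ^^ i) x) - real N * a) > 0"
        by (simp add: sum_subtractf mult_ac)
      then show ?case by blast
    qed
    have "0 \<le> (\<integral>x. h N x - real N * a \<partial>M)"
      by (rule pow.maximal_ergodic[OF _ ae]) (use hint N in auto)
    then have "real N * a \<le> (\<integral>x. h N x \<partial>M)"
      using hint[OF N(1)] by (simp add: Bochner_Integration.integral_diff prob_space)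
    then show False using a(1) N(1) by (simp add: field_simps)
  qed
  have "AE x in M. (\<lambda>n. h n x / real n) \<longlonglongrightarrow> c"
    using l u by eventually_elim (rule tendsto_of_liminf_limsup, use lower upper in auto)
  then show ?thesis by blast
qed

end

section \<open>Symmetric matrices and their eigenframes\<close>

lemma norm_matrix_vector_le: "norm (A *v x) \<le> norm A * norm x"
  for A :: "real ^ 'n ^ 'm"
proof -
  have "norm (A *v x) \<le> L2_set (\<lambda>i. norm (A $ i) * norm x) UNIV"
    unfolding norm_vec_def[of "A *v x"]
    by (rule L2_set_mono) (auto simp: matrix_vector_mul_component Cauchy_Schwarz_ineq2)
  also have "\<dots> = norm A * norm x"
    unfolding norm_vec_def[of A] by (rule L2_set_left_distrib[symmetric]) simp
  finally show ?thesis .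
qed

lemma dot_matrix_vector_transpose: "(A *v x) \<bullet> y = x \<bullet> (transpose A *v y)"
  for A :: "real ^ 'n ^ 'm"
  by (metis dot_lmul_matrix inner_commute transpose_matrix_vector)

lemma norm_matrix_vector_sq: "(norm (L *v v))\<^sup>2 = v \<bullet> ((transpose L ** L) *v v)"
  for L :: "real ^ 'n ^ 'm"
  by (simp add: power2_norm_eq_inner dot_matrix_vector_transpose matrix_vector_mul_assoc)

lemma matrix_add_rdistrib: "(A + B) ** C = A ** C + B ** C"
  for A B :: "real ^ 'n ^ 'm"
  by (simp add: vec_eq_iff matrix_matrix_mult_def sum.distrib distrib_right)

lemma transpose_add: "transpose (A + B) = transpose A + transpose B"
  for A B :: "real ^ 'n ^ 'm"
  by (simp add: vec_eq_iff transpose_def)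

definition orthonormal_frame :: "('n \<Rightarrow> real ^ 'n) \<Rightarrow> bool" where
  "orthonormal_frame u \<longleftrightarrow> (\<forall>i j. u i \<bullet> u j = (if i = j then 1 else 0))"

text \<open>
  The symmetric matrix with eigenvectors \<open>u i\<close> and eigenvalues \<open>f i\<close>; for an orthonormal frame these
  matrices are multiplied and added through their eigenvalues.
\<close>

definition frame_diag :: "('n \<Rightarrow> real ^ 'n) \<Rightarrow> ('n \<Rightarrow> real) \<Rightarrow> real ^ 'n ^ 'n" where
  "frame_diag u f = (\<chi> a b. \<Sum>i\<in>UNIV. f i * (u i $ a * u i $ b))"

text \<open>
  The first-order condition at a maximum: a linear term dominated by a quadratic one vanishes.
\<close>

lemma quadratic_bound_imp_zero:
  fixes c K :: real
  assumes "\<And>t. 2 * t * c \<le> t\<^sup>2 * K" "c \<ge> 0"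
  shows "c = 0"
proof (rule ccontr)
  assume "c \<noteq> 0"
  then have c: "c > 0" using assms(2) by simp
  have K: "K \<ge> 0" using assms(1)[of 1] c by simp
  let ?t = "c / (K + 1)"
  have t: "?t > 0" using c K by simp
  have "2 * ?t * c \<le> ?t * (?t * K)" using assms(1)[of ?t] by (simp add: power2_eq_square)
  then have "2 * c \<le> ?t * K" using t by (simp only: mult.assoc mult.left_commute[of 2] mult_le_cancel_left_pos)
  also have "\<dots> \<le> c" using c K by (simp add: field_simps)
  finally show False using c by simp
qed

text \<open>
  A maximiser of the quadratic form of \<open>S\<close> on the unit sphere of an invariant subspace is an eigenvector:
  its residual \<open>z\<close> lies in the subspace, and moving in the direction \<open>z\<close> cannot increase the form to first order.
\<close>

lemma symmetric_eigenvector: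
  fixes S :: "real ^ 'n ^ 'n"
  assumes sym: "transpose S = S" and W: "subspace W" and inv: "\<And>w. w \<in> W \<Longrightarrow> S *v w \<in> W"
    and ne: "w0 \<in> W" "w0 \<noteq> 0"
  shows "\<exists>w\<in>W. norm w = 1 \<and> (\<exists>m. S *v w = m *\<^sub>R w)"
proof -
  let ?K = "W \<inter> sphere 0 1"
  have "compact ?K" using closed_subspace[OF W] by (intro closed_Int_compact) auto
  moreover have "(1 / norm w0) *\<^sub>R w0 \<in> ?K" using W ne by (auto simp: subspace_scale)
  moreover have "continuous_on ?K (\<lambda>w. w \<bullet> (S *v w))"
    by (intro continuous_intros linear_continuous_on matrix_vector_mul_bounded_linear)
  ultimately obtain w where w: "w \<in> ?K" and max: "\<And>v. v \<in> ?K \<Longrightarrow> v \<bullet> (S *v v) \<le> w \<bullet> (S *v w)"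
    using continuous_attains_sup[of ?K "\<lambda>w. w \<bullet> (S *v w)"] by blast
  define m where "m = w \<bullet> (S *v w)"
  have wn: "norm w = 1" "w \<in> W" using w by auto
  have le: "v \<bullet> (S *v v) \<le> m * (v \<bullet> v)" if v: "v \<in> W" for v
  proof (cases "v = 0")
    case False
    let ?v = "(1 / norm v) *\<^sub>R v"
    have "?v \<in> ?K" using W v False by (auto simp: subspace_scale)
    from max[OF this] have "(v \<bullet> (S *v v)) / (norm v)\<^sup>2 \<le> m"
      by (simp add: m_def matrix_vector_mult_scaleR power2_eq_square)
    then show ?thesis using False by (simp add: pos_divide_le_eq dot_square_norm)
  qed simp
  \<comment> \<open>The residual of the eigenvalue equation.\<close>
  define z where "z = S *v w - m *\<^sub>R w"
  have zW: "z \<in> W" unfolding z_def using inv wn W by (intro subspace_diff subspace_scale)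
  have zw: "z \<bullet> w = 0" using wn unfolding z_def m_def
    by (simp add: inner_diff_left inner_diff_right inner_commute dot_square_norm)
  have "z \<bullet> z = 0"
  proof (rule quadratic_bound_imp_zero[where K="m * (z \<bullet> z) - z \<bullet> (S *v z)"])
    fix t :: real
    have mem: "w + t *\<^sub>R z \<in> W" using wn zW W by (intro subspace_add subspace_scale)
    have sw: "w \<bullet> (S *v z) = z \<bullet> (S *v w)"
      using dot_matrix_vector_transpose[of S w z] sym by (simp add: inner_commute)
    have "z \<bullet> (S *v w) = z \<bullet> z" using zw unfolding z_def by (simp add: inner_diff_right)
    then have "(w + t *\<^sub>R z) \<bullet> (S *v (w + t *\<^sub>R z)) = m + 2 * t * (z \<bullet> z) + t\<^sup>2 * (z \<bullet> (S *v z))"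
      using sw by (simp add: m_def matrix_vector_right_distrib matrix_vector_mult_scaleR inner_add_left inner_add_right power2_eq_square algebra_simps)
    moreover have "(w + t *\<^sub>R z) \<bullet> (w + t *\<^sub>R z) = 1 + t\<^sup>2 * (z \<bullet> z)"
      using zw wn(1) norm_eq_1[of w] by (simp add: inner_add_left inner_add_right inner_commute[of w z] power2_eq_square)
    ultimately show "2 * t * (z \<bullet> z) \<le> t\<^sup>2 * (m * (z \<bullet> z) - z \<bullet> (S *v z))"
      using le[OF mem] by (simp add: algebra_simps)
  qed simp
  then have "S *v w = m *\<^sub>R w" unfolding z_def by simp
  then show ?thesis using wn by blast
qed

text \<open>
  Eigenvectors are collected one at a time, each in the orthogonal complement of the previous
  ones, which is invariant by symmetry.
\<close>

theorem spectral_theorem: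
  fixes S :: "real ^ 'n ^ 'n"
  assumes sym: "transpose S = S"
  shows "\<exists>u s. orthonormal_frame u \<and> (\<forall>i. S *v u i = s i *\<^sub>R u i)"
proof -
  have "\<exists>B. finite B \<and> card B = k \<and> pairwise orthogonal B \<and> (\<forall>b\<in>B. norm b = 1 \<and> (\<exists>m. S *v b = m *\<^sub>R b))"
    if "k \<le> CARD('n)" for k
    using that
  proof (induction k)
    case 0
    show ?case by (rule exI[of _ "{}"]) auto
  next
    case (Suc k)
    then obtain B where B: "finite B" "card B = k" "pairwise orthogonal B"
      "\<And>b. b \<in> B \<Longrightarrow> norm b = 1" "\<And>b. b \<in> B \<Longrightarrow> \<exists>m. S *v b = m *\<^sub>R b" by auto
    let ?W = "{w. \<forall>b\<in>B. orthogonal b w}"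
    have "dim B < DIM(real ^ 'n)" using dim_le_card'[OF B(1)] B(2) Suc.prems by simp
    then obtain w0 where w0: "w0 \<noteq> 0" "\<And>y. y \<in> span B \<Longrightarrow> orthogonal w0 y"
      using orthogonal_to_subspace_exists by blast
    have "\<exists>w\<in>?W. norm w = 1 \<and> (\<exists>m. S *v w = m *\<^sub>R w)"
    proof (rule symmetric_eigenvector[OF sym])
      show "subspace ?W" by (auto simp: subspace_def orthogonal_def inner_add_right)
      show "w0 \<in> ?W" using w0(2) by (auto simp: orthogonal_commute span_base)
      show "w0 \<noteq> 0" by fact
      fix w assume w: "w \<in> ?W"
      show "S *v w \<in> ?W"
      proof (clarify)
        fix b assume b: "b \<in> B"
        then obtain m where m: "S *v b = m *\<^sub>R b" using B(5) by blast
        have "b \<bullet> (S *v w) = (S *v b) \<bullet> w"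
          using dot_matrix_vector_transpose[of S b w] sym by simp
        then show "orthogonal b (S *v w)" using w b m by (simp add: orthogonal_def)
      qed
    qed
    then obtain w where w: "\<And>b. b \<in> B \<Longrightarrow> orthogonal b w" "norm w = 1" "\<exists>m. S *v w = m *\<^sub>R w" by auto
    have "w \<notin> B" using w(1)[of w] w(2) by (auto simp: orthogonal_def dot_square_norm)
    then show ?case using B w
      by (intro exI[of _ "insert w B"]) (auto simp: pairwise_insert orthogonal_commute)
  qed
  from this[OF order_refl] obtain B where B: "finite B" "card B = CARD('n)" "pairwise orthogonal B"
      "\<And>b. b \<in> B \<Longrightarrow> norm b = 1" "\<And>b. b \<in> B \<Longrightarrow> \<exists>m. S *v b = m *\<^sub>R b" by auto
  obtain u where u: "bij_betw u (UNIV :: 'n set) B"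
    using finite_same_card_bij[of "UNIV :: 'n set" B] B by auto
  have uB: "u i \<in> B" for i using u by (auto simp: bij_betw_def)
  have uinj: "u i = u j \<longleftrightarrow> i = j" for i j using u by (auto simp: bij_betw_def inj_on_def)
  have "orthonormal_frame u"
    unfolding orthonormal_frame_def
    using B(3,4) uB uinj by (auto simp: dot_square_norm pairwise_def orthogonal_def)
  moreover have "\<exists>s. \<forall>i. S *v u i = s i *\<^sub>R u i" using B(5) uB by (intro choice) blast
  ultimately show ?thesis by blast
qed

context
  fixes u :: "'n \<Rightarrow> real ^ 'n"
  assumes u: "orthonormal_frame u"
begin

lemma frame_inner: "u i \<bullet> u j = (if i = j then 1 else 0)"
  using u by (auto simp: orthonormal_frame_def)

lemma frame_norm: "norm (u i) = 1"
  using frame_inner[of i i] by (simp add: norm_eq_sqrt_inner)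

definition frame_matrix :: "real ^ 'n ^ 'n" where "frame_matrix = (\<chi> a i. u i $ a)"

lemma frame_matrix_orthogonal: "transpose frame_matrix ** frame_matrix = mat 1" "frame_matrix ** transpose frame_matrix = mat 1"
proof -
  show "transpose frame_matrix ** frame_matrix = mat 1"
    using frame_inner by (simp add: vec_eq_iff matrix_matrix_mult_def transpose_def frame_matrix_def mat_def inner_vec_def)
  then show "frame_matrix ** transpose frame_matrix = mat 1"
    by (simp add: matrix_left_right_inverse)
qed

lemma frame_diag_eq: "frame_diag u f = frame_matrix ** (\<chi> i j. if i = j then f i else 0) ** transpose frame_matrix"
  by (simp add: vec_eq_iff frame_diag_def matrix_matrix_mult_def transpose_def frame_matrix_def if_distrib[where f="\<lambda>x. _ * x"] sum.delta mult_ac cong: if_cong)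

lemma frame_expand: "v = (\<Sum>i\<in>UNIV. (u i \<bullet> v) *\<^sub>R u i)"
proof -
  have "v = frame_matrix *v (transpose frame_matrix *v v)"
    by (simp only: matrix_vector_mul_assoc frame_matrix_orthogonal matrix_vector_mul_lid)
  also have "\<dots> = (\<Sum>i\<in>UNIV. (u i \<bullet> v) *\<^sub>R u i)"
    by (simp add: vec_eq_iff matrix_vector_mult_def frame_matrix_def transpose_def inner_vec_def mult_ac)
  finally show ?thesis .
qed

lemma frame_diag_apply: "frame_diag u f *v v = (\<Sum>i\<in>UNIV. (f i * (u i \<bullet> v)) *\<^sub>R u i)"
  unfolding vec_eq_iff
proof
  fix a
  have "(frame_diag u f *v v) $ a = (\<Sum>b\<in>UNIV. \<Sum>i\<in>UNIV. f i * (u i $ a * u i $ b) * v $ b)"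
    by (simp add: matrix_vector_mult_def frame_diag_def sum_distrib_right)
  also have "\<dots> = (\<Sum>i\<in>UNIV. \<Sum>b\<in>UNIV. f i * (u i $ a * u i $ b) * v $ b)" by (rule sum.swap)
  also have "\<dots> = (\<Sum>i\<in>UNIV. (f i * (u i \<bullet> v)) *\<^sub>R u i) $ a"
    by (simp add: inner_vec_def sum_distrib_left sum_distrib_right mult_ac)
  finally show "(frame_diag u f *v v) $ a = (\<Sum>i\<in>UNIV. (f i * (u i \<bullet> v)) *\<^sub>R u i) $ a" .
qed

lemma frame_inner_diag: "u i \<bullet> (frame_diag u f *v v) = f i * (u i \<bullet> v)"
  by (simp add: frame_diag_apply inner_sum_right frame_inner if_distrib[where f="\<lambda>x. _ * x"] cong: if_cong)

lemma frame_eqI: "(\<And>i. u i \<bullet> v = u i \<bullet> w) \<Longrightarrow> v = w"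
  by (subst frame_expand[of v], subst frame_expand[of w]) simp

lemma frame_norm_sq: "(norm v)\<^sup>2 = (\<Sum>i\<in>UNIV. (u i \<bullet> v)\<^sup>2)"
proof -
  have "(norm v)\<^sup>2 = v \<bullet> (\<Sum>i\<in>UNIV. (u i \<bullet> v) *\<^sub>R u i)"
    by (subst frame_expand[symmetric]) (simp add: dot_square_norm)
  then show ?thesis by (simp add: inner_sum_right power2_eq_square inner_commute)
qed

lemma frame_diag_quad: "v \<bullet> (frame_diag u f *v v) = (\<Sum>i\<in>UNIV. f i * (u i \<bullet> v)\<^sup>2)"
  by (simp add: frame_diag_apply inner_sum_right power2_eq_square inner_commute mult_ac)

lemma frame_diag_mult: "frame_diag u f ** frame_diag u g = frame_diag u (\<lambda>i. f i * g i)"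
  by (subst matrix_eq) (auto intro!: frame_eqI simp: frame_inner_diag matrix_vector_mul_assoc[symmetric])

lemma frame_diag_one: "frame_diag u (\<lambda>_. 1) = mat 1"
  by (subst matrix_eq) (auto intro!: frame_eqI simp: frame_inner_diag)

lemma frame_diag_add: "frame_diag u f + frame_diag u g = frame_diag u (\<lambda>i. f i + g i)"
  by (simp add: vec_eq_iff frame_diag_def sum.distrib distrib_right)

lemma frame_diag_diff: "frame_diag u f - frame_diag u g = frame_diag u (\<lambda>i. f i - g i)"
  by (simp add: vec_eq_iff frame_diag_def sum_subtractf left_diff_distrib)

lemma frame_diag_scale: "c *\<^sub>R frame_diag u f = frame_diag u (\<lambda>i. c * f i)"
  by (simp add: vec_eq_iff frame_diag_def sum_distrib_left mult_ac)

lemma transpose_frame_diag: "transpose (frame_diag u f) = frame_diag u f"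
  by (simp add: vec_eq_iff frame_diag_def transpose_def mult_ac)

lemma det_frame_diag: "det (frame_diag u f) = (\<Prod>i\<in>UNIV. f i)"
proof -
  have "det frame_matrix * det (transpose frame_matrix) = 1"
    using frame_matrix_orthogonal(2) by (metis det_I det_mul)
  then show ?thesis
    by (simp add: frame_diag_eq det_mul det_diagonal)
qed

lemma trace_frame_diag: "trace (frame_diag u f) = (\<Sum>i\<in>UNIV. f i)"
proof -
  have "trace (frame_diag u f) = (\<Sum>i\<in>UNIV. f i * (u i \<bullet> u i))"
    unfolding trace_def frame_diag_def inner_vec_def
    by (simp add: sum_distrib_left) (rule sum.swap)
  then show ?thesis by (simp add: frame_inner)
qed

lemma frame_diag_norm_le: "norm (frame_diag u f) \<le> (\<Sum>i\<in>UNIV. \<bar>f i\<bar>)"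
proof -
  define E where "E i = (\<chi> a b. u i $ a * u i $ b)" for i
  have E: "norm (E i) = 1" for i
  proof -
    have "(norm (E i))\<^sup>2 = (\<Sum>a\<in>UNIV. \<Sum>b\<in>UNIV. (u i $ a)\<^sup>2 * (u i $ b)\<^sup>2)"
      unfolding power2_norm_eq_inner inner_vec_def E_def by (simp add: power2_eq_square mult_ac)
    also have "\<dots> = (u i \<bullet> u i) * (u i \<bullet> u i)"
      unfolding inner_vec_def sum_product by (simp add: power2_eq_square mult_ac)
    finally show ?thesis by (simp add: frame_inner power2_eq_1_iff) (metis norm_ge_zero abs_1 abs_minus abs_of_nonneg)
  qed
  have "frame_diag u f = (\<Sum>i\<in>UNIV. f i *\<^sub>R E i)"
    by (simp add: vec_eq_iff frame_diag_def E_def)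
  then have "norm (frame_diag u f) \<le> (\<Sum>i\<in>UNIV. norm (f i *\<^sub>R E i))"
    by (simp only: norm_sum)
  then show ?thesis by (simp add: E)
qed

end

lemma spectral_frame_diag:
  fixes S :: "real ^ 'n ^ 'n"
  assumes "transpose S = S"
  shows "\<exists>u s. orthonormal_frame u \<and> S = frame_diag u s"
proof -
  obtain u s where u: "orthonormal_frame u" "\<And>i. S *v u i = s i *\<^sub>R u i"
    using spectral_theorem[OF assms] by auto
  have "u i \<bullet> (S *v v) = u i \<bullet> (frame_diag u s *v v)" for i v
  proof -
    have "u i \<bullet> (S *v v) = (S *v u i) \<bullet> v" using dot_matrix_vector_transpose[of S "u i" v] assms by simp
    then show ?thesis by (simp add: u(2) frame_inner_diag[OF u(1)])
  qed
  then have "S = frame_diag u s" by (subst matrix_eq) (auto intro: frame_eqI[OF u(1)])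
  then show ?thesis using u(1) by blast
qed

section \<open>Determinants of Gram type are submultiplicative\<close>

lemma det_ge_1:
  fixes X :: "real ^ 'n ^ 'n"
  assumes sym: "transpose X = X" and ge: "\<And>v. v \<bullet> (X *v v) \<ge> v \<bullet> v"
  shows "det X \<ge> 1"
proof -
  obtain u s where u: "orthonormal_frame u" "X = frame_diag u s"
    using spectral_frame_diag[OF sym] by auto
  have "s i \<ge> 1" for i
    using ge[of "u i"] unfolding u(2) frame_inner_diag[OF u(1)] by (simp add: frame_inner[OF u(1)])
  then show ?thesis unfolding u(2) det_frame_diag[OF u(1)] by (intro prod_ge_1) auto
qed

text \<open>
  Conjugating by the inverse square root of \<open>X\<close> reduces the claim to the case in which \<open>X\<close> is the identity.
\<close>

lemma det_mono_posdef:
  fixes X Y :: "real ^ 'n ^ 'n"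
  assumes symX: "transpose X = X" and symY: "transpose Y = Y"
    and pos: "\<And>v. v \<noteq> 0 \<Longrightarrow> v \<bullet> (X *v v) > 0"
    and le: "\<And>v. v \<bullet> (X *v v) \<le> v \<bullet> (Y *v v)"
  shows "det X \<le> det Y"
proof -
  obtain u s where u: "orthonormal_frame u" "X = frame_diag u s"
    using spectral_frame_diag[OF symX] by auto
  have s: "s i > 0" for i
  proof -
    have "u i \<noteq> 0" using frame_norm[OF u(1), of i] by auto
    from pos[OF this] show ?thesis
      unfolding u(2) frame_inner_diag[OF u(1)] by (simp add: frame_inner[OF u(1)])
  qed
  define Z where "Z = frame_diag u (\<lambda>i. 1 / sqrt (s i))"
  have Zsym: "transpose Z = Z" unfolding Z_def by (rule transpose_frame_diag[OF u(1)])
  have "(\<lambda>i. 1 / sqrt (s i) * s i * (1 / sqrt (s i))) = (\<lambda>_. 1)"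
    using less_imp_le[OF s] less_imp_neq[OF s] by (auto simp: fun_eq_iff field_simps)
  then have ZXZ: "Z ** X ** Z = mat 1"
    unfolding Z_def u(2) by (simp only: frame_diag_mult[OF u(1)] frame_diag_one[OF u(1)])
  have quad: "v \<bullet> ((Z ** C ** Z) *v v) = (Z *v v) \<bullet> (C *v (Z *v v))" for C v
    using dot_matrix_vector_transpose[of Z v] Zsym by (simp add: matrix_vector_mul_assoc[symmetric])
  have "1 \<le> det (Z ** Y ** Z)"
  proof (rule det_ge_1)
    show "transpose (Z ** Y ** Z) = Z ** Y ** Z"
      by (simp add: matrix_transpose_mul Zsym symY matrix_mul_assoc)
    fix v
    have "v \<bullet> v = v \<bullet> ((Z ** X ** Z) *v v)" by (simp add: ZXZ)
    also have "\<dots> \<le> v \<bullet> ((Z ** Y ** Z) *v v)" unfolding quad by (rule le)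
    finally show "v \<bullet> v \<le> v \<bullet> ((Z ** Y ** Z) *v v)" .
  qed
  also have "\<dots> = (det Z)\<^sup>2 * det Y" by (simp add: det_mul power2_eq_square)
  finally have 1: "1 \<le> (det Z)\<^sup>2 * det Y" .
  have 2: "(det Z)\<^sup>2 * det X = 1" using arg_cong[OF ZXZ, of det] by (simp add: det_mul power2_eq_square mult_ac)
  have "det Z \<noteq> 0" using 2 by auto
  then have pos: "(det Z)\<^sup>2 > 0" by simp
  have "(det Z)\<^sup>2 * det X \<le> (det Z)\<^sup>2 * det Y" using 1 2 by simp
  then show ?thesis using pos by (simp only: mult_le_cancel_left_pos)
qed

text \<open>
  The determinant is a polynomial in \<open>e\<close> that does not vanish for \<open>e\<close> beyond the norm of \<open>X\<close>. This
  makes invertible matrices dense.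
\<close>

lemma finite_singular_shifts: "finite {e. det (X + e *\<^sub>R mat 1 :: real ^ 'n ^ 'n) = 0}"
proof -
  let ?f = "\<lambda>e. det (X + e *\<^sub>R mat 1 :: real ^ 'n ^ 'n)"
  have "real_polynomial_function ?f"
    unfolding det_def
  proof (intro real_polynomial_function_sum real_polynomial_function.intros(4))
    fix p :: "'n \<Rightarrow> 'n"
    show "real_polynomial_function (\<lambda>e. of_int (sign p) :: real)" by (rule real_polynomial_function.intros(2))
    show "real_polynomial_function (\<lambda>e. \<Prod>i\<in>UNIV. (X + e *\<^sub>R mat 1) $ i $ p i)"
    proof (rule real_polynomial_function_prod)
      fix i
      have "real_polynomial_function (\<lambda>e. X $ i $ p i + e * (mat 1 :: real ^ 'n ^ 'n) $ i $ p i)"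
        by (intro real_polynomial_function.intros bounded_linear_ident)
      then show "real_polynomial_function (\<lambda>e. (X + e *\<^sub>R mat 1) $ i $ p i)" by simp
    qed simp
  qed auto
  then have "\<exists>a n. ?f = (\<lambda>e. \<Sum>i\<le>n. a i * e ^ i)" by (simp only: real_polynomial_function_iff_sum)
  then obtain a n where f: "?f = (\<lambda>e. \<Sum>i\<le>n. a i * e ^ i)" by (elim exE) (rule that)
  \<comment> \<open>Any shift larger than the norm of \<open>X\<close> is nonsingular.\<close>
  define e where "e = norm X + 1"
  have "det (X + e *\<^sub>R mat 1) \<noteq> 0"
  proof
    assume "det (X + e *\<^sub>R mat 1) = 0"
    moreover have "det B * det (X + e *\<^sub>R mat 1) = 1" if "B ** (X + e *\<^sub>R mat 1) = mat 1" for B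
      using arg_cong[OF that, of det] by (simp add: det_mul)
    ultimately have "\<not> (\<exists>B. B ** (X + e *\<^sub>R mat 1) = mat 1)" by auto
    then obtain v where v: "v \<noteq> 0" "(X + e *\<^sub>R mat 1) *v v = 0"
      unfolding matrix_left_invertible_ker by auto
    then have "X *v v = - (e *\<^sub>R v)"
      by (simp add: matrix_vector_mult_add_rdistrib scaleR_matrix_vector_assoc[symmetric] add_eq_0_iff2)
    then have "e * norm v = norm (X *v v)" by (simp add: e_def)
    also have "\<dots> \<le> norm X * norm v" by (rule norm_matrix_vector_le)
    finally show False using v by (simp add: e_def)
  qed
  then have ne: "(\<Sum>i\<le>n. a i * e ^ i) \<noteq> 0" using fun_cong[OF f, of e] by simp
  have "\<exists>k\<le>n. a k \<noteq> 0"
  proof (rule ccontr)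
    assume "\<not> ?thesis"
    then have "(\<Sum>i\<le>n. a i * e ^ i) = 0" by (intro sum.neutral) auto
    then show False using ne by simp
  qed
  then obtain k where "a k \<noteq> 0" "k \<le> n" by blast
  then have "finite {e. (\<Sum>i\<le>n. a i * e ^ i) = 0}"
    by (intro polyfun_rootbound_finite) blast
  then show ?thesis by (simp only: fun_cong[OF f])
qed

text \<open>
  For invertible \<open>X\<close> the two matrices are conjugate; the general case follows by continuity.
\<close>

lemma sylvester_det: "det (mat 1 + X ** Y) = det (mat 1 + Y ** X)"
  for X Y :: "real ^ 'n ^ 'n"
proof -
  define d where "d e = det (mat 1 + (X + e *\<^sub>R mat 1) ** Y) - det (mat 1 + Y ** (X + e *\<^sub>R mat 1))" for e
  have inv: "d e = 0" if "det (X + e *\<^sub>R mat 1) \<noteq> 0" for e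
  proof -
    let ?X = "X + e *\<^sub>R mat 1"
    have "?X ** (mat 1 + Y ** ?X) = (mat 1 + ?X ** Y) ** ?X"
      by (simp add: matrix_add_ldistrib matrix_add_rdistrib matrix_mul_assoc)
    then have "det ?X * det (mat 1 + Y ** ?X) = det (mat 1 + ?X ** Y) * det ?X"
      by (metis det_mul)
    then show ?thesis using that by (simp add: d_def)
  qed
  have "isCont d 0"
    unfolding d_def det_def matrix_matrix_mult_def vector_add_component vec_lambda_beta vector_scaleR_component
    by (intro continuous_intros)
  then have lim: "(d \<longlongrightarrow> d 0) (at 0)" by (simp add: isCont_def)
  have "\<forall>\<^sub>F e in at 0. d e = 0"
  proof -
    have "\<forall>\<^sub>F e in at 0. e \<notin> {e. det (X + e *\<^sub>R mat 1) = 0} - {0}"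
      using finite_singular_shifts[of X] by (auto simp: eventually_at_topological intro!: exI[of _ "- ({e. det (X + e *\<^sub>R mat 1) = 0} - {0})"] finite_imp_closed)
    moreover have "\<forall>\<^sub>F e in at 0. e \<noteq> (0::real)" by (simp add: eventually_at_filter)
    ultimately show ?thesis by eventually_elim (auto intro: inv)
  qed
  then have "(d \<longlongrightarrow> 0) (at 0)" by (rule tendsto_eventually)
  from tendsto_unique[OF _ lim this] have "d 0 = 0" by simp
  then show ?thesis by (simp add: d_def)
qed

text \<open>
  By the Cauchy-Binet formula this is the sum of the squares of all minors of \<open>C\<close>, the empty one included, that is, the
  squared Hilbert-Schmidt norm of \<open>C\<close> on the exterior algebra. It captures the volume growth in all dimensions at once.
\<close>

definition gram_det :: "real ^ 'n ^ 'n \<Rightarrow> real" where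
  "gram_det C = det (mat 1 + transpose C ** C)"

lemma gram_det_ge_1: "gram_det C \<ge> 1"
  unfolding gram_det_def
  by (rule det_ge_1)
    (auto simp: transpose_add matrix_transpose_mul matrix_vector_mult_add_rdistrib inner_add_right norm_matrix_vector_sq[symmetric])

text \<open>
  With \<open>R\<^sup>2 = 1 + C\<^sup>T C\<close>, enlarging \<open>C\<^sup>T C\<close> to \<open>R\<^sup>2\<close> gives \<open>gram_det (C D) \<le> gram_det (R D)\<close>. By
  Sylvester's identity the latter is \<open>det (1 + R D D\<^sup>T R) = (det R)\<^sup>2 det (R\<^sup>-\<^sup>2 + D D\<^sup>T)\<close>, and \<open>R\<^sup>-\<^sup>2 \<le> 1\<close>.
\<close>

lemma gram_det_mult: "gram_det (C ** D) \<le> gram_det C * gram_det D"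
  for C D :: "real ^ 'n ^ 'n"
proof -
  have symH: "transpose (mat 1 + transpose C ** C) = mat 1 + transpose C ** C" for C :: "real ^ 'n ^ 'n"
    by (simp add: transpose_add matrix_transpose_mul)
  obtain u s where u: "orthonormal_frame u" "mat 1 + transpose C ** C = frame_diag u s"
    using spectral_frame_diag[OF symH] by blast
  have s: "s i \<ge> 1" for i
  proof -
    have "s i = u i \<bullet> ((mat 1 + transpose C ** C) *v u i)"
      unfolding u(2) frame_inner_diag[OF u(1)] by (simp add: frame_inner[OF u(1)])
    also have "\<dots> \<ge> 1"
      using frame_inner[OF u(1)] by (simp add: matrix_vector_mult_add_rdistrib inner_add_right norm_matrix_vector_sq[symmetric])
    finally show ?thesis .
  qed
  then have s0: "s i > 0" for i by (meson less_le_trans zero_less_one)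
  define R where "R = frame_diag u (\<lambda>i. sqrt (s i))"
  define R' where "R' = frame_diag u (\<lambda>i. 1 / sqrt (s i))"
  have sym: "transpose R = R" "transpose R' = R'" unfolding R_def R'_def by (rule transpose_frame_diag[OF u(1)])+
  have "(\<lambda>i. sqrt (s i) * sqrt (s i)) = s" using s0 by (auto simp: fun_eq_iff less_imp_le)
  then have RR: "R ** R = mat 1 + transpose C ** C" unfolding R_def u(2) by (simp only: frame_diag_mult[OF u(1)])
  have "(\<lambda>i. sqrt (s i) * (1 / sqrt (s i))) = (\<lambda>_. 1)" using s0 by (auto simp: fun_eq_iff less_imp_neq[symmetric])
  then have R1: "R ** R' = mat 1" "R' ** R = mat 1"
    unfolding R_def R'_def by (simp_all only: frame_diag_mult[OF u(1)] frame_diag_one[OF u(1)] mult.commute)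
  have R'le: "v \<bullet> ((R' ** R') *v v) \<le> v \<bullet> v" "v \<bullet> ((R' ** R') *v v) > 0" if "v \<noteq> 0" for v
  proof -
    have eq: "v \<bullet> ((R' ** R') *v v) = (norm (R' *v v))\<^sup>2" by (simp add: norm_matrix_vector_sq sym)
    show "v \<bullet> ((R' ** R') *v v) \<le> v \<bullet> v"
      unfolding R'_def frame_diag_mult[OF u(1)] frame_diag_quad[OF u(1)]
      unfolding dot_square_norm frame_norm_sq[OF u(1)]
    proof (rule sum_mono)
      fix i
      have "(u i \<bullet> v)\<^sup>2 / s i \<le> (u i \<bullet> v)\<^sup>2 / 1"
        by (rule divide_left_mono) (use s s0[of i] in auto)
      then show "1 / sqrt (s i) * (1 / sqrt (s i)) * (u i \<bullet> v)\<^sup>2 \<le> (u i \<bullet> v)\<^sup>2"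
        using s0[of i] by simp
    qed
    have "R' *v v \<noteq> 0"
    proof
      assume "R' *v v = 0"
      then have "(R ** R') *v v = 0" by (simp add: matrix_vector_mul_assoc[symmetric])
      then show False using R1 that by simp
    qed
    then show "v \<bullet> ((R' ** R') *v v) > 0" unfolding eq by simp
  qed
  have "gram_det (C ** D) \<le> gram_det (R ** D)"
    unfolding gram_det_def
  proof (rule det_mono_posdef)
    fix v :: "real ^ 'n"
    have *: "v \<bullet> ((mat 1 + transpose (X ** D) ** (X ** D)) *v v) = v \<bullet> v + (norm (X *v (D *v v)))\<^sup>2" for X :: "real ^ 'n ^ 'n"
    proof -
      have "v \<bullet> ((mat 1 + transpose (X ** D) ** (X ** D)) *v v) = v \<bullet> v + (norm ((X ** D) *v v))\<^sup>2"
        unfolding norm_matrix_vector_sq by (simp add: matrix_vector_mult_add_rdistrib inner_add_right)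
      then show ?thesis by (simp only: matrix_vector_mul_assoc)
    qed
    show "v \<bullet> ((mat 1 + transpose (C ** D) ** (C ** D)) *v v) > 0" if "v \<noteq> 0"
      unfolding * using that by (simp add: add_pos_nonneg)
    have "(norm (R *v w))\<^sup>2 = w \<bullet> w + (norm (C *v w))\<^sup>2" for w
      unfolding norm_matrix_vector_sq sym RR by (simp add: matrix_vector_mult_add_rdistrib inner_add_right)
    then show "v \<bullet> ((mat 1 + transpose (C ** D) ** (C ** D)) *v v) \<le> v \<bullet> ((mat 1 + transpose (R ** D) ** (R ** D)) *v v)"
      unfolding * by simp
  qed (rule symH)+
  also have "gram_det (R ** D) = det (mat 1 + (R ** D) ** transpose (R ** D))"
    unfolding gram_det_def by (rule sylvester_det)
  also have "mat 1 + (R ** D) ** transpose (R ** D) = R ** (R' ** R' + D ** transpose D) ** R"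
    using R1 by (simp add: matrix_transpose_mul sym matrix_add_ldistrib matrix_add_rdistrib matrix_mul_assoc)
  also have "det \<dots> = gram_det C * det (R' ** R' + D ** transpose D)"
    using arg_cong[OF RR, of det] by (simp add: det_mul gram_det_def mult_ac)
  also have "\<dots> \<le> gram_det C * det (mat 1 + D ** transpose D)"
  proof (rule mult_left_mono)
    show "0 \<le> gram_det C" using gram_det_ge_1[of C] by linarith
    have *: "v \<bullet> ((X + D ** transpose D) *v v) = v \<bullet> (X *v v) + (norm (transpose D *v v))\<^sup>2" for X v
      unfolding norm_matrix_vector_sq transpose_transpose by (simp add: matrix_vector_mult_add_rdistrib inner_add_right)
    show "det (R' ** R' + D ** transpose D) \<le> det (mat 1 + D ** transpose D)"
    proof (rule det_mono_posdef)
      fix v :: "real ^ 'n"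
      show "v \<bullet> ((R' ** R' + D ** transpose D) *v v) > 0" if "v \<noteq> 0"
        unfolding * using R'le(2)[OF that] by (simp add: add_pos_nonneg)
      show "v \<bullet> ((R' ** R' + D ** transpose D) *v v) \<le> v \<bullet> ((mat 1 + D ** transpose D) *v v)"
        unfolding * using R'le(1)[of v] by (cases "v = 0") auto
    qed (simp_all add: transpose_add matrix_transpose_mul sym)
  qed
  also have "det (mat 1 + D ** transpose D) = gram_det D"
    unfolding gram_det_def by (rule sylvester_det)
  finally show ?thesis .
qed

lemma gram_det_scaled:
  assumes "orthonormal_frame u" "transpose L ** L = frame_diag u s"
  shows "gram_det (c *\<^sub>R L) = (\<Prod>i\<in>UNIV. 1 + c\<^sup>2 * s i)"
proof -
  have "mat 1 + transpose (c *\<^sub>R L) ** (c *\<^sub>R L) = frame_diag u (\<lambda>i. 1 + c\<^sup>2 * s i)"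
    by (simp add: transpose_scalar scalar_matrix_assoc[symmetric] matrix_scalar_ac assms
       frame_diag_scale frame_diag_add frame_diag_one[OF assms(1), symmetric] power2_eq_square mult_ac)
  then show ?thesis unfolding gram_det_def using det_frame_diag[OF assms(1)] by simp
qed

lemma singular_frame:
  fixes L :: "real ^ 'n ^ 'n"
  shows "\<exists>u s. orthonormal_frame u \<and> transpose L ** L = frame_diag u s \<and> (\<forall>i. 0 \<le> s i \<and> s i \<le> (norm L)\<^sup>2)"
proof -
  obtain u s where u: "orthonormal_frame u" "transpose L ** L = frame_diag u s"
    using spectral_frame_diag[of "transpose L ** L"] by (auto simp: matrix_transpose_mul)
  have "s i = (norm (L *v u i))\<^sup>2" for i
    unfolding norm_matrix_vector_sq u(2) frame_inner_diag[OF u(1)] by (simp add: frame_inner[OF u(1)])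
  moreover have "(norm (L *v u i))\<^sup>2 \<le> (norm L)\<^sup>2" for i
    using norm_matrix_vector_le[of L "u i"] frame_norm[OF u(1), of i] by (intro power_mono) auto
  ultimately have "\<forall>i. 0 \<le> s i \<and> s i \<le> (norm L)\<^sup>2" by simp
  then show ?thesis using u by blast
qed

lemma gram_det_le: "gram_det C \<le> (1 + (norm C)\<^sup>2) ^ CARD('n)"
  for C :: "real ^ 'n ^ 'n"
proof -
  obtain u s where u: "orthonormal_frame u" "transpose C ** C = frame_diag u s" "\<And>i. 0 \<le> s i \<and> s i \<le> (norm C)\<^sup>2"
    using singular_frame[of C] by blast
  have "gram_det C = (\<Prod>i\<in>UNIV. 1 + s i)" using gram_det_scaled[OF u(1,2), of 1] by simp
  also have "\<dots> \<le> (\<Prod>i\<in>(UNIV::'n set). 1 + (norm C)\<^sup>2)" by (rule prod_mono) (use u(3) in auto)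
  finally show ?thesis by simp
qed

section \<open>Convergence of slow singular subspaces\<close>

lemma eventually_le_exp:
  fixes c e :: real
  assumes "e > 0"
  shows "\<forall>\<^sub>F n in sequentially. c \<le> exp (real n * e)"
proof -
  obtain N where N: "c < real N * e" using reals_Archimedean3[OF assms] by blast
  have "c \<le> exp (real n * e)" if "n \<ge> N" for n
  proof -
    have "real N * e \<le> real n * e" using that assms by (intro mult_right_mono) auto
    also have "\<dots> \<le> exp (real n * e)" using exp_ge_add_one_self[of "real n * e"] by linarith
    finally show ?thesis using N by linarith
  qed
  then show ?thesis by (auto simp: eventually_sequentially)
qed

lemma norm_transpose: "norm (transpose A) = norm A" for A :: "real ^ 'n ^ 'm"
proof -
  have "(norm (transpose A))\<^sup>2 = (norm A)\<^sup>2"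
    unfolding power2_norm_eq_inner inner_vec_def transpose_def by (simp, rule sum.swap)
  then show ?thesis by simp
qed

lemma norm_le_of_apply:
  fixes X :: "real ^ 'n ^ 'm"
  assumes "\<And>v. norm (X *v v) \<le> c * norm v"
  shows "norm X \<le> real CARD('n) * c"
proof -
  have "norm X = norm (transpose X)" by (simp add: norm_transpose)
  also have "\<dots> \<le> (\<Sum>j\<in>UNIV. norm (transpose X $ j))"
    unfolding norm_vec_def[of "transpose X"] by (rule L2_set_le_sum) auto
  also have "\<dots> \<le> (\<Sum>j\<in>(UNIV::'n set). c)"
  proof (rule sum_mono)
    fix j :: 'n
    have "transpose X $ j = X *v axis j 1"
      by (simp add: vec_eq_iff transpose_def matrix_vector_mult_basis column_def)
    then show "norm (transpose X $ j) \<le> c" using assms[of "axis j 1"] by (simp add: norm_axis_1)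
  qed
  finally show ?thesis by simp
qed

lemma norm_sq_trace: "(norm X)\<^sup>2 = trace (transpose X ** X)" for X :: "real ^ 'n ^ 'm"
proof -
  have "(norm X)\<^sup>2 = (\<Sum>i\<in>UNIV. \<Sum>j\<in>UNIV. X $ i $ j * X $ i $ j)"
    unfolding power2_norm_eq_inner inner_vec_def by simp
  also have "\<dots> = trace (transpose X ** X)"
    unfolding trace_def matrix_matrix_mult_def transpose_def by (simp, rule sum.swap)
  finally show ?thesis .
qed

definition orth_proj :: "real ^ 'n ^ 'n \<Rightarrow> bool" where
  "orth_proj P \<longleftrightarrow> transpose P = P \<and> P ** P = P"

lemma transpose_diff: "transpose (A - B) = transpose A - transpose B"
  for A B :: "real ^ 'n ^ 'm"
  by (simp add: vec_eq_iff transpose_def)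

lemma matrix_diff_ldistrib: "A ** (B - C) = A ** B - A ** C" for A :: "real ^ 'n ^ 'm"
  by (simp add: vec_eq_iff matrix_matrix_mult_def sum_subtractf right_diff_distrib)

lemma matrix_diff_rdistrib: "(A - B) ** C = A ** C - B ** C" for A :: "real ^ 'n ^ 'm"
  by (simp add: vec_eq_iff matrix_matrix_mult_def sum_subtractf left_diff_distrib)

text \<open>
  For projections of equal rank the Hilbert-Schmidt distance is controlled by one of the two off-diagonal
  blocks alone, since both blocks have the same norm. Hence a one-sided estimate on slow vectors suffices
  to compare slow subspaces.
\<close>

lemma orth_proj_dist:
  fixes P P' :: "real ^ 'n ^ 'n"
  assumes P: "orth_proj P" and P': "orth_proj P'" and tr: "trace P = trace P'"
  shows "norm (P' - P) = sqrt 2 * norm ((mat 1 - P') ** P)"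
proof -
  have p: "transpose P = P" "P ** P = P" "transpose P' = P'" "P' ** P' = P'"
    using P P' by (auto simp: orth_proj_def)
  have c: "trace (P ** P') = trace (P' ** P)" by (rule trace_mul_sym)
  have "transpose (P' - P) ** (P' - P) = P' - P' ** P - P ** P' + P"
    by (simp add: transpose_diff p matrix_diff_ldistrib matrix_diff_rdistrib)
  then have 1: "(norm (P' - P))\<^sup>2 = 2 * (trace P - trace (P' ** P))"
    unfolding norm_sq_trace using tr c by (simp add: trace_add trace_sub)
  have "transpose ((mat 1 - P') ** P) ** ((mat 1 - P') ** P) = P ** ((mat 1 - P') ** ((mat 1 - P') ** P))"
    by (simp add: matrix_transpose_mul transpose_diff p matrix_mul_assoc)
  also have "\<dots> = P ** (P - P' ** P)"
    by (simp add: matrix_diff_ldistrib matrix_diff_rdistrib p matrix_mul_assoc)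
  finally have "(norm ((mat 1 - P') ** P))\<^sup>2 = trace (P ** (P - P' ** P))" unfolding norm_sq_trace by simp
  also have "\<dots> = trace P - trace ((P ** P') ** P)"
    by (simp add: matrix_diff_ldistrib p trace_sub matrix_mul_assoc)
  also have "trace ((P ** P') ** P) = trace (P ** (P ** P'))" by (rule trace_mul_sym)
  also have "\<dots> = trace (P' ** P)" using c by (simp add: matrix_mul_assoc p)
  finally have "(norm (P' - P))\<^sup>2 = (sqrt 2 * norm ((mat 1 - P') ** P))\<^sup>2"
    using 1 by (simp add: power_mult_distrib)
  then show ?thesis by (simp only: power2_eq_iff_nonneg norm_ge_zero mult_nonneg_nonneg real_sqrt_ge_zero zero_le_numeral)
qed

lemma geometric_limit:
  fixes X :: "nat \<Rightarrow> 'a :: banach"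
  assumes r: "0 < r" "r < 1" and step: "\<And>n. n \<ge> n0 \<Longrightarrow> norm (X (Suc n) - X n) \<le> K * r ^ n"
  shows "\<exists>P. X \<longlonglongrightarrow> P \<and> (\<forall>n\<ge>n0. norm (P - X n) \<le> K / (1 - r) * r ^ n)"
proof -
  have K: "K \<ge> 0"
  proof -
    have "0 \<le> K * r ^ n0" using step[of n0] norm_ge_zero order_trans by blast
    then show ?thesis using zero_less_power[OF r(1), of n0] by (auto simp: zero_le_mult_iff)
  qed
  have bound: "norm (X (n + k) - X n) \<le> K / (1 - r) * r ^ n" if n: "n \<ge> n0" for n k
  proof -
    have "norm (X (n + k) - X n) \<le> K / (1 - r) * r ^ n * (1 - r ^ k)"
    proof (induction k)
      case (Suc k)
      have "norm (X (n + Suc k) - X n) \<le> norm (X (Suc (n + k)) - X (n + k)) + norm (X (n + k) - X n)"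
        using norm_triangle_ineq[of "X (Suc (n + k)) - X (n + k)" "X (n + k) - X n"] by simp
      also have "\<dots> \<le> K * r ^ (n + k) + K / (1 - r) * r ^ n * (1 - r ^ k)"
        using step[of "n + k"] n Suc by (intro add_mono) auto
      also have "\<dots> = K / (1 - r) * r ^ n * (1 - r ^ Suc k)"
        using r by (simp add: field_simps power_add)
      finally show ?case .
    qed simp
    also have "\<dots> \<le> K / (1 - r) * r ^ n * 1"
      using r K by (intro mult_left_mono) auto
    finally show ?thesis by simp
  qed
  have "Cauchy X"
  proof (rule metric_CauchyI)
    fix e :: real assume e: "e > 0"
    have "(\<lambda>n. K / (1 - r) * r ^ n) \<longlonglongrightarrow> K / (1 - r) * 0"
      using r by (intro tendsto_intros LIMSEQ_realpow_zero) auto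
    then have "\<forall>\<^sub>F n in sequentially. K / (1 - r) * r ^ n < e / 2"
      using e by (intro order_tendstoD(2)) auto
    then obtain N where N: "\<And>n. n \<ge> N \<Longrightarrow> K / (1 - r) * r ^ n < e / 2"
      by (auto simp: eventually_sequentially)
    let ?N = "max N n0"
    have half: "dist (X m) (X ?N) < e / 2" if m: "m \<ge> ?N" for m
    proof -
      have "?N + (m - ?N) = m" using m by simp
      then have "norm (X m - X ?N) \<le> K / (1 - r) * r ^ ?N" using bound[of ?N "m - ?N"] by (metis max.cobounded2)
      also have "\<dots> < e / 2" by (rule N) simp
      finally show ?thesis by (simp only: dist_norm)
    qed
    show "\<exists>M. \<forall>m\<ge>M. \<forall>n\<ge>M. dist (X m) (X n) < e"
      by (intro exI[of _ ?N] allI impI) (metis half dist_triangle_half_l dist_commute)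
  qed
  then obtain P where P: "X \<longlonglongrightarrow> P" using Cauchy_convergent convergent_def by blast
  have "norm (P - X n) \<le> K / (1 - r) * r ^ n" if "n \<ge> n0" for n
  proof (rule LIMSEQ_le_const2)
    show "(\<lambda>k. norm (X (n + k) - X n)) \<longlonglongrightarrow> norm (P - X n)"
      by (intro tendsto_intros LIMSEQ_ignore_initial_segment[OF P, of n, simplified add.commute[of _ n]])
  qed (use bound[OF that] in blast)
  then show ?thesis using P by blast
qed

lemma tendsto_matrix_mult:
  fixes f :: "'a \<Rightarrow> real ^ 'n ^ 'm" and g :: "'a \<Rightarrow> real ^ 'k ^ 'n"
  assumes "(f \<longlongrightarrow> a) F" "(g \<longlongrightarrow> b) F"
  shows "((\<lambda>x. f x ** g x) \<longlongrightarrow> a ** b) F"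
  unfolding matrix_matrix_mult_def
  by (intro vec_tendstoI) (simp, intro tendsto_intros tendsto_vec_nth assms)

lemma tendsto_matrix_vector_mult:
  fixes f :: "'a \<Rightarrow> real ^ 'n ^ 'm"
  assumes "(f \<longlongrightarrow> a) F"
  shows "((\<lambda>x. f x *v v) \<longlongrightarrow> a *v v) F"
  unfolding matrix_vector_mult_def
  by (intro vec_tendstoI) (simp, intro tendsto_intros tendsto_vec_nth assms)

lemma tendsto_transpose:
  fixes f :: "'a \<Rightarrow> real ^ 'n ^ 'm"
  assumes "(f \<longlongrightarrow> a) F"
  shows "((\<lambda>x. transpose (f x)) \<longlongrightarrow> transpose a) F"
  unfolding transpose_def
  by (intro vec_tendstoI) (simp, intro tendsto_intros tendsto_vec_nth assms)

lemma tendsto_trace: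
  fixes f :: "'a \<Rightarrow> real ^ 'n ^ 'n"
  assumes "(f \<longlongrightarrow> a) F"
  shows "((\<lambda>x. trace (f x)) \<longlongrightarrow> trace a) F"
  unfolding trace_def by (intro tendsto_intros tendsto_vec_nth assms)

text \<open>
  The fixed vectors of \<open>Q\<close> grow at most at the rate \<open>l'\<close>, all others exactly at the rate \<open>l\<close>. The rates are stated
  without logarithms, so that vectors that are mapped to \<open>0\<close> need no special treatment.
\<close>

definition splits_growth :: "(nat \<Rightarrow> real ^ 'n ^ 'n) \<Rightarrow> real \<Rightarrow> real \<Rightarrow> real ^ 'n ^ 'n \<Rightarrow> bool" where
  "splits_growth L l l' Q \<longleftrightarrow> (\<forall>v e. e > 0 \<longrightarrow> (\<forall>\<^sub>F n in sequentially.
     if Q *v v = v then norm (L n *v v) \<le> exp (real n * (l' + e))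
     else exp (real n * (l - e)) \<le> norm (L n *v v) \<and> norm (L n *v v) \<le> exp (real n * (l + e))))"

lemma splits_growth_slow:
  assumes "splits_growth L l l' Q" "Q *v v = v" "e > 0"
  shows "\<forall>\<^sub>F n in sequentially. norm (L n *v v) \<le> exp (real n * (l' + e))"
  using assms(1)[unfolded splits_growth_def, rule_format, OF assms(3), of v] assms(2) by simp

lemma splits_growth_fast:
  assumes "splits_growth L l l' Q" "Q *v v \<noteq> v" "e > 0"
  shows "\<forall>\<^sub>F n in sequentially. exp (real n * (l - e)) \<le> norm (L n *v v) \<and> norm (L n *v v) \<le> exp (real n * (l + e))"
  using assms(1)[unfolded splits_growth_def, rule_format, OF assms(3), of v] assms(2) by simp

text \<open>
  Products \<open>L n\<close> of matrices \<open>B n\<close> of subexponential size whose singular values, the square roots of the \<open>s n i\<close>,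
  are separated: \<open>p\<close> of them have rate \<open>l\<close>, the others have rate at most \<open>l'\<close>.
\<close>

locale gap_sequence =
  fixes L B :: "nat \<Rightarrow> real ^ 'n ^ 'n" and u :: "nat \<Rightarrow> 'n \<Rightarrow> real ^ 'n" and s :: "nat \<Rightarrow> 'n \<Rightarrow> real"
    and l l' :: real and p :: nat
  assumes L_Suc: "L (Suc n) = B n ** L n"
    and B_sub: "e > 0 \<Longrightarrow> \<forall>\<^sub>F n in sequentially. norm (B n) \<le> exp (real n * e)"
    and frame: "orthonormal_frame (u n)" and gram: "transpose (L n) ** L n = frame_diag (u n) (s n)"
    and s_nonneg: "0 \<le> s n i"
    and lt: "l' < l"
    and gap: "e > 0 \<Longrightarrow> \<forall>\<^sub>F n in sequentially. \<exists>I. card I = p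
      \<and> (\<forall>i\<in>I. exp (2 * real n * (l - e)) \<le> s n i \<and> s n i \<le> exp (2 * real n * (l + e)))
      \<and> (\<forall>i\<in>-I. s n i \<le> exp (2 * real n * (l' + e)))"
begin

definition "\<theta> = (l + l') / 2"
definition "slow n i \<longleftrightarrow> s n i < exp (2 * real n * \<theta>)"
definition "slow_proj n = frame_diag (u n) (\<lambda>i. if slow n i then 1 else 0)"

lemma orth_proj_slow_proj: "orth_proj (slow_proj n)"
proof -
  have "(\<lambda>i. (if slow n i then 1 else 0) * (if slow n i then 1 else (0::real))) = (\<lambda>i. if slow n i then 1 else 0)"
    by auto
  then show ?thesis
    by (simp add: orth_proj_def slow_proj_def transpose_frame_diag[OF frame] frame_diag_mult[OF frame])
qed

lemma norm_L_sq: "(norm (L n *v v))\<^sup>2 = (\<Sum>i\<in>UNIV. s n i * (u n i \<bullet> v)\<^sup>2)"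
  unfolding norm_matrix_vector_sq gram by (rule frame_diag_quad[OF frame])

text \<open>
  The index set of the spectral gap is the set of indices above the threshold \<open>\<theta>\<close>, so it does not depend on \<open>e\<close>.
\<close>

lemma separated:
  assumes e: "0 < e" "e \<le> (l - l') / 4"
  shows "\<forall>\<^sub>F n in sequentially.
    (\<forall>i. \<not> slow n i \<longrightarrow> exp (2 * real n * (l - e)) \<le> s n i) \<and>
    (\<forall>i. slow n i \<longrightarrow> s n i \<le> exp (2 * real n * (l' + e))) \<and>
    (\<forall>i. s n i \<le> exp (2 * real n * (l + e))) \<and>
    trace (slow_proj n) = real CARD('n) - real p"
  using gap[OF e(1)] eventually_gt_at_top[of 0]
proof eventually_elim
  case (elim n)
  then obtain I where I: "card I = p"
      "\<And>i. i \<in> I \<Longrightarrow> exp (2 * real n * (l - e)) \<le> s n i" "\<And>i. i \<in> I \<Longrightarrow> s n i \<le> exp (2 * real n * (l + e))"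
      "\<And>i. i \<notin> I \<Longrightarrow> s n i \<le> exp (2 * real n * (l' + e))" by auto
  have mono: "exp (2 * real n * x) \<le> exp (2 * real n * y)" if "x \<le> y" for x y
    using that elim by simp
  have smono: "exp (2 * real n * x) < exp (2 * real n * y)" if "x < y" for x y
    using that elim by simp
  have "\<theta> \<le> l - e" "l' + e < \<theta>" "l' + e \<le> l + e" using e lt by (auto simp: \<theta>_def field_simps)
  then have I_slow: "slow n i \<longleftrightarrow> i \<notin> I" for i
  proof (cases "i \<in> I")
    case True
    then show ?thesis using order_trans[OF mono[OF \<open>\<theta> \<le> l - e\<close>] I(2)[OF True]] unfolding slow_def by (simp add: not_less)
  next
    case False
    then show ?thesis using le_less_trans[OF I(4)[OF False] smono[OF \<open>l' + e < \<theta>\<close>]] unfolding slow_def by simp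
  qed
  have le: "s n i \<le> exp (2 * real n * (l + e))" for i
    using I(3)[of i] order_trans[OF I(4)[of i] mono[OF \<open>l' + e \<le> l + e\<close>]] by (cases "i \<in> I") blast+
  have "trace (slow_proj n) = (\<Sum>i\<in>UNIV. if i \<in> - I then 1 else 0)"
    unfolding slow_proj_def trace_frame_diag[OF frame] I_slow by (rule sum.cong) auto
  also have "\<dots> = real (card (- I))" by (simp add: sum.If_cases Compl_eq)
  also have "\<dots> = real CARD('n) - real p"
    using I(1) card_mono[of UNIV I] by (simp add: Compl_eq_Diff_UNIV card_Diff_subset of_nat_diff)
  finally show ?case using I le I_slow by auto
qed

lemma bounds:
  assumes e: "0 < e" "e \<le> (l - l') / 4"
  shows "\<forall>\<^sub>F n in sequentially.
    (\<forall>v. norm (L n *v (slow_proj n *v v)) \<le> exp (real n * (l' + e)) * norm v) \<and>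
    (\<forall>v. exp (real n * (l - e)) * norm (v - slow_proj n *v v) \<le> norm (L n *v v)) \<and>
    (\<forall>v. norm (L n *v v) \<le> exp (real n * (l + e)) * norm v)"
  using separated[OF e]
proof eventually_elim
  case (elim n)
  have sq: "(exp (real n * x))\<^sup>2 = exp (2 * real n * x)" for x
    by (simp add: power2_eq_square exp_add[symmetric])
  have inner: "u n i \<bullet> (slow_proj n *v v) = (if slow n i then 1 else 0) * (u n i \<bullet> v)" for i v
    unfolding slow_proj_def by (rule frame_inner_diag[OF frame])
  have 1: "norm (L n *v (slow_proj n *v v)) \<le> exp (real n * (l' + e)) * norm v" for v
  proof (rule power2_le_imp_le)
    show "(norm (L n *v (slow_proj n *v v)))\<^sup>2 \<le> (exp (real n * (l' + e)) * norm v)\<^sup>2"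
      unfolding norm_L_sq power_mult_distrib sq frame_norm_sq[OF frame, of v n] sum_distrib_left inner
      by (rule sum_mono) (use elim in \<open>auto intro!: mult_right_mono\<close>)
  qed simp
  have 2: "exp (real n * (l - e)) * norm (v - slow_proj n *v v) \<le> norm (L n *v v)" for v
  proof (rule power2_le_imp_le)
    show "(exp (real n * (l - e)) * norm (v - slow_proj n *v v))\<^sup>2 \<le> (norm (L n *v v))\<^sup>2"
      unfolding norm_L_sq power_mult_distrib sq frame_norm_sq[OF frame, of "v - slow_proj n *v v" n] sum_distrib_left inner_diff_right inner
      by (rule sum_mono) (use elim s_nonneg in \<open>auto intro!: mult_right_mono\<close>)
  qed simp
  have 3: "norm (L n *v v) \<le> exp (real n * (l + e)) * norm v" for v
  proof (rule power2_le_imp_le)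
    show "(norm (L n *v v))\<^sup>2 \<le> (exp (real n * (l + e)) * norm v)\<^sup>2"
      unfolding norm_L_sq power_mult_distrib sq frame_norm_sq[OF frame, of v n] sum_distrib_left
      by (rule sum_mono) (use elim in \<open>auto intro!: mult_right_mono\<close>)
  qed simp
  show ?case using 1 2 3 by blast
qed

text \<open>
  A slow vector \<open>w\<close> of time \<open>n\<close> satisfies \<open>exp ((n + 1) (l - e)) |w - \<Pi> w| \<le> |L (n + 1) w| \<le> exp (n e) exp (n (l' + e)) |w|\<close>, where
  \<open>\<Pi>\<close> is the slow projection of time \<open>n + 1\<close>.
\<close>

lemma step_bound:
  assumes e: "0 < e" "e \<le> (l - l') / 4"
  shows "\<forall>\<^sub>F n in sequentially. norm (slow_proj (Suc n) - slow_proj n)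
     \<le> sqrt 2 * real CARD('n) * exp (e - l) * exp (- (l - l' - 3 * e)) ^ n"
  using bounds[OF e] eventually_compose_filterlim[OF bounds[OF e] filterlim_Suc]
    separated[OF e] eventually_compose_filterlim[OF separated[OF e] filterlim_Suc] B_sub[OF e(1)]
proof eventually_elim
  case (elim n)
  let ?m = "Suc n"
  have "norm (((mat 1 - slow_proj ?m) ** slow_proj n) *v v) \<le> exp (e - l) * exp (- (l - l' - 3 * e)) ^ n * norm v" for v
  proof -
    let ?w = "slow_proj n *v v"
    have "exp (real ?m * (l - e)) * norm (?w - slow_proj ?m *v ?w) \<le> norm (L ?m *v ?w)"
      using elim(2) by blast
    also have "\<dots> = norm (B n *v (L n *v ?w))" by (simp only: L_Suc matrix_vector_mul_assoc[symmetric])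
    also have "\<dots> \<le> norm (B n) * norm (L n *v ?w)" by (rule norm_matrix_vector_le)
    also have "\<dots> \<le> exp (real n * e) * (exp (real n * (l' + e)) * norm v)"
      using elim by (intro mult_mono) auto
    finally have "norm (?w - slow_proj ?m *v ?w) \<le> exp (real n * e) * (exp (real n * (l' + e)) * norm v) / exp (real ?m * (l - e))"
      by (simp add: pos_le_divide_eq mult.commute)
    also have "\<dots> = exp (real n * e + real n * (l' + e) - real ?m * (l - e)) * norm v"
      by (simp add: exp_add exp_diff)
    also have "real n * e + real n * (l' + e) - real ?m * (l - e) = (e - l) + real n * (- (l - l' - 3 * e))"
      by (simp add: algebra_simps)
    also have "exp \<dots> = exp (e - l) * exp (- (l - l' - 3 * e)) ^ n"
      by (simp only: exp_add exp_of_nat_mult)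
    finally show ?thesis
      by (simp add: matrix_vector_mul_assoc[symmetric] matrix_vector_mult_diff_rdistrib)
  qed
  from norm_le_of_apply[OF this]
  have "norm ((mat 1 - slow_proj ?m) ** slow_proj n) \<le> real CARD('n) * (exp (e - l) * exp (- (l - l' - 3 * e)) ^ n)" .
  moreover have "norm (slow_proj ?m - slow_proj n) = sqrt 2 * norm ((mat 1 - slow_proj ?m) ** slow_proj n)"
    by (rule orth_proj_dist[OF orth_proj_slow_proj orth_proj_slow_proj]) (use elim in auto)
  ultimately show ?case by (simp add: mult.assoc mult_left_mono)
qed

definition "P = lim slow_proj"

lemma slow_proj_rate:
  assumes e: "0 < e" "e \<le> (l - l') / 4"
  shows "slow_proj \<longlonglongrightarrow> P" "\<exists>K\<ge>0. \<forall>\<^sub>F n in sequentially. norm (P - slow_proj n) \<le> K * exp (- real n * (l - l' - 3 * e))"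
proof -
  let ?r = "exp (- (l - l' - 3 * e))"
  let ?K = "sqrt 2 * real CARD('n) * exp (e - l)"
  have r: "0 < ?r" "?r < 1" using e lt by auto
  obtain n0 where n0: "\<And>n. n \<ge> n0 \<Longrightarrow> norm (slow_proj (Suc n) - slow_proj n) \<le> ?K * ?r ^ n"
    using step_bound[OF e] by (auto simp: eventually_sequentially)
  obtain P' where P': "slow_proj \<longlonglongrightarrow> P'" "\<forall>n\<ge>n0. norm (P' - slow_proj n) \<le> ?K / (1 - ?r) * ?r ^ n"
    using geometric_limit[OF r n0] by blast
  have eq: "P' = P" unfolding P_def using P'(1) by (simp add: limI)
  then show "slow_proj \<longlonglongrightarrow> P" using P' by simp
  have "?r ^ n = exp (- real n * (l - l' - 3 * e))" for n
    by (simp add: exp_of_nat_mult[symmetric] algebra_simps)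
  then show "\<exists>K\<ge>0. \<forall>\<^sub>F n in sequentially. norm (P - slow_proj n) \<le> K * exp (- real n * (l - l' - 3 * e))"
    using P'(2) r unfolding eq eventually_sequentially by (intro exI[of _ "?K / (1 - ?r)"]) auto
qed

lemma slow_proj_tendsto: "slow_proj \<longlonglongrightarrow> P"
  by (rule slow_proj_rate(1)[of "(l - l') / 4"]) (use lt in auto)

lemma orth_proj_P: "orth_proj P"
proof -
  have "(\<lambda>n. transpose (slow_proj n)) \<longlonglongrightarrow> transpose P" "(\<lambda>n. slow_proj n ** slow_proj n) \<longlonglongrightarrow> P ** P"
    by (intro tendsto_transpose tendsto_matrix_mult slow_proj_tendsto)+
  then have "transpose P = P" "P ** P = P"
    using orth_proj_slow_proj slow_proj_tendsto unfolding orth_proj_def by (simp_all add: LIMSEQ_unique)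
  then show ?thesis by (simp add: orth_proj_def)
qed

lemma trace_P: "trace P = real CARD('n) - real p"
proof -
  have "\<forall>\<^sub>F n in sequentially. trace (slow_proj n) = real CARD('n) - real p"
    using separated[of "(l - l') / 4"] lt by (auto elim: eventually_mono)
  then have "(\<lambda>n. trace (slow_proj n)) \<longlonglongrightarrow> real CARD('n) - real p" by (rule tendsto_eventually)
  then show ?thesis using tendsto_trace[OF slow_proj_tendsto] by (rule LIMSEQ_unique[symmetric])
qed

text \<open>
  Split \<open>v\<close> into its slow part at time \<open>n\<close> and an error of order \<open>exp (- n (l - l' - 3 e))\<close>; the error is
  stretched at most by \<open>exp (n (l + e))\<close>, which leaves \<open>exp (n (l' + 4 e))\<close>.
\<close>

lemma slow_growth:
  assumes v: "P *v v = v" and e0: "e0 > 0"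
  shows "\<forall>\<^sub>F n in sequentially. norm (L n *v v) \<le> exp (real n * (l' + e0))"
proof -
  \<comment> \<open>Five units of \<open>e\<close> are spent below; the second bound keeps the rate \<open>l - l' - 3 e\<close> positive.\<close>
  define e where "e = min (e0 / 5) ((l - l') / 6)"
  have e: "0 < e" "e \<le> (l - l') / 4" "5 * e \<le> e0" using lt e0 by (auto simp: e_def min_def)
  obtain K where K: "K \<ge> 0" "\<forall>\<^sub>F n in sequentially. norm (P - slow_proj n) \<le> K * exp (- real n * (l - l' - 3 * e))"
    using slow_proj_rate(2)[OF e(1,2)] by blast
  show ?thesis
    using K(2) bounds[OF e(1,2)] eventually_le_exp[OF e(1), of "(1 + K) * norm v"]
  proof eventually_elim
    case (elim n)
    have "v = slow_proj n *v v + (P - slow_proj n) *v v" by (simp add: matrix_vector_mult_diff_rdistrib v)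
    then have "norm (L n *v v) = norm (L n *v (slow_proj n *v v) + L n *v ((P - slow_proj n) *v v))"
      by (metis matrix_vector_right_distrib)
    also have "\<dots> \<le> norm (L n *v (slow_proj n *v v)) + norm (L n *v ((P - slow_proj n) *v v))"
      by (rule norm_triangle_ineq)
    finally have split: "norm (L n *v v) \<le> norm (L n *v (slow_proj n *v v)) + norm (L n *v ((P - slow_proj n) *v v))" .
    have slow: "norm (L n *v (slow_proj n *v v)) \<le> exp (real n * (l' + e)) * norm v" using elim(2) by blast
    have "norm ((P - slow_proj n) *v v) \<le> norm (P - slow_proj n) * norm v" by (rule norm_matrix_vector_le)
    also have "\<dots> \<le> K * exp (- real n * (l - l' - 3 * e)) * norm v" by (rule mult_right_mono[OF elim(1)]) simp
    finally have err: "norm ((P - slow_proj n) *v v) \<le> K * exp (- real n * (l - l' - 3 * e)) * norm v" .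
    have "norm (L n *v ((P - slow_proj n) *v v)) \<le> exp (real n * (l + e)) * norm ((P - slow_proj n) *v v)"
      using elim(2) by blast
    also have "\<dots> \<le> exp (real n * (l + e)) * (K * exp (- real n * (l - l' - 3 * e)) * norm v)"
      by (rule mult_left_mono[OF err]) simp
    also have "\<dots> = K * norm v * exp (real n * (l' + 4 * e))"
    proof -
      have "exp (real n * (l + e)) * exp (- real n * (l - l' - 3 * e)) = exp (real n * (l' + 4 * e))"
        by (simp add: exp_add[symmetric] algebra_simps)
      then show ?thesis by (simp add: mult_ac)
    qed
    finally have fast: "norm (L n *v ((P - slow_proj n) *v v)) \<le> K * norm v * exp (real n * (l' + 4 * e))" .
    have "norm (L n *v v) \<le> exp (real n * (l' + e)) * norm v + K * norm v * exp (real n * (l' + 4 * e))"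
      using split slow fast by linarith
    also have "exp (real n * (l' + e)) * norm v \<le> exp (real n * (l' + 4 * e)) * norm v"
      using e(1) by (intro mult_right_mono) (auto intro!: mult_left_mono)
    also have "exp (real n * (l' + 4 * e)) * norm v + K * norm v * exp (real n * (l' + 4 * e))
      = (1 + K) * norm v * exp (real n * (l' + 4 * e))" by (simp add: algebra_simps)
    also have "\<dots> \<le> exp (real n * e) * exp (real n * (l' + 4 * e))" using elim(3) by (intro mult_right_mono) auto
    also have "\<dots> = exp (real n * (l' + 5 * e))" by (simp add: exp_add[symmetric] algebra_simps)
    also have "\<dots> \<le> exp (real n * (l' + e0))" using e(3) by (auto intro!: mult_left_mono)
    finally show ?case by simp
  qed
qed

lemma fast_growth:
  assumes v: "P *v v \<noteq> v" and e0: "e0 > 0"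
  shows "\<forall>\<^sub>F n in sequentially. exp (real n * (l - e0)) \<le> norm (L n *v v) \<and> norm (L n *v v) \<le> exp (real n * (l + e0))"
proof -
  define e where "e = min (e0 / 2) ((l - l') / 4)"
  have e: "0 < e" "e \<le> (l - l') / 4" "2 * e \<le> e0" using lt e0 by (auto simp: e_def min_def)
  define c where "c = norm (v - P *v v)"
  have c: "c > 0" using v by (simp add: c_def)
  have "(\<lambda>n. norm (v - slow_proj n *v v)) \<longlonglongrightarrow> c"
    unfolding c_def by (intro tendsto_intros tendsto_matrix_vector_mult slow_proj_tendsto)
  then have "\<forall>\<^sub>F n in sequentially. norm (v - slow_proj n *v v) > c / 2"
    using c by (intro order_tendstoD(1)) auto
  then show ?thesis
    using bounds[OF e(1,2)] eventually_le_exp[OF e(1), of "2 / c"] eventually_le_exp[OF e(1), of "norm v"]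
  proof eventually_elim
    case (elim n)
    have "norm (L n *v v) \<le> exp (real n * (l + e)) * norm v" using elim(2) by blast
    also have "\<dots> \<le> exp (real n * (l + e)) * exp (real n * e)" using elim(4) by simp
    also have "\<dots> = exp (real n * (l + 2 * e))" by (simp add: exp_add[symmetric] algebra_simps)
    also have "\<dots> \<le> exp (real n * (l + e0))" using e(3) by (auto intro!: mult_left_mono)
    finally have 1: "norm (L n *v v) \<le> exp (real n * (l + e0))" .
    have "exp (real n * (l - e0)) \<le> exp (real n * (l - 2 * e))" using e(3) by (auto intro!: mult_left_mono)
    also have "\<dots> = exp (real n * (l - e)) * (1 / exp (real n * e))"
      by (simp add: exp_diff[symmetric] algebra_simps)
    also have "\<dots> \<le> exp (real n * (l - e)) * (c / 2)"
      using elim(3) c by (intro mult_left_mono) (auto simp: field_simps)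
    also have "\<dots> \<le> exp (real n * (l - e)) * norm (v - slow_proj n *v v)" using elim(1) by (intro mult_left_mono) auto
    also have "\<dots> \<le> norm (L n *v v)" using elim(2) by blast
    finally show ?case using 1 by blast
  qed
qed

lemma splits_growth_P: "splits_growth L l l' P"
  unfolding splits_growth_def
proof (intro allI impI)
  fix v :: "real ^ 'n" and e :: real assume "e > 0"
  then show "\<forall>\<^sub>F n in sequentially.
     if P *v v = v then norm (L n *v v) \<le> exp (real n * (l' + e))
     else exp (real n * (l - e)) \<le> norm (L n *v v) \<and> norm (L n *v v) \<le> exp (real n * (l + e))"
    using slow_growth[of v e] fast_growth[of v e] by (cases "P *v v = v") simp_all
qed

text \<open>
  The eigenvalues of the resolvent are exponentially close to \<open>1\<close> on slow and to \<open>0\<close> on fast directions. Unlike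
  \<open>slow_proj\<close>, which involves a choice of eigenvectors, the resolvent is an explicit function of \<open>L n\<close>.
\<close>

lemma resolvent_tendsto: "(\<lambda>n. frame_diag (u n) (\<lambda>i. 1 / (1 + exp (- 2 * real n * \<theta>) * s n i))) \<longlonglongrightarrow> P"
proof -
  define e where "e = (l - l') / 4"
  have e: "0 < e" "e \<le> (l - l') / 4" using lt by (auto simp: e_def)
  let ?q = "\<lambda>n i. 1 / (1 + exp (- 2 * real n * \<theta>) * s n i)"
  let ?d = "\<lambda>n i. ?q n i - (if slow n i then 1 else 0)"
  have bound: "\<forall>\<^sub>F n in sequentially. norm (frame_diag (u n) (?q n) - slow_proj n) \<le> real CARD('n) * exp (- ((l - l') / 2)) ^ n"
    using separated[OF e]
  proof eventually_elim
    case (elim n)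
    have pw: "exp (- ((l - l') / 2)) ^ n = exp (- real n * (l - l') / 2)"
      by (simp add: exp_of_nat_mult[symmetric])
    have "\<bar>?d n i\<bar> \<le> exp (- ((l - l') / 2)) ^ n" for i
    proof (cases "slow n i")
      case True
      let ?x = "exp (- 2 * real n * \<theta>) * s n i"
      have x: "?x \<ge> 0" using s_nonneg by simp
      have "\<bar>1 / (1 + y) - 1\<bar> = y / (1 + y)" if "y \<ge> 0" for y :: real
      proof -
        have "1 / (1 + y) - 1 = - (y / (1 + y))" using that by (simp add: field_simps)
        then show ?thesis using that by simp
      qed
      from this[OF x] have "\<bar>?d n i\<bar> = ?x / (1 + ?x)" using True by simp
      also have "\<dots> \<le> ?x / 1" using x by (intro divide_left_mono) auto
      also have "\<dots> \<le> exp (- 2 * real n * \<theta>) * exp (2 * real n * (l' + e))" using elim True by simp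
      also have "\<dots> = exp (- real n * (l - l') / 2)" by (simp add: exp_add[symmetric] \<theta>_def e_def field_simps)
      finally show ?thesis unfolding pw .
    next
      case False
      let ?x = "exp (- 2 * real n * \<theta>) * s n i"
      have "exp (real n * (l - l') / 2) = exp (- 2 * real n * \<theta>) * exp (2 * real n * (l - e))"
        by (simp add: exp_add[symmetric] \<theta>_def e_def field_simps)
      also have "\<dots> \<le> ?x" using elim False by simp
      finally have x: "exp (real n * (l - l') / 2) \<le> ?x" .
      then have x0: "?x > 0" by (rule less_le_trans[OF exp_gt_zero])
      have "\<bar>?d n i\<bar> = 1 / (1 + ?x)" using False x0 by simp
      also have "\<dots> \<le> 1 / exp (real n * (l - l') / 2)" using x x0 by (intro divide_left_mono) auto
      also have "\<dots> = exp (- real n * (l - l') / 2)" by (simp add: exp_minus inverse_eq_divide)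
      finally show ?thesis unfolding pw .
    qed
    then have "(\<Sum>i\<in>UNIV. \<bar>?d n i\<bar>) \<le> (\<Sum>i\<in>(UNIV::'n set). exp (- ((l - l') / 2)) ^ n)" by (rule sum_mono)
    moreover have "norm (frame_diag (u n) (?q n) - slow_proj n) \<le> (\<Sum>i\<in>UNIV. \<bar>?d n i\<bar>)"
      unfolding slow_proj_def frame_diag_diff[OF frame] by (rule frame_diag_norm_le[OF frame])
    ultimately show ?case by simp
  qed
  have null: "(\<lambda>n. real CARD('n) * exp (- ((l - l') / 2)) ^ n) \<longlonglongrightarrow> real CARD('n) * 0"
    by (rule tendsto_mult_left[OF LIMSEQ_realpow_zero]) (use lt in auto)
  have "(\<lambda>n. frame_diag (u n) (?q n) - slow_proj n) \<longlonglongrightarrow> 0"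
    by (rule Lim_null_comparison[OF bound null[unfolded mult_zero_right]])
  from tendsto_add[OF this slow_proj_tendsto] show ?thesis by simp
qed

end

section \<open>Limiting exponents of the singular values\<close>

definition hinge_sum :: "('n::finite \<Rightarrow> real) \<Rightarrow> real \<Rightarrow> real" where
  "hinge_sum a t = (\<Sum>i\<in>UNIV. max 0 (a i - t))"

lemma ln_one_plus_exp_bounds:
  fixes y :: real
  shows "max 0 y \<le> ln (1 + exp y)" "ln (1 + exp y) \<le> max 0 y + ln 2"
proof -
  have "exp (max 0 y) \<le> 1 + exp y" by (auto simp: max_def intro: less_imp_le)
  then show "max 0 y \<le> ln (1 + exp y)" by (subst ln_ge_iff) (auto intro: add_pos_pos)
  have "1 + exp y \<le> 2 * exp (max 0 y)" by (auto simp: max_def)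
  then have "ln (1 + exp y) \<le> ln (2 * exp (max 0 y))" by (subst ln_le_cancel_iff) (auto intro: add_pos_pos)
  then show "ln (1 + exp y) \<le> max 0 y + ln 2" by (simp add: ln_mult)
qed

text \<open>
  Truncation from below at \<open>t0\<close> keeps the exponents in a compact set and gives the singular value
  \<open>0\<close> a real exponent; hinge sums at levels \<open>t \<ge> t0\<close> do not see the difference.
\<close>

definition trunc_exponent :: "real \<Rightarrow> nat \<Rightarrow> real \<Rightarrow> real" where
  "trunc_exponent t0 n s = (if s = 0 then t0 else max t0 (ln s / (2 * real n)))"

lemma ln_one_plus_scaled:
  assumes n: "n \<ge> 1" and s: "s \<ge> 0" and t: "t \<ge> t0"
  shows "\<bar>ln (1 + (exp (- (real n * t)))\<^sup>2 * s) / real n - 2 * max 0 (trunc_exponent t0 n s - t)\<bar> \<le> ln 2 / real n"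
proof (cases "s = 0")
  case True
  then show ?thesis using t by (simp add: trunc_exponent_def)
next
  case False
  then have s: "s > 0" using s by simp
  define y where "y = ln s - 2 * real n * t"
  have "(exp (- (real n * t)))\<^sup>2 * s = exp y"
    using s by (simp add: y_def exp_diff exp_minus power2_eq_square exp_add[symmetric] field_simps)
  moreover have "2 * max 0 (trunc_exponent t0 n s - t) = max 0 y / real n"
  proof -
    define x where "x = ln s / (2 * real n)"
    have y: "y = real n * (2 * (x - t))" using n by (simp add: y_def x_def field_simps)
    have "max 0 (trunc_exponent t0 n s - t) = max 0 (x - t)"
      using t False by (auto simp: trunc_exponent_def x_def[symmetric] max_def)
    moreover have "max 0 y = real n * (2 * max 0 (x - t))"
      unfolding y using n by (cases "x \<ge> t") (auto simp: max_def mult_le_0_iff zero_le_mult_iff)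
    ultimately show ?thesis using n by simp
  qed
  moreover have "\<bar>ln (1 + exp y) / real n - max 0 y / real n\<bar> \<le> ln 2 / real n"
    using ln_one_plus_exp_bounds[of y] n
    by (simp add: diff_divide_distrib[symmetric] abs_divide divide_right_mono)
  ultimately show ?thesis by simp
qed

lemma hinge_sum_tendsto:
  fixes s :: "nat \<Rightarrow> 'n::finite \<Rightarrow> real"
  assumes s: "\<And>n i. s n i \<ge> 0" and t: "t \<ge> t0"
    and lim: "(\<lambda>n. ln (\<Prod>i\<in>UNIV. 1 + (exp (- (real n * t)))\<^sup>2 * s n i) / real n) \<longlonglongrightarrow> g"
  shows "(\<lambda>n. hinge_sum (\<lambda>i. trunc_exponent t0 n (s n i)) t) \<longlonglongrightarrow> g / 2"
proof -
  let ?l = "\<lambda>n i. ln (1 + (exp (- (real n * t)))\<^sup>2 * s n i)"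
  have eq: "ln (\<Prod>i\<in>UNIV. 1 + (exp (- (real n * t)))\<^sup>2 * s n i) = (\<Sum>i\<in>UNIV. ?l n i)" for n
  proof (rule ln_prod)
    fix i
    have "0 < 1 + (exp (- (real n * t)))\<^sup>2 * s n i" by (intro add_pos_nonneg) (auto simp: s)
    then show "1 + (exp (- (real n * t)))\<^sup>2 * s n i \<noteq> 0" by simp
  qed auto
  let ?h = "\<lambda>n. hinge_sum (\<lambda>i. trunc_exponent t0 n (s n i)) t"
  have "(\<lambda>n. (\<Sum>i\<in>UNIV. ?l n i) / real n - 2 * ?h n) \<longlonglongrightarrow> 0"
  proof (rule Lim_null_comparison)
    show "\<forall>\<^sub>F n in sequentially. norm ((\<Sum>i\<in>UNIV. ?l n i) / real n - 2 * ?h n) \<le> real CARD('n) * ln 2 / real n"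
      using eventually_ge_at_top[of 1]
    proof eventually_elim
      case (elim n)
      have split: "(\<Sum>i\<in>UNIV. ?l n i) / real n - 2 * ?h n = (\<Sum>i\<in>UNIV. ?l n i / real n - 2 * max 0 (trunc_exponent t0 n (s n i) - t))"
        by (simp add: hinge_sum_def sum_subtractf sum_divide_distrib sum_distrib_left)
      have "\<bar>(\<Sum>i\<in>UNIV. ?l n i) / real n - 2 * ?h n\<bar> \<le> (\<Sum>i\<in>UNIV. \<bar>?l n i / real n - 2 * max 0 (trunc_exponent t0 n (s n i) - t)\<bar>)"
        unfolding split by (rule sum_abs)
      also have "\<dots> \<le> (\<Sum>i\<in>(UNIV::'n set). ln 2 / real n)"
        by (rule sum_mono) (rule ln_one_plus_scaled[OF elim s t])
      finally show ?case by simp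
    qed
    show "(\<lambda>n. real CARD('n) * ln 2 / real n) \<longlonglongrightarrow> 0" by (rule lim_const_over_n)
  qed
  from tendsto_diff[OF lim[unfolded eq] this] have "(\<lambda>n. 2 * ?h n) \<longlonglongrightarrow> g" by simp
  from tendsto_divide[OF this tendsto_const[of 2]] show ?thesis by simp
qed

text \<open>
  A convergent subsequence of the vectors of exponents realises the limit profile.
\<close>

lemma hinge_limit_profile:
  fixes a :: "nat \<Rightarrow> 'n::finite \<Rightarrow> real"
  assumes ge: "\<And>n i. a n i \<ge> t0" and t0: "t0 \<in> \<rat>"
    and lim: "\<And>t. t \<in> \<rat> \<Longrightarrow> t \<ge> t0 \<Longrightarrow> (\<lambda>n. hinge_sum (a n) t) \<longlonglongrightarrow> g t"
  shows "\<exists>b :: 'n \<Rightarrow> real. (\<forall>i. b i \<ge> t0) \<and> (\<forall>t\<in>\<rat>. t \<ge> t0 \<longrightarrow> g t = hinge_sum b t)"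
proof -
  obtain C where C: "\<And>n. norm (hinge_sum (a n) t0) \<le> C"
    using convergent_imp_Bseq[OF convergentI[OF lim[OF t0 order_refl]]] by (auto simp: Bseq_def)
  have le: "a n i \<le> t0 + C" for n i
  proof -
    have "a n i - t0 \<le> hinge_sum (a n) t0"
      unfolding hinge_sum_def using member_le_sum[of i UNIV "\<lambda>i. max 0 (a n i - t0)"] by simp
    then show ?thesis using C[of n] by simp
  qed
  define v where "v n = (\<chi> i. a n i)" for n
  have "bounded (range v)"
  proof (rule boundedI)
    fix x assume "x \<in> range v"
    then obtain n where "x = v n" by blast
    then have "norm x \<le> (\<Sum>i\<in>UNIV. \<bar>a n i\<bar>)" using norm_le_l1_cart[of "v n"] by (simp add: v_def)
    also have "\<dots> \<le> (\<Sum>i\<in>(UNIV::'n set). \<bar>t0\<bar> + \<bar>t0 + C\<bar>)"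
    proof (rule sum_mono)
      fix i show "\<bar>a n i\<bar> \<le> \<bar>t0\<bar> + \<bar>t0 + C\<bar>" using ge[of n i] le[of n i] by arith
    qed
    finally show "norm x \<le> real CARD('n) * (\<bar>t0\<bar> + \<bar>t0 + C\<bar>)" by simp
  qed
  then obtain w r where r: "strict_mono r" and w: "(v \<circ> r) \<longlonglongrightarrow> w"
    using bounded_imp_convergent_subsequence by blast
  define b where "b i = w $ i" for i
  have b: "(\<lambda>n. a (r n) i) \<longlonglongrightarrow> b i" for i
    using tendsto_vec_nth[OF w, of i] by (simp add: v_def b_def comp_def)
  have "b i \<ge> t0" for i by (rule LIMSEQ_le_const[OF b]) (use ge in blast)
  moreover have "g t = hinge_sum b t" if "t \<in> \<rat>" "t \<ge> t0" for t
  proof -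
    have "(\<lambda>n. hinge_sum (a (r n)) t) \<longlonglongrightarrow> hinge_sum b t"
      unfolding hinge_sum_def by (intro tendsto_intros b)
    moreover have "(\<lambda>n. hinge_sum (a (r n)) t) \<longlonglongrightarrow> g t"
      using LIMSEQ_subseq_LIMSEQ[OF lim[OF that] r] by (simp add: comp_def)
    ultimately show ?thesis by (rule LIMSEQ_unique[symmetric])
  qed
  ultimately show ?thesis by (intro exI[of _ b]) auto
qed

text \<open>
  The slope of a hinge sum at the level \<open>t\<close> counts the exponents above \<open>t\<close>. Difference quotients on either
  side of \<open>t\<close> bound the count from above and below and converge to the same integer; only rational levels
  are needed.
\<close>

lemma hinge_count:
  fixes a :: "nat \<Rightarrow> 'n::finite \<Rightarrow> real"
  assumes lim: "\<And>t. t \<in> \<rat> \<Longrightarrow> t \<ge> t0 \<Longrightarrow> (\<lambda>n. hinge_sum (a n) t) \<longlonglongrightarrow> hinge_sum b t"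
    and t: "t0 < t" "\<And>i. b i \<noteq> t"
  shows "\<forall>\<^sub>F n in sequentially. card {i. a n i \<ge> t} = card {i. b i > t}"
proof -
  \<comment> \<open>No exponent \<open>b i\<close> lies within \<open>d\<close> of the level \<open>t\<close>, so the slope is constant there.\<close>
  define d where "d = Min (insert (t - t0) (range (\<lambda>i. \<bar>b i - t\<bar>)))"
  have "d > 0" unfolding d_def using t by (subst Min_gr_iff) auto
  moreover have "d \<le> t - t0" "d \<le> \<bar>b i - t\<bar>" for i
    unfolding d_def by (auto intro!: Min_le simp del: Min_insert)
  ultimately have d: "d > 0" "d \<le> t - t0" "\<And>i. d \<le> \<bar>b i - t\<bar>" by auto
  let ?k = "real (card {i. b i > t})"
  have slope: "(\<lambda>n. (hinge_sum (a n) q - hinge_sum (a n) q') / (q' - q)) \<longlonglongrightarrow> ?k"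
    if q: "q \<in> \<rat>" "q' \<in> \<rat>" "q < q'" "t - d < q" "q' < t + d" for q q'
  proof -
    have "hinge_sum b q - hinge_sum b q' = (\<Sum>i\<in>UNIV. if b i > t then q' - q else 0)"
      unfolding hinge_sum_def sum_subtractf[symmetric]
    proof (rule sum.cong)
      fix i
      show "max 0 (b i - q) - max 0 (b i - q') = (if b i > t then q' - q else 0)"
        using d(3)[of i] q by (auto simp: max_def abs_if split: if_splits)
    qed simp
    also have "\<dots> = ?k * (q' - q)" by (simp add: sum.If_cases)
    finally have "?k = (hinge_sum b q - hinge_sum b q') / (q' - q)" using q by simp
    moreover have "(\<lambda>n. (hinge_sum (a n) q - hinge_sum (a n) q') / (q' - q)) \<longlonglongrightarrow> (hinge_sum b q - hinge_sum b q') / (q' - q)"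
      by (intro tendsto_intros lim) (use q d in auto)
    ultimately show ?thesis by simp
  qed
  obtain q1 where q1: "q1 \<in> \<rat>" "t - d < q1" "q1 < t" using Rats_dense_in_real[of "t - d" t] d by auto
  obtain q2 where q2: "q2 \<in> \<rat>" "q1 < q2" "q2 < t" using Rats_dense_in_real[of q1 t] q1 by auto
  obtain q3 where q3: "q3 \<in> \<rat>" "t < q3" "q3 < t + d" using Rats_dense_in_real[of t "t + d"] d by auto
  obtain q4 where q4: "q4 \<in> \<rat>" "q3 < q4" "q4 < t + d" using Rats_dense_in_real[of q3 "t + d"] q3 by auto
  have up: "real (card {i. a n i \<ge> t}) \<le> (hinge_sum (a n) q1 - hinge_sum (a n) q2) / (q2 - q1)" for n
  proof -
    have "real (card {i. a n i \<ge> t}) * (q2 - q1) = (\<Sum>i\<in>UNIV. if a n i \<ge> t then q2 - q1 else 0)"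
      by (simp add: sum.If_cases)
    also have "\<dots> \<le> hinge_sum (a n) q1 - hinge_sum (a n) q2"
      unfolding hinge_sum_def sum_subtractf[symmetric]
      by (rule sum_mono) (use q1 q2 in \<open>auto simp: max_def\<close>)
    finally show ?thesis using q2 by (simp add: pos_le_divide_eq)
  qed
  have lo: "(hinge_sum (a n) q3 - hinge_sum (a n) q4) / (q4 - q3) \<le> real (card {i. a n i \<ge> t})" for n
  proof -
    have "hinge_sum (a n) q3 - hinge_sum (a n) q4 \<le> (\<Sum>i\<in>UNIV. if a n i \<ge> t then q4 - q3 else 0)"
      unfolding hinge_sum_def sum_subtractf[symmetric]
      by (rule sum_mono) (use q3 q4 in \<open>auto simp: max_def\<close>)
    also have "\<dots> = real (card {i. a n i \<ge> t}) * (q4 - q3)" by (simp add: sum.If_cases)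
    finally show ?thesis using q4 by (simp add: pos_divide_le_eq)
  qed
  have "\<forall>\<^sub>F n in sequentially. (hinge_sum (a n) q1 - hinge_sum (a n) q2) / (q2 - q1) < ?k + 1"
    by (rule order_tendstoD(2)[OF slope]) (use q1 q2 d in auto)
  moreover have "\<forall>\<^sub>F n in sequentially. (hinge_sum (a n) q3 - hinge_sum (a n) q4) / (q4 - q3) > ?k - 1"
    by (rule order_tendstoD(1)[OF slope]) (use q3 q4 d in auto)
  ultimately show ?thesis
  proof eventually_elim
    case (elim n)
    then have "real (card {i. a n i \<ge> t}) < ?k + 1" "real (card {i. a n i \<ge> t}) > ?k - 1"
      using up[of n] lo[of n] by auto
    then show ?case by linarith
  qed
qed

text \<open>
  Rational levels \<open>t\<close> are countably many, so convergence at all of them holds almost surely.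
\<close>

definition growth_profile :: "(nat \<Rightarrow> 'n::finite \<Rightarrow> real) \<Rightarrow> (real \<Rightarrow> real) \<Rightarrow> bool" where
  "growth_profile s G \<longleftrightarrow> (\<forall>n i. 0 \<le> s n i) \<and>
     (\<forall>t\<in>\<rat>. (\<lambda>n. ln (\<Prod>i\<in>UNIV. 1 + (exp (- (real n * t)))\<^sup>2 * s n i) / real n) \<longlonglongrightarrow> G t)"

definition spectral_gap :: "(nat \<Rightarrow> 'n::finite \<Rightarrow> real) \<Rightarrow> real \<Rightarrow> real \<Rightarrow> nat \<Rightarrow> bool" where
  "spectral_gap s l l' p \<longleftrightarrow> (\<forall>e>0. \<forall>\<^sub>F n in sequentially. \<exists>I. card I = p
      \<and> (\<forall>i\<in>I. exp (2 * real n * (l - e)) \<le> s n i \<and> s n i \<le> exp (2 * real n * (l + e)))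
      \<and> (\<forall>i\<in>-I. s n i \<le> exp (2 * real n * (l' + e))))"

lemma trunc_exponent_less:
  assumes "trunc_exponent t0 n s < x" "n \<ge> 1" "s \<ge> 0"
  shows "s \<le> exp (2 * real n * x)"
proof (cases "s = 0")
  case False
  then have "ln s / (2 * real n) < x" using assms by (auto simp: trunc_exponent_def)
  then have "ln s < 2 * real n * x" using assms(2) by (simp add: field_simps)
  then have "exp (ln s) < exp (2 * real n * x)" by (simp only: exp_less_cancel_iff)
  then show ?thesis using False assms(3) by simp
qed simp

lemma trunc_exponent_ge:
  assumes "x \<le> trunc_exponent t0 n s" "n \<ge> 1" "s \<ge> 0" "t0 < x"
  shows "exp (2 * real n * x) \<le> s"
proof -
  have s: "s > 0" using assms by (cases "s = 0") (auto simp: trunc_exponent_def)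
  then have "x \<le> ln s / (2 * real n)" using assms by (auto simp: trunc_exponent_def)
  then have "2 * real n * x \<le> ln s" using assms(2) by (simp add: field_simps)
  then have "exp (2 * real n * x) \<le> exp (ln s)" by (simp only: exp_le_cancel_iff)
  then show ?thesis using s by simp
qed

text \<open>
  The profile \<open>G\<close> is the hinge sum of some exponents \<open>b\<close>, and \<open>G t0 \<noteq> 0\<close> says that the largest one,
  \<open>l\<close>, exceeds \<open>t0\<close>; \<open>l'\<close> is the next one, or \<open>t0\<close> if there is none. Since \<open>l\<close>, \<open>l'\<close> and the multiplicity \<open>p\<close> depend
  on \<open>G\<close> alone, they serve all sequences with this profile.
\<close>

theorem spectral_gap_exists:
  fixes s0 :: "nat \<Rightarrow> 'n::finite \<Rightarrow> real"
  assumes prof: "growth_profile s0 G" and t0: "t0 \<in> \<rat>" "G t0 \<noteq> 0"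
  shows "\<exists>l l' p. l' < l \<and> p \<ge> 1 \<and> (\<forall>s :: nat \<Rightarrow> 'n \<Rightarrow> real. growth_profile s G \<longrightarrow> spectral_gap s l l' p)"
proof -
  have tr: "(\<lambda>n. hinge_sum (\<lambda>i. trunc_exponent t0 n (s n i)) t) \<longlonglongrightarrow> G t / 2"
    if "growth_profile s G" "t \<in> \<rat>" "t \<ge> t0" for s :: "nat \<Rightarrow> 'n \<Rightarrow> real" and t
    by (rule hinge_sum_tendsto) (use that in \<open>auto simp: growth_profile_def\<close>)
  have "\<exists>b :: 'n \<Rightarrow> real. (\<forall>i. b i \<ge> t0) \<and> (\<forall>t\<in>\<rat>. t \<ge> t0 \<longrightarrow> G t / 2 = hinge_sum b t)"
    by (rule hinge_limit_profile[of t0 "\<lambda>n i. trunc_exponent t0 n (s0 n i)" "\<lambda>t. G t / 2"])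
      (use tr[OF prof] t0 in \<open>auto simp: trunc_exponent_def\<close>)
  then obtain b :: "'n \<Rightarrow> real" where b: "\<And>i. b i \<ge> t0" "\<And>t. t \<in> \<rat> \<Longrightarrow> t \<ge> t0 \<Longrightarrow> G t / 2 = hinge_sum b t"
    by auto
  define l where "l = Max (range b)"
  define l' where "l' = Max (insert t0 {x \<in> range b. x < l})"
  define p where "p = card {i. b i = l}"
  have bl: "b i \<le> l" for i unfolding l_def by simp
  have "l \<in> range b" unfolding l_def by (rule Max_in) auto
  then have p: "p \<ge> 1" unfolding p_def by (auto simp: Suc_le_eq card_gt_0_iff)
  have "l > t0"
  proof (rule ccontr)
    assume "\<not> l > t0"
    then have "b i = t0" for i using b(1)[of i] bl[of i] by simp
    then have "hinge_sum b t0 = 0" by (simp add: hinge_sum_def)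
    then show False using b(2)[OF t0(1)] t0(2) by simp
  qed
  have "l' \<in> insert t0 {x \<in> range b. x < l}" unfolding l'_def by (rule Max_in) auto
  then have l': "l' < l" using \<open>l > t0\<close> by auto
  have l't0: "t0 \<le> l'" unfolding l'_def by simp
  have bl': "b i \<le> l'" if "b i \<noteq> l" for i
    unfolding l'_def by (rule Max_ge) (use bl[of i] that in auto)
  have gap: "spectral_gap s l l' p" if s: "growth_profile s G" for s :: "nat \<Rightarrow> 'n \<Rightarrow> real"
    unfolding spectral_gap_def
  proof (intro allI impI)
    fix e :: real assume e: "e > 0"
    \<comment> \<open>The margins around \<open>l\<close> and \<open>l'\<close> are kept disjoint.\<close>
    define e' where "e' = min e ((l - l') / 3)"
    have e': "e' > 0" "e' \<le> e" "l' + e' < l - e'" using e l' by (auto simp: e'_def min_def field_simps)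
    define a where "a n = (\<lambda>i. trunc_exponent t0 n (s n i))" for n
    have lim: "(\<lambda>n. hinge_sum (a n) t) \<longlonglongrightarrow> hinge_sum b t" if "t \<in> \<rat>" "t \<ge> t0" for t
      using tr[OF s that] b(2)[OF that] by (simp add: a_def)
    have s0: "s n i \<ge> 0" for n i using s by (simp add: growth_profile_def)
    have ne: "b i \<noteq> l' + e'" "b i \<noteq> l - e'" "b i \<noteq> l + e'"
      and gt: "b i > l' + e' \<longleftrightarrow> b i = l" "b i > l - e' \<longleftrightarrow> b i = l" "\<not> b i > l + e'" for i
      using bl'[of i] bl[of i] e'(1,3) by (cases "b i = l"; linarith)+
    have "\<forall>\<^sub>F n in sequentially. card {i. a n i \<ge> l' + e'} = card {i. b i > l' + e'}"
      by (rule hinge_count[OF lim]) (use l't0 e'(1,3) ne in \<open>auto\<close>)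
    moreover have "{i. b i > l' + e'} = {i. b i = l}" using gt by auto
    moreover have "\<forall>\<^sub>F n in sequentially. card {i. a n i \<ge> l - e'} = card {i. b i > l - e'}"
      by (rule hinge_count[OF lim]) (use l't0 e'(1,3) ne in \<open>auto\<close>)
    moreover have "{i. b i > l - e'} = {i. b i = l}" using gt by auto
    moreover have "\<forall>\<^sub>F n in sequentially. card {i. a n i \<ge> l + e'} = card {i. b i > l + e'}"
      by (rule hinge_count[OF lim]) (use l't0 e'(1,3) l' ne in \<open>auto\<close>)
    moreover have "{i. b i > l + e'} = {}" using gt by auto
    ultimately have "\<forall>\<^sub>F n in sequentially. card {i. a n i \<ge> l' + e'} = p \<and> card {i. a n i \<ge> l - e'} = p \<and> card {i. a n i \<ge> l + e'} = 0"
      unfolding p_def by (simp add: eventually_conj_iff)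
    then show "\<forall>\<^sub>F n in sequentially. \<exists>I. card I = p
      \<and> (\<forall>i\<in>I. exp (2 * real n * (l - e)) \<le> s n i \<and> s n i \<le> exp (2 * real n * (l + e)))
      \<and> (\<forall>i\<in>-I. s n i \<le> exp (2 * real n * (l' + e)))"
      using eventually_ge_at_top[of 1]
    proof eventually_elim
      case (elim n)
      let ?I = "{i. a n i \<ge> l - e'}"
      have "?I \<subseteq> {i. a n i \<ge> l' + e'}" using e' by auto
      then have I: "?I = {i. a n i \<ge> l' + e'}" using elim by (intro card_subset_eq) auto
      have mono: "exp (2 * real n * x) \<le> exp (2 * real n * y)" if "x \<le> y" for x y
        using that elim by simp
      have "exp (2 * real n * (l - e)) \<le> s n i" if "i \<in> ?I" for i
        by (rule order_trans[OF mono[of _ "l - e'"] trunc_exponent_ge[of _ t0]])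
          (use that e' elim s0 l't0 in \<open>auto simp: a_def\<close>)
      moreover have "s n i \<le> exp (2 * real n * (l + e))" for i
      proof (rule order_trans[OF trunc_exponent_less[of t0 n "s n i" "l + e'"] mono])
        have "{i. a n i \<ge> l + e'} = {}" using elim by simp
        then show "trunc_exponent t0 n (s n i) < l + e'" by (auto simp: a_def not_le)
      qed (use e' elim s0 in auto)
      moreover have "s n i \<le> exp (2 * real n * (l' + e))" if "i \<notin> ?I" for i
      proof (rule order_trans[OF trunc_exponent_less[of t0 n "s n i" "l' + e'"] mono])
        show "trunc_exponent t0 n (s n i) < l' + e'" using that unfolding I by (auto simp: a_def not_le)
      qed (use e' elim s0 in auto)
      ultimately show ?case using elim by (intro exI[of _ ?I]) auto
    qed
  qed
  then show ?thesis using p l' by blast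
qed

text \<open>
  If \<open>G\<close> vanishes at a level \<open>t\<close> then every singular value is eventually below \<open>exp (n t)\<close>
  up to a subexponential factor.
\<close>

lemma zero_profile_decay:
  fixes s :: "nat \<Rightarrow> 'n::finite \<Rightarrow> real"
  assumes prof: "growth_profile s G" and zero: "\<And>t. t \<in> \<rat> \<Longrightarrow> G t = 0"
  shows "\<forall>\<^sub>F n in sequentially. \<forall>i. s n i \<le> exp (2 * real n * K)"
proof -
  obtain t where t: "t \<in> \<rat>" "K - 1 < t" "t < K" using Rats_dense_in_real[of "K - 1" K] by auto
  have "(\<lambda>n. ln (\<Prod>i\<in>UNIV. 1 + (exp (- (real n * t)))\<^sup>2 * s n i) / real n) \<longlonglongrightarrow> 0"
    using prof t zero[OF t(1)] by (auto simp: growth_profile_def)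
  then have "\<forall>\<^sub>F n in sequentially. ln (\<Prod>i\<in>UNIV. 1 + (exp (- (real n * t)))\<^sup>2 * s n i) / real n < 2 * (K - t)"
    using t by (intro order_tendstoD(2)) auto
  then show ?thesis using eventually_gt_at_top[of 0]
  proof eventually_elim
    case (elim n)
    let ?x = "\<lambda>i. (exp (- (real n * t)))\<^sup>2 * s n i"
    have s0: "s n i \<ge> 0" for i using prof by (simp add: growth_profile_def)
    have "s n i \<le> exp (2 * real n * K)" for i
    proof -
      have "1 + ?x i \<le> (\<Prod>i\<in>UNIV. 1 + ?x i)"
      proof -
        have "(\<Prod>i\<in>UNIV. 1 + ?x i) = (1 + ?x i) * (\<Prod>i\<in>UNIV - {i}. 1 + ?x i)"
          by (rule prod.remove) auto
        moreover have "1 \<le> (\<Prod>i\<in>UNIV - {i}. 1 + ?x i)" by (rule prod_ge_1) (simp add: s0)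
        ultimately show ?thesis using s0[of i] mult_left_mono[of 1 "\<Prod>i\<in>UNIV - {i}. 1 + ?x i" "1 + ?x i"] by simp
      qed
      also have "\<dots> \<le> exp (2 * (K - t) * real n)"
      proof -
        have pos: "0 < (\<Prod>i\<in>UNIV. 1 + ?x i)" by (rule prod_pos) (simp add: s0 add_pos_nonneg)
        have "ln (\<Prod>i\<in>UNIV. 1 + ?x i) \<le> 2 * (K - t) * real n" using elim by (simp add: pos_divide_less_eq)
        then have "exp (ln (\<Prod>i\<in>UNIV. 1 + ?x i)) \<le> exp (2 * (K - t) * real n)" by (simp only: exp_le_cancel_iff)
        then show ?thesis using pos by simp
      qed
      finally have "?x i \<le> exp (2 * (K - t) * real n)" by simp
      then have "exp (2 * real n * t) * ?x i \<le> exp (2 * real n * t) * exp (2 * (K - t) * real n)" by simp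
      moreover have "exp (2 * real n * t) * ?x i = s n i"
        by (simp add: power2_eq_square exp_minus exp_add[symmetric] field_simps)
      moreover have "exp (2 * real n * t) * exp (2 * (K - t) * real n) = exp (2 * real n * K)"
        by (simp add: exp_add[symmetric] algebra_simps)
      ultimately show ?thesis by simp
    qed
    then show ?case by blast
  qed
qed

section \<open>The top exponent of a matrix cocycle\<close>

lemma tendsto_det:
  fixes f :: "'a \<Rightarrow> real ^ 'n ^ 'n"
  assumes "(f \<longlongrightarrow> a) F"
  shows "((\<lambda>x. det (f x)) \<longlongrightarrow> det a) F"
  unfolding det_def by (intro tendsto_intros tendsto_vec_nth assms)

lemma measurable_vec_nth:
  fixes f :: "'a \<Rightarrow> 'b :: euclidean_space ^ 'n"
  assumes "f \<in> borel_measurable M"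
  shows "(\<lambda>x. f x $ i) \<in> borel_measurable M"
  by (rule measurable_compose[OF assms borel_measurable_continuous_onI])
    (auto simp: continuous_on_def intro: tendsto_vec_nth)

lemma measurable_vec_lambda:
  fixes f :: "'n :: finite \<Rightarrow> 'a \<Rightarrow> 'b :: euclidean_space"
  assumes "\<And>i. f i \<in> borel_measurable M"
  shows "(\<lambda>x. \<chi> i. f i x) \<in> borel_measurable M"
proof (subst borel_measurable_euclidean_space, intro ballI)
  fix b :: "'b ^ 'n" assume "b \<in> Basis"
  then obtain i c where b: "b = axis i c" "c \<in> Basis" by (auto simp: Basis_vec_def)
  have "(\<lambda>x. (\<chi> i. f i x) \<bullet> b) = (\<lambda>x. f i x \<bullet> c)" by (simp add: b inner_axis)
  then show "(\<lambda>x. (\<chi> i. f i x) \<bullet> b) \<in> borel_measurable M" using assms[of i] by simp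
qed

lemma measurable_det:
  fixes f :: "'a \<Rightarrow> real ^ 'n ^ 'n"
  assumes "f \<in> borel_measurable M"
  shows "(\<lambda>x. det (f x)) \<in> borel_measurable M"
  by (rule measurable_compose[OF assms borel_measurable_continuous_onI])
    (auto simp: continuous_on_def intro: tendsto_det)

lemma measurable_matrix_mult:
  fixes f :: "'a \<Rightarrow> real ^ 'n ^ 'm" and g :: "'a \<Rightarrow> real ^ 'k ^ 'n"
  assumes "f \<in> borel_measurable M" "g \<in> borel_measurable M"
  shows "(\<lambda>x. f x ** g x) \<in> borel_measurable M"
proof (rule borel_measurable_continuous_Pair[OF assms])
  have "((\<lambda>x. fst x ** snd x) \<longlongrightarrow> fst p ** snd p) (at p)" for p :: "(real ^ 'n ^ 'm) \<times> (real ^ 'k ^ 'n)"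
    by (rule tendsto_matrix_mult[OF tendsto_fst[OF tendsto_ident_at] tendsto_snd[OF tendsto_ident_at]])
  then show "continuous_on UNIV (\<lambda>x :: (real ^ 'n ^ 'm) \<times> (real ^ 'k ^ 'n). fst x ** snd x)"
    by (simp add: continuous_on_def)
qed

lemma measurable_transpose:
  fixes f :: "'a \<Rightarrow> real ^ 'n ^ 'm"
  assumes "f \<in> borel_measurable M"
  shows "(\<lambda>x. transpose (f x)) \<in> borel_measurable M"
  by (rule measurable_compose[OF assms borel_measurable_continuous_onI])
    (auto simp: continuous_on_def intro: tendsto_transpose)

lemma measurable_orth_proj_or_0:
  fixes f :: "'a \<Rightarrow> real ^ 'n ^ 'n"
  assumes f: "f \<in> borel_measurable M"
  shows "(\<lambda>x. if orth_proj (f x) then f x else 0) \<in> borel_measurable M"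
proof (rule measurable_If[OF f])
  have "{x \<in> space M. orth_proj (f x)} = {x \<in> space M. transpose (f x) = f x} \<inter> {x \<in> space M. f x ** f x = f x}"
    by (auto simp: orth_proj_def)
  also have "\<dots> \<in> sets M"
    by (intro sets.Int measurable_equality_set f measurable_transpose[OF f] measurable_matrix_mult[OF f f])
  finally show "{x \<in> space M. orth_proj (f x)} \<in> sets M" .
qed simp

text \<open>
  Cramer's formula exhibits the inverse as a quotient of determinants, which makes its measurability evident.
\<close>

definition cramer_inverse :: "real ^ 'n ^ 'n \<Rightarrow> real ^ 'n ^ 'n" where
  "cramer_inverse Y = (\<chi> i j. det (\<chi> a b. if b = i then axis j 1 $ a else Y $ a $ b) / det Y)"

lemma cramer_inverse_eq:
  assumes "Y ** R = mat 1"
  shows "R = cramer_inverse Y"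
proof -
  have "det Y * det R = 1" using arg_cong[OF assms, of det] by (simp add: det_mul)
  then have det: "det Y \<noteq> 0" by auto
  have "R $ i $ j = cramer_inverse Y $ i $ j" for i j
  proof -
    have "Y *v (R *v axis j 1) = axis j 1" by (simp add: matrix_vector_mul_assoc assms)
    then have "R *v axis j 1 = (\<chi> k. det (\<chi> a b. if b = k then axis j 1 $ a else Y $ a $ b) / det Y)"
      using cramer[OF det] by blast
    moreover have "(R *v axis j 1) $ i = R $ i $ j" by (simp add: matrix_vector_mult_basis column_def)
    ultimately show ?thesis by (simp add: cramer_inverse_def)
  qed
  then show ?thesis by (simp add: vec_eq_iff)
qed

lemma measurable_cramer_inverse:
  fixes f :: "'a \<Rightarrow> real ^ 'n ^ 'n"
  assumes f: "f \<in> borel_measurable M"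
  shows "(\<lambda>x. cramer_inverse (f x)) \<in> borel_measurable M"
proof -
  have *: "(\<lambda>x. \<chi> a b. if b = i then axis j 1 $ a else f x $ a $ b) \<in> borel_measurable M" for i j :: 'n
  proof (intro measurable_vec_lambda)
    fix a b show "(\<lambda>x. if b = i then axis j 1 $ a else f x $ a $ b) \<in> borel_measurable M"
      using measurable_vec_nth[OF measurable_vec_nth[OF f]] by (cases "b = i") auto
  qed
  show ?thesis unfolding cramer_inverse_def
  proof (intro measurable_vec_lambda)
    fix i j
    show "(\<lambda>x. det (\<chi> a b. if b = i then axis j 1 $ a else f x $ a $ b) / det (f x)) \<in> borel_measurable M"
      by (rule borel_measurable_divide[OF measurable_det[OF *] measurable_det[OF f]])
  qed
qed

primrec matrix_iterate :: "('a \<Rightarrow> 'a) \<Rightarrow> ('a \<Rightarrow> real ^ 'n ^ 'n) \<Rightarrow> nat \<Rightarrow> 'a \<Rightarrow> real ^ 'n ^ 'n" where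
  "matrix_iterate T B 0 x = mat 1"
| "matrix_iterate T B (Suc n) x = B ((T ^^ n) x) ** matrix_iterate T B n x"

lemma matrix_iterate_add:
  "matrix_iterate T B (n + m) x = matrix_iterate T B m ((T ^^ n) x) ** matrix_iterate T B n x"
proof (induction m)
  case (Suc m)
  have "(T ^^ m) ((T ^^ n) x) = (T ^^ (n + m)) x" by (simp add: add.commute[of n m] funpow_add)
  with Suc show ?case by (simp add: matrix_mul_assoc)
qed simp

locale matrix_cocycle = ergodic_map M T for M :: "'a measure" and T +
  fixes B :: "'a \<Rightarrow> real ^ 'n ^ 'n"
  assumes B_measurable: "B \<in> borel_measurable M"
    and B_integrable: "integrable M (\<lambda>x. ln (max 1 (norm (B x))))"
begin

abbreviation "iterate \<equiv> matrix_iterate T B"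

lemma iterate_measurable: "iterate n \<in> borel_measurable M"
proof (induction n)
  case (Suc n)
  have "(\<lambda>x. B ((T ^^ n) x)) \<in> borel_measurable M"
    by (rule measurable_compose[OF T_pow_measurable B_measurable])
  with Suc show ?case by (simp add: measurable_matrix_mult)
qed simp

definition volume_growth :: "real \<Rightarrow> nat \<Rightarrow> 'a \<Rightarrow> real" where
  "volume_growth t n x = ln (gram_det (exp (- (real n * t)) *\<^sub>R iterate n x))"

lemma volume_growth_measurable: "volume_growth t n \<in> borel_measurable M"
proof -
  have [measurable]: "(\<lambda>x. exp (- (real n * t)) *\<^sub>R iterate n x) \<in> borel_measurable M"
    using iterate_measurable[of n] by measurable
  have "(\<lambda>x. gram_det (exp (- (real n * t)) *\<^sub>R iterate n x)) \<in> borel_measurable M"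
    unfolding gram_det_def
    by (intro measurable_det borel_measurable_add measurable_matrix_mult measurable_transpose) auto
  then show ?thesis unfolding volume_growth_def by measurable
qed

lemma volume_growth_nonneg: "0 \<le> volume_growth t n x"
  unfolding volume_growth_def using gram_det_ge_1 by (rule ln_ge_zero)

lemma volume_growth_add: "volume_growth t (n + m) x \<le> volume_growth t n x + volume_growth t m ((T ^^ n) x)"
proof -
  let ?C = "exp (- (real m * t)) *\<^sub>R iterate m ((T ^^ n) x)" and ?D = "exp (- (real n * t)) *\<^sub>R iterate n x"
  have pos: "gram_det C > 0" for C :: "real ^ 'n ^ 'n" using gram_det_ge_1[of C] by linarith
  have "exp (- (real (n + m) * t)) = exp (- (real n * t)) * exp (- (real m * t))"
    by (simp add: exp_add[symmetric] algebra_simps)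
  then have "exp (- (real (n + m) * t)) *\<^sub>R iterate (n + m) x = ?C ** ?D"
    by (simp add: matrix_iterate_add[of T B n m x] matrix_scalar_ac scalar_matrix_assoc[symmetric])
  then have "volume_growth t (n + m) x = ln (gram_det (?C ** ?D))" by (simp only: volume_growth_def)
  also have "\<dots> \<le> ln (gram_det ?C * gram_det ?D)"
    using gram_det_mult[of ?C ?D] pos by (subst ln_le_cancel_iff) auto
  also have "\<dots> = volume_growth t n x + volume_growth t m ((T ^^ n) x)"
    unfolding volume_growth_def by (simp add: ln_mult pos less_imp_neq[OF pos, symmetric])
  finally show ?thesis .
qed

text \<open>
  At time \<open>1\<close> the process is bounded by an affine function of \<open>log\<^sup>+\<close> of the norm.
\<close>

lemma volume_growth_integrable: "integrable M (volume_growth t 1)"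
proof (rule Bochner_Integration.integrable_bound[where f="\<lambda>x. real CARD('n) * (ln 2 + 2 * \<bar>t\<bar> + 2 * ln (max 1 (norm (B x))))"])
  show "integrable M (\<lambda>x. real CARD('n) * (ln 2 + 2 * \<bar>t\<bar> + 2 * ln (max 1 (norm (B x)))))"
    using B_integrable by (intro integrable_mult_right Bochner_Integration.integrable_add) auto
  show "volume_growth t 1 \<in> borel_measurable M" by (rule volume_growth_measurable)
  show "AE x in M. norm (volume_growth t 1 x) \<le> norm (real CARD('n) * (ln 2 + 2 * \<bar>t\<bar> + 2 * ln (max 1 (norm (B x)))))"
  proof (rule AE_I2)
    fix x
    let ?b = "norm (B x)" and ?m = "max 1 (norm (B x))"
    have "volume_growth t 1 x = ln (gram_det (exp (- t) *\<^sub>R B x))" by (simp add: volume_growth_def)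
    also have "\<dots> \<le> ln ((1 + (norm (exp (- t) *\<^sub>R B x))\<^sup>2) ^ CARD('n))"
      using gram_det_le[of "exp (- t) *\<^sub>R B x"] gram_det_ge_1[of "exp (- t) *\<^sub>R B x"]
      by (subst ln_le_cancel_iff) (auto intro!: zero_less_power add_pos_nonneg)
    also have "\<dots> = real CARD('n) * ln (1 + (norm (exp (- t) *\<^sub>R B x))\<^sup>2)"
      by (rule ln_realpow)
    also have "ln (1 + (norm (exp (- t) *\<^sub>R B x))\<^sup>2) \<le> ln (2 * (exp \<bar>t\<bar> * ?m)\<^sup>2)"
    proof -
      have "norm (exp (- t) *\<^sub>R B x) \<le> exp \<bar>t\<bar> * ?m" by (auto intro!: mult_mono)
      then have "(norm (exp (- t) *\<^sub>R B x))\<^sup>2 \<le> (exp \<bar>t\<bar> * ?m)\<^sup>2" by (intro power_mono) auto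
      moreover have "1 \<le> exp \<bar>t\<bar> * ?m" using mult_mono[of 1 "exp \<bar>t\<bar>" 1 ?m] by simp
      then have "1 \<le> (exp \<bar>t\<bar> * ?m)\<^sup>2" by (rule one_le_power)
      ultimately have "1 + (norm (exp (- t) *\<^sub>R B x))\<^sup>2 \<le> 2 * (exp \<bar>t\<bar> * ?m)\<^sup>2" by linarith
      moreover have "0 < 1 + (norm (exp (- t) *\<^sub>R B x))\<^sup>2" by (intro add_pos_nonneg) auto
      ultimately show ?thesis by (subst ln_le_cancel_iff) auto
    qed
    also have "ln (2 * (exp \<bar>t\<bar> * ?m)\<^sup>2) = ln 2 + 2 * \<bar>t\<bar> + 2 * ln ?m"
      by (simp add: ln_mult ln_realpow)
    finally have "volume_growth t 1 x \<le> real CARD('n) * (ln 2 + 2 * \<bar>t\<bar> + 2 * ln ?m)" by simp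
    then show "norm (volume_growth t 1 x) \<le> norm (real CARD('n) * (ln 2 + 2 * \<bar>t\<bar> + 2 * ln ?m))"
      using volume_growth_nonneg[of t 1 x] by simp
  qed
qed

lemma volume_growth_rate: "\<exists>G. AE x in M. \<forall>t\<in>\<rat>. (\<lambda>n. volume_growth t n x / real n) \<longlonglongrightarrow> G t"
proof -
  have "\<exists>c. AE x in M. (\<lambda>n. volume_growth t n x / real n) \<longlonglongrightarrow> c" for t
    by (rule kingman) (use volume_growth_measurable volume_growth_add volume_growth_nonneg volume_growth_integrable in auto)
  then have "\<exists>G. \<forall>t. AE x in M. (\<lambda>n. volume_growth t n x / real n) \<longlonglongrightarrow> G t" by (intro choice) blast
  then obtain G where "\<forall>t. AE x in M. (\<lambda>n. volume_growth t n x / real n) \<longlonglongrightarrow> G t" ..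
  then have "AE x in M. \<forall>t\<in>\<rat>. (\<lambda>n. volume_growth t n x / real n) \<longlonglongrightarrow> G t"
    by (subst AE_ball_countable[OF countable_rat]) blast
  then show ?thesis by blast
qed

lemma B_subexponential: "AE x in M. \<forall>e>0. \<forall>\<^sub>F n in sequentially. norm (B ((T ^^ n) x)) \<le> exp (real n * e)"
proof -
  have "AE x in M. (\<lambda>n. ln (max 1 (norm (B ((T ^^ n) x)))) / real n) \<longlonglongrightarrow> 0"
    by (rule iterate_over_n_tendsto_0[OF B_integrable]) auto
  then show ?thesis
  proof eventually_elim
    case (elim x)
    show ?case
    proof (intro allI impI)
      fix e :: real assume "e > 0"
      then have "\<forall>\<^sub>F n in sequentially. ln (max 1 (norm (B ((T ^^ n) x)))) / real n < e"
        by (rule order_tendstoD(2)[OF elim])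
      then show "\<forall>\<^sub>F n in sequentially. norm (B ((T ^^ n) x)) \<le> exp (real n * e)"
        using eventually_gt_at_top[of 0]
      proof eventually_elim
        case (elim n)
        let ?m = "max 1 (norm (B ((T ^^ n) x)))"
        have "ln ?m < real n * e" using elim by (simp add: pos_divide_less_eq mult.commute)
        then have "exp (ln ?m) < exp (real n * e)" by (simp only: exp_less_cancel_iff)
        then show ?case by simp
      qed
    qed
  qed
qed

text \<open>
  A choice of frames at every point. They serve in pointwise estimates; the measurability of the limit
  comes from the resolvents.
\<close>

definition singular_data :: "nat \<Rightarrow> 'a \<Rightarrow> ('n \<Rightarrow> real ^ 'n) \<times> ('n \<Rightarrow> real)" where
  "singular_data n x = (SOME (u, s). orthonormal_frame u \<and> transpose (iterate n x) ** iterate n x = frame_diag u s \<and> (\<forall>i. 0 \<le> s i))"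

definition "sframe n x = fst (singular_data n x)"
definition "sval n x = snd (singular_data n x)"

lemma singular_data:
  "orthonormal_frame (sframe n x)" "transpose (iterate n x) ** iterate n x = frame_diag (sframe n x) (sval n x)"
  "0 \<le> sval n x i"
proof -
  have "\<exists>us. case us of (u, s) \<Rightarrow> orthonormal_frame u \<and> transpose (iterate n x) ** iterate n x = frame_diag u s \<and> (\<forall>i. 0 \<le> s i)"
    using singular_frame[of "iterate n x"] by auto
  from someI_ex[OF this]
  have "case singular_data n x of (u, s) \<Rightarrow> orthonormal_frame u \<and> transpose (iterate n x) ** iterate n x = frame_diag u s \<and> (\<forall>i. 0 \<le> s i)"
    unfolding singular_data_def .
  then show "orthonormal_frame (sframe n x)" "transpose (iterate n x) ** iterate n x = frame_diag (sframe n x) (sval n x)"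
    "0 \<le> sval n x i" by (auto simp: sframe_def sval_def split: prod.splits)
qed

lemma growth_profile_sval:
  assumes "\<forall>t\<in>\<rat>. (\<lambda>n. volume_growth t n x / real n) \<longlonglongrightarrow> G t"
  shows "growth_profile (\<lambda>n. sval n x) G"
  using assms unfolding growth_profile_def volume_growth_def gram_det_scaled[OF singular_data(1,2)]
  by (auto simp: singular_data(3))

text \<open>
  The first alternative is the exponent \<open>-\<infinity>\<close>. In the second one \<open>Q x\<close> projects onto the subspace of
  vectors growing more slowly than the top exponent \<open>l\<close>. Its rank is almost surely a constant \<open>q\<close>, since the multiplicity of \<open>l\<close>
  is read off from the constant profile \<open>G\<close>.
\<close>

theorem top_exponent:
  "(AE x in M. \<forall>v K. \<forall>\<^sub>F n in sequentially. norm (iterate n x *v v) \<le> exp (- (real n * K))) \<or>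
   (\<exists>l l' Q q. l' < l \<and> Q \<in> borel_measurable M \<and> (\<forall>x. orth_proj (Q x)) \<and> q < CARD('n) \<and>
      (AE x in M. trace (Q x) = real q
        \<and> splits_growth (\<lambda>n. iterate n x) l l' (Q x)))"
  (is "?decay \<or> ?gap")
proof -
  obtain G where G: "AE x in M. \<forall>t\<in>\<rat>. (\<lambda>n. volume_growth t n x / real n) \<longlonglongrightarrow> G t"
    using volume_growth_rate by blast
  show ?thesis
  proof (cases "\<forall>t\<in>\<rat>. G t = 0")
    case True
    have "AE x in M. \<forall>v K. \<forall>\<^sub>F n in sequentially. norm (iterate n x *v v) \<le> exp (- (real n * K))"
      using G
    proof eventually_elim
      case (elim x)
      show ?case
      proof (intro allI)
        fix v :: "real ^ 'n" and K :: real
        have "\<forall>\<^sub>F n in sequentially. \<forall>i. sval n x i \<le> exp (2 * real n * (- (K + 1)))"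
          by (rule zero_profile_decay[OF growth_profile_sval[OF elim]]) (use True in blast)
        then show "\<forall>\<^sub>F n in sequentially. norm (iterate n x *v v) \<le> exp (- (real n * K))"
          using eventually_le_exp[OF zero_less_one, of "norm v"]
        proof eventually_elim
          case (elim n)
          have "(norm (iterate n x *v v))\<^sup>2 = (\<Sum>i\<in>UNIV. sval n x i * (sframe n x i \<bullet> v)\<^sup>2)"
            unfolding norm_matrix_vector_sq singular_data(2) by (rule frame_diag_quad[OF singular_data(1)])
          also have "\<dots> \<le> (\<Sum>i\<in>UNIV. exp (2 * real n * (- (K + 1))) * (sframe n x i \<bullet> v)\<^sup>2)"
            by (rule sum_mono) (use elim in \<open>auto intro!: mult_right_mono\<close>)
          also have "\<dots> = exp (2 * real n * (- (K + 1))) * (norm v)\<^sup>2"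
            unfolding frame_norm_sq[OF singular_data(1), of v n x] by (simp only: sum_distrib_left)
          also have "exp (2 * real n * (- (K + 1))) = (exp (- (real n * (K + 1))))\<^sup>2"
            by (simp add: power2_eq_square exp_add[symmetric] algebra_simps)
          finally have "(norm (iterate n x *v v))\<^sup>2 \<le> (exp (- (real n * (K + 1))) * norm v)\<^sup>2"
            by (simp only: power_mult_distrib)
          then have "norm (iterate n x *v v) \<le> exp (- (real n * (K + 1))) * norm v"
            by (rule power2_le_imp_le) simp
          also have "\<dots> \<le> exp (- (real n * (K + 1))) * exp (real n * 1)" using elim by simp
          also have "\<dots> = exp (- (real n * K))" by (simp add: exp_add[symmetric] algebra_simps)
          finally show ?case .
        qed
      qed
    qed
    then show ?thesis ..
  next
    case False
    then obtain t0 where t0: "t0 \<in> \<rat>" "G t0 \<noteq> 0" by blast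
    obtain x0 where "\<forall>t\<in>\<rat>. (\<lambda>n. volume_growth t n x0 / real n) \<longlonglongrightarrow> G t" using AE_imp_ex_space[OF G] by blast
    from spectral_gap_exists[OF growth_profile_sval[OF this] t0]
    obtain l l' p where l: "l' < l" "p \<ge> 1" "\<And>s :: nat \<Rightarrow> 'n \<Rightarrow> real. growth_profile s G \<Longrightarrow> spectral_gap s l l' p"
      by blast
    define th where "th = (l + l') / 2"
    define R where "R n x = cramer_inverse (mat 1 + exp (- 2 * real n * th) *\<^sub>R (transpose (iterate n x) ** iterate n x))" for n x
    have R_eq: "R n x = frame_diag (sframe n x) (\<lambda>i. 1 / (1 + exp (- 2 * real n * th) * sval n x i))" for n x
    proof -
      let ?f = "\<lambda>i. 1 + exp (- 2 * real n * th) * sval n x i"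
      have "?f i > 0" for i by (rule add_pos_nonneg) (auto simp: singular_data(3))
      then have ne: "?f i \<noteq> 0" for i by (metis less_irrefl)
      have Y: "mat 1 + exp (- 2 * real n * th) *\<^sub>R (transpose (iterate n x) ** iterate n x) = frame_diag (sframe n x) ?f"
        unfolding singular_data(2) frame_diag_scale[OF singular_data(1)] frame_diag_one[OF singular_data(1), symmetric, of n x]
          frame_diag_add[OF singular_data(1)] ..
      have "frame_diag (sframe n x) ?f ** frame_diag (sframe n x) (\<lambda>i. 1 / ?f i) = mat 1"
        unfolding frame_diag_mult[OF singular_data(1)] using ne by (simp add: frame_diag_one[OF singular_data(1)])
      from cramer_inverse_eq[OF this] show ?thesis unfolding R_def Y by simp
    qed
    have R_meas: "R n \<in> borel_measurable M" for n
      unfolding R_def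
      by (intro measurable_cramer_inverse borel_measurable_add borel_measurable_scaleR measurable_matrix_mult
          measurable_transpose iterate_measurable) auto
    define Q0 where "Q0 x = lim (\<lambda>n. R n x)" for x
    have Q0_meas: "Q0 \<in> borel_measurable M" unfolding Q0_def by (rule borel_measurable_lim_metric[OF R_meas])
    define Q where "Q x = (if orth_proj (Q0 x) then Q0 x else 0)" for x
    have "Q \<in> borel_measurable M" unfolding Q_def by (rule measurable_orth_proj_or_0[OF Q0_meas])
    moreover have "orth_proj (Q x)" for x
      by (auto simp: Q_def orth_proj_def vec_eq_iff transpose_def matrix_matrix_mult_def)
    moreover have "AE x in M. trace (Q x) = real (CARD('n) - p) \<and> p \<le> CARD('n)
        \<and> splits_growth (\<lambda>n. iterate n x) l l' (Q x)"
      using G B_subexponential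
    proof eventually_elim
      case (elim x)
      have gap: "spectral_gap (\<lambda>n. sval n x) l l' p" by (rule l(3)[OF growth_profile_sval[OF elim(1)]])
      from eventually_happens'[OF sequentially_bot gap[unfolded spectral_gap_def, rule_format, OF zero_less_one]]
      obtain I where "card (I :: 'n set) = p" by blast
      then have p: "p \<le> CARD('n)" using card_mono[of UNIV I] by simp
      interpret gap_sequence "\<lambda>n. iterate n x" "\<lambda>n. B ((T ^^ n) x)" "\<lambda>n. sframe n x" "\<lambda>n. sval n x" l l' p
        by unfold_locales (use gap elim(2) l(1) singular_data in \<open>auto simp: spectral_gap_def\<close>)
      have "(\<lambda>n. R n x) \<longlonglongrightarrow> P" using resolvent_tendsto unfolding R_eq th_def \<theta>_def .
      then have "Q0 x = P" unfolding Q0_def by (rule limI)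
      then have "Q x = P" unfolding Q_def using orth_proj_P by simp
      then show ?case using trace_P splits_growth_P p by (simp add: of_nat_diff)
    qed
    moreover have "CARD('n) - p < CARD('n)" using l(2) by simp
    ultimately have ?gap using l(1)
      by (intro exI[of _ l] exI[of _ l'] exI[of _ Q] exI[of _ "CARD('n) - p"]) (auto elim: eventually_mono)
    then show ?thesis ..
  qed
qed

end

section \<open>Exponential growth and extended logarithms\<close>

lemma elog_le_of_le_exp:
  assumes "a \<ge> 0" "n \<ge> 1" "a \<le> exp (real n * x)"
  shows "elog a / ereal (real n) \<le> ereal x"
proof (cases "a = 0")
  case True
  then show ?thesis using assms by (simp add: elog_def divide_ereal_def)
next
  case False
  then have "ln a \<le> real n * x" using assms by (metis less_le ln_exp ln_le_cancel_iff exp_gt_zero)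
  then show ?thesis using False assms by (simp add: elog_def pos_divide_le_eq mult.commute)
qed

lemma elog_tendsto_real:
  assumes bounds: "\<And>e. e > 0 \<Longrightarrow> \<forall>\<^sub>F n in sequentially. exp (real n * (l - e)) \<le> a n \<and> a n \<le> exp (real n * (l + e))"
  shows "(\<lambda>n. elog (a n) / ereal (real n)) \<longlonglongrightarrow> ereal l"
proof -
  have "(\<lambda>n. ln (a n) / real n) \<longlonglongrightarrow> l"
  proof (rule tendstoI)
    fix e :: real assume "e > 0"
    then have "\<forall>\<^sub>F n in sequentially. exp (real n * (l - e / 2)) \<le> a n \<and> a n \<le> exp (real n * (l + e / 2))"
      by (intro bounds) simp
    then show "\<forall>\<^sub>F n in sequentially. dist (ln (a n) / real n) l < e"
      using eventually_gt_at_top[of 0]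
    proof eventually_elim
      case (elim n)
      have pos: "a n > 0" using elim exp_gt_zero[of "real n * (l - e / 2)"] by linarith
      have "real n * (l - e / 2) \<le> ln (a n)" "ln (a n) \<le> real n * (l + e / 2)"
        using elim pos by (auto simp: ln_ge_iff) (metis exp_gt_zero ln_exp ln_le_cancel_iff)
      then have "l - e / 2 \<le> ln (a n) / real n" "ln (a n) / real n \<le> l + e / 2"
        using elim by (auto simp: pos_le_divide_eq pos_divide_le_eq mult.commute)
      then show ?case using \<open>e > 0\<close> by (simp add: dist_real_def abs_if)
    qed
  qed
  then have "(\<lambda>n. ereal (ln (a n) / real n)) \<longlonglongrightarrow> ereal l" by simp
  moreover have "\<forall>\<^sub>F n in sequentially. ereal (ln (a n) / real n) = elog (a n) / ereal (real n)"
    using bounds[OF zero_less_one] eventually_gt_at_top[of 0]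
  proof eventually_elim
    case (elim n)
    have "a n > 0" using elim exp_gt_zero[of "real n * (l - 1)"] by linarith
    then show ?case using elim by (simp add: elog_def)
  qed
  ultimately show ?thesis by (rule Lim_transform_eventually)
qed

lemma elog_tendsto_MInf:
  assumes "\<And>n. a n \<ge> 0" "\<And>K. \<forall>\<^sub>F n in sequentially. a n \<le> exp (- (real n * K))"
  shows "(\<lambda>n. elog (a n) / ereal (real n)) \<longlonglongrightarrow> - \<infinity>"
  unfolding tendsto_MInfty
proof
  fix r :: real
  show "\<forall>\<^sub>F n in sequentially. elog (a n) / ereal (real n) < ereal r"
    using assms(2)[of "1 - r"] eventually_ge_at_top[of 1]
  proof eventually_elim
    case (elim n)
    have "elog (a n) / ereal (real n) \<le> ereal (r - 1)"
      by (rule elog_le_of_le_exp) (use assms(1) elim in \<open>auto simp: algebra_simps\<close>)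
    also have "\<dots> < ereal r" by simp
    finally show ?case .
  qed
qed

lemma elog_limit_le:
  assumes lim: "(\<lambda>n. elog (a n) / ereal (real n)) \<longlonglongrightarrow> c"
    and nonneg: "\<And>n. a n \<ge> 0" and le: "\<And>e. e > 0 \<Longrightarrow> \<forall>\<^sub>F n in sequentially. a n \<le> exp (real n * (l + e))"
  shows "c \<le> ereal l"
proof (rule ereal_le_epsilon2)
  fix e :: real assume e: "e > 0"
  have "\<forall>\<^sub>F n in sequentially. elog (a n) / ereal (real n) \<le> ereal (l + e)"
    using le[OF e] eventually_ge_at_top[of 1] by eventually_elim (rule elog_le_of_le_exp, auto simp: nonneg)
  then have "c \<le> ereal (l + e)" by (rule tendsto_upperbound[OF lim]) simp
  then show "c \<le> ereal l + ereal e" by simp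
qed

section \<open>Subspaces as orthogonal projections\<close>

definition fibre :: "real ^ 'n ^ 'n \<Rightarrow> (real ^ 'n) set" where
  "fibre P = {v. P *v v = v}"

lemma subspace_fibre: "subspace (fibre P)"
  by (auto simp: fibre_def subspace_def matrix_vector_right_distrib matrix_vector_mult_scaleR)

lemma fibre_0: "fibre 0 = {0}"
  by (auto simp: fibre_def)

lemma orth_proj_0: "orth_proj 0"
  by (simp add: orth_proj_def vec_eq_iff transpose_def matrix_matrix_mult_def)

lemma orth_proj_in_fibre: "orth_proj P \<Longrightarrow> P *v v \<in> fibre P"
  by (simp add: orth_proj_def fibre_def matrix_vector_mul_assoc)

lemma orth_proj_norm_le:
  assumes "orth_proj P"
  shows "norm (P *v v) \<le> norm v"
proof -
  have "norm (P *v v) * norm (P *v v) = v \<bullet> (P *v v)"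
    using norm_matrix_vector_sq[of P v] assms by (simp add: orth_proj_def power2_eq_square)
  also have "\<dots> \<le> norm v * norm (P *v v)" by (rule norm_cauchy_schwarz)
  finally show ?thesis by (cases "P *v v = 0") (auto simp: mult_le_cancel_right)
qed

text \<open>
  The nearest point in a subspace is characterised by orthogonality of the residual, and this
  makes the nearest-point map linear.
\<close>

lemma closest_point_subspace_iff:
  fixes S :: "(real ^ 'n) set"
  assumes S: "subspace S"
  shows "closest_point S x = y \<longleftrightarrow> y \<in> S \<and> (\<forall>w\<in>S. (x - y) \<bullet> w = 0)"
proof -
  have *: "y = closest_point S x" if y: "y \<in> S" "\<And>w. w \<in> S \<Longrightarrow> (x - y) \<bullet> w = 0" for y
  proof (rule closest_point_unique[OF subspace_imp_convex[OF S] closed_subspace[OF S] y(1)], intro ballI)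
    fix z assume z: "z \<in> S"
    have "(x - y) \<bullet> (y - z) = 0" by (rule y(2)) (use S y z subspace_diff in auto)
    then have "(norm (x - z))\<^sup>2 = (norm (x - y))\<^sup>2 + (norm (y - z))\<^sup>2"
      using norm_add_Pythagorean[of "x - y" "y - z"] by (simp add: orthogonal_def)
    then have "(norm (x - y))\<^sup>2 \<le> (norm (x - z))\<^sup>2" by simp
    then show "dist x y \<le> dist x z" by (simp add: dist_norm)
  qed
  obtain y0 z0 where d: "y0 \<in> span S" "\<And>w. w \<in> span S \<Longrightarrow> orthogonal z0 w" "x = y0 + z0"
    using orthogonal_subspace_decomp_exists[of S x] by metis
  have d': "y0 \<in> S" "\<And>w. w \<in> S \<Longrightarrow> (x - y0) \<bullet> w = 0"
    using d S by (auto simp: orthogonal_def span_eq_iff[THEN iffD2])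
  have "closest_point S x = y0" using *[OF d'] by simp
  then show ?thesis using d' *[of y] by blast
qed

definition proj_matrix :: "(real ^ 'n) set \<Rightarrow> real ^ 'n ^ 'n" where
  "proj_matrix S = matrix (closest_point S)"

lemma proj_matrix_apply:
  assumes S: "subspace S"
  shows "proj_matrix S *v x = closest_point S x"
proof -
  have cp: "closest_point S x \<in> S" "\<And>w. w \<in> S \<Longrightarrow> (x - closest_point S x) \<bullet> w = 0" for x
    using closest_point_subspace_iff[OF S, of x "closest_point S x"] by auto
  have "linear (closest_point S)"
  proof (rule linearI)
    show "closest_point S (x + y) = closest_point S x + closest_point S y" for x y
      unfolding closest_point_subspace_iff[OF S]
      using cp(1)[of x] cp(1)[of y] cp(2)[of _ x] cp(2)[of _ y] S by (auto simp: subspace_add inner_diff_left inner_add_left)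
    show "closest_point S (c *\<^sub>R x) = c *\<^sub>R closest_point S x" for c x
      unfolding closest_point_subspace_iff[OF S]
      using cp(1)[of x] cp(2)[of _ x] S by (auto simp: subspace_scale inner_diff_left)
  qed
  then show ?thesis by (simp add: proj_matrix_def matrix_works)
qed

lemma proj_matrix:
  assumes S: "subspace S"
  shows "orth_proj (proj_matrix S)" "fibre (proj_matrix S) = S"
proof -
  have cp: "closest_point S x \<in> S" "\<And>w. w \<in> S \<Longrightarrow> (x - closest_point S x) \<bullet> w = 0" for x
    using closest_point_subspace_iff[OF S, of x "closest_point S x"] by auto
  have fixed: "closest_point S x = x \<longleftrightarrow> x \<in> S" for x by (simp add: closest_point_subspace_iff[OF S])
  have "(proj_matrix S *v x) \<bullet> y = x \<bullet> (proj_matrix S *v y)" for x y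
    unfolding proj_matrix_apply[OF S]
  proof -
    have "x \<bullet> closest_point S y = closest_point S x \<bullet> closest_point S y"
      "y \<bullet> closest_point S x = closest_point S y \<bullet> closest_point S x"
      using cp(2)[OF cp(1), of y x] cp(2)[OF cp(1), of x y] by (simp_all add: inner_diff_left)
    then show "closest_point S x \<bullet> y = x \<bullet> closest_point S y"
      using inner_commute[of y "closest_point S x"] inner_commute[of "closest_point S x" "closest_point S y"] by simp
  qed
  then have "\<forall>x. x \<bullet> (transpose (proj_matrix S) *v y) = x \<bullet> (proj_matrix S *v y)" for y
    by (simp only: dot_matrix_vector_transpose[symmetric]) blast
  then have "transpose (proj_matrix S) *v y = proj_matrix S *v y" for y
    by (rule iffD1[OF vector_eq_ldot])
  then have "transpose (proj_matrix S) = proj_matrix S" by (intro iffD2[OF matrix_eq] allI)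
  moreover have "proj_matrix S ** proj_matrix S = proj_matrix S"
    using cp(1) by (simp add: matrix_eq matrix_vector_mul_assoc[symmetric] proj_matrix_apply[OF S] fixed)
  ultimately show "orth_proj (proj_matrix S)" by (simp add: orth_proj_def)
  show "fibre (proj_matrix S) = S" by (auto simp: fibre_def proj_matrix_apply[OF S] fixed)
qed

lemma proj_matrix_fibre:
  assumes P: "orth_proj P"
  shows "proj_matrix (fibre P) = P"
proof -
  have "closest_point (fibre P) x = P *v x" for x
    unfolding closest_point_subspace_iff[OF subspace_fibre]
  proof (intro conjI ballI)
    show "P *v x \<in> fibre P" by (rule orth_proj_in_fibre[OF P])
    fix w assume "w \<in> fibre P"
    then have "(P *v x) \<bullet> w = x \<bullet> w" using P dot_matrix_vector_transpose[of P x w] by (simp add: orth_proj_def fibre_def)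
    then show "(x - P *v x) \<bullet> w = 0" by (simp add: inner_diff_left)
  qed
  then have "closest_point (fibre P) = (\<lambda>x. P *v x)" by auto
  then show ?thesis by (simp add: proj_matrix_def)
qed

lemma trace_orth_proj_nonneg: "orth_proj P \<Longrightarrow> trace P = (norm P)\<^sup>2"
  by (simp add: norm_sq_trace orth_proj_def)

text \<open>
  The eigenvalues of an orthogonal projection are \<open>0\<close> and \<open>1\<close>, and the range is spanned by the
  eigenvectors for \<open>1\<close>.
\<close>

lemma trace_orth_proj_dim:
  fixes P :: "real ^ 'n ^ 'n"
  assumes P: "orth_proj P"
  shows "trace P = real (dim (fibre P))"
proof -
  obtain u s where u: "orthonormal_frame u" "P = frame_diag u s"
    using spectral_frame_diag[of P] P by (auto simp: orth_proj_def)
  let ?I = "{i. s i = 1}"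
  have Pu: "P *v u i = s i *\<^sub>R u i" for i
  proof (rule frame_eqI[OF u(1)])
    show "u j \<bullet> (P *v u i) = u j \<bullet> s i *\<^sub>R u i" for j
      unfolding u(2) frame_inner_diag[OF u(1)] by (auto simp: frame_inner[OF u(1)])
  qed
  have nz: "u i \<noteq> 0" for i using frame_norm[OF u(1), of i] by auto
  have "(s i * s i) *\<^sub>R u i = s i *\<^sub>R u i" for i
  proof -
    have "(P ** P) *v u i = (s i * s i) *\<^sub>R u i"
      by (simp add: matrix_vector_mul_assoc[symmetric] Pu matrix_vector_mult_scaleR)
    then show ?thesis using P Pu by (simp add: orth_proj_def)
  qed
  then have s01: "s i = 0 \<or> s i = 1" for i using nz[of i] by auto
  have "fibre P = span (u ` ?I)"
  proof
    show "span (u ` ?I) \<subseteq> fibre P"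
      by (rule span_minimal[OF _ subspace_fibre]) (auto simp: fibre_def Pu)
    show "fibre P \<subseteq> span (u ` ?I)"
    proof
      fix v assume "v \<in> fibre P"
      then have "v = (\<Sum>i\<in>UNIV. (s i * (u i \<bullet> v)) *\<^sub>R u i)"
        using frame_diag_apply[OF u(1), of s v] u(2) by (simp add: fibre_def)
      also have "\<dots> \<in> span (u ` ?I)"
      proof (intro span_sum)
        fix i show "(s i * (u i \<bullet> v)) *\<^sub>R u i \<in> span (u ` ?I)"
          using s01[of i] by (auto intro: span_scale span_base span_zero)
      qed
      finally show "v \<in> span (u ` ?I)" .
    qed
  qed
  moreover have "independent (u ` ?I)"
    by (rule pairwise_orthogonal_independent)
      (use frame_inner[OF u(1)] nz in \<open>auto simp: pairwise_def orthogonal_def\<close>)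
  moreover have "inj_on u ?I"
    by (rule inj_onI) (metis frame_inner[OF u(1)] zero_neq_one)
  ultimately have "dim (fibre P) = card ?I"
    by (simp add: dim_eq_card_independent card_image)
  moreover have "trace P = (\<Sum>i\<in>UNIV. if s i = 1 then 1 else 0)"
    unfolding u(2) trace_frame_diag[OF u(1)] by (rule sum.cong) (use s01 in auto)
  ultimately show ?thesis by (simp add: sum.If_cases)
qed

lemma norm_mult_orth_proj_le:
  fixes B :: "real ^ 'n ^ 'n"
  assumes P: "orth_proj P"
  shows "norm (B ** P) \<le> norm B"
proof -
  have "norm ((B ** P) $ i) \<le> norm (B $ i)" for i
  proof -
    have "(B ** P) $ i = transpose P *v (B $ i)"
      by (simp add: vec_eq_iff matrix_matrix_mult_def matrix_vector_mult_def transpose_def mult.commute)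
    also have "\<dots> = P *v (B $ i)" using P by (simp only: orth_proj_def)
    finally show ?thesis using orth_proj_norm_le[OF P, of "B $ i"] by (simp only:)
  qed
  then show ?thesis unfolding norm_vec_def[of "B ** P"] norm_vec_def[of B] by (intro L2_set_mono) auto
qed

section \<open>The filtration of an invariant sub-bundle\<close>

context ergodic_map
begin

definition grows :: "('a \<Rightarrow> real ^ 'n ^ 'n) \<Rightarrow> 'a \<Rightarrow> real ^ 'n \<Rightarrow> ereal \<Rightarrow> bool" where
  "grows B x v c \<longleftrightarrow> (\<lambda>n. elog (norm (matrix_iterate T B n x *v v)) / ereal (real n)) \<longlonglongrightarrow> c"

text \<open>
  Levels are counted from \<open>0\<close>: the rate on \<open>fibre (Q j x)\<close> minus \<open>fibre (Q (Suc j) x)\<close> is \<open>c j\<close>.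
\<close>

definition filtration :: "('a \<Rightarrow> real ^ 'n ^ 'n) \<Rightarrow> nat \<Rightarrow> (nat \<Rightarrow> ereal) \<Rightarrow> (nat \<Rightarrow> 'a \<Rightarrow> real ^ 'n ^ 'n) \<Rightarrow> 'a \<Rightarrow> bool" where
  "filtration B k c Q x \<longleftrightarrow> (\<forall>j<k. fibre (Q (Suc j) x) \<subset> fibre (Q j x)
     \<and> (\<forall>v\<in>fibre (Q j x). B x *v v \<in> fibre (Q j (T x)))
     \<and> (\<forall>v\<in>fibre (Q j x) - fibre (Q (Suc j) x). grows B x v (c j)))"

text \<open>
  The bundle of the ranges of \<open>P\<close> has constant dimension \<open>d\<close>, and \<open>B\<close> is a cocycle on it, extended by \<open>0\<close> on the
  orthogonal complements.
\<close>

definition sub_cocycle :: "('a \<Rightarrow> real ^ 'n ^ 'n) \<Rightarrow> ('a \<Rightarrow> real ^ 'n ^ 'n) \<Rightarrow> nat \<Rightarrow> bool" where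
  "sub_cocycle B P d \<longleftrightarrow> B \<in> borel_measurable M \<and> integrable M (\<lambda>x. ln (max 1 (norm (B x))))
     \<and> P \<in> borel_measurable M \<and> (\<forall>x. orth_proj (P x))
     \<and> (AE x in M. trace (P x) = real d \<and> B x ** P x = B x \<and> P (T x) ** B x = B x)"

lemma restrict_sub_cocycle:
  assumes B: "B \<in> borel_measurable M" "integrable M (\<lambda>x. ln (max 1 (norm (B x))))"
    and P: "P \<in> borel_measurable M" "\<And>x. orth_proj (P x)" "AE x in M. trace (P x) = real d"
    and inv: "AE x in M. \<forall>v\<in>fibre (P x). B x *v v \<in> fibre (P (T x))"
  shows "sub_cocycle (\<lambda>x. B x ** P x) P d"
    and "AE x in M. \<forall>n. \<forall>v\<in>fibre (P x). matrix_iterate T (\<lambda>x. B x ** P x) n x *v v = matrix_iterate T B n x *v v"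
proof -
  have BP[measurable]: "(\<lambda>x. B x ** P x) \<in> borel_measurable M" by (rule measurable_matrix_mult[OF B(1) P(1)])
  have "integrable M (\<lambda>x. ln (max 1 (norm (B x ** P x))))"
  proof (rule Bochner_Integration.integrable_bound[OF B(2)])
    show "AE x in M. norm (ln (max 1 (norm (B x ** P x)))) \<le> norm (ln (max 1 (norm (B x))))"
    proof (rule AE_I2)
      fix x
      have "ln (max 1 (norm (B x ** P x))) \<le> ln (max 1 (norm (B x)))"
        using norm_mult_orth_proj_le[OF P(2), of "B x" x] by (subst ln_le_cancel_iff) auto
      moreover have "0 \<le> ln (max 1 (norm (B x ** P x)))" by simp
      ultimately show "norm (ln (max 1 (norm (B x ** P x)))) \<le> norm (ln (max 1 (norm (B x))))"
        by simp
    qed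
  qed measurable
  moreover have "AE x in M. trace (P x) = real d \<and> (B x ** P x) ** P x = B x ** P x \<and> P (T x) ** (B x ** P x) = B x ** P x"
    using P(3) inv
  proof eventually_elim
    case (elim x)
    have "(B x ** P x) ** P x = B x ** P x" using P(2)[of x] by (simp add: orth_proj_def matrix_mul_assoc[symmetric])
    moreover have "P (T x) ** (B x ** P x) = B x ** P x"
      using elim(2) orth_proj_in_fibre[OF P(2), of x]
      by (simp add: matrix_eq matrix_vector_mul_assoc[symmetric] fibre_def)
    ultimately show ?case using elim by blast
  qed
  ultimately show "sub_cocycle (\<lambda>x. B x ** P x) P d"
    unfolding sub_cocycle_def using BP P by blast
  show "AE x in M. \<forall>n. \<forall>v\<in>fibre (P x). matrix_iterate T (\<lambda>x. B x ** P x) n x *v v = matrix_iterate T B n x *v v"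
    using AE_all_iterates[OF inv]
  proof eventually_elim
    case (elim x)
    have "matrix_iterate T B n x *v v \<in> fibre (P ((T ^^ n) x)) \<and>
       matrix_iterate T (\<lambda>x. B x ** P x) n x *v v = matrix_iterate T B n x *v v" if "v \<in> fibre (P x)" for n v
    proof (induction n)
      case (Suc n)
      let ?w = "matrix_iterate T B n x *v v"
      have "B ((T ^^ n) x) *v ?w \<in> fibre (P (T ((T ^^ n) x)))" using elim Suc by blast
      moreover have "P ((T ^^ n) x) *v ?w = ?w" using Suc by (simp add: fibre_def)
      ultimately show ?case using Suc by (simp add: matrix_vector_mul_assoc[symmetric])
    qed (use that in simp)
    then show ?case by blast
  qed
qed

text \<open>
  The complement of the fibre of \<open>P\<close> is killed by \<open>B\<close>, so it consists of slow vectors; therefore \<open>1 - P\<close> is dominated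
  by \<open>Q\<close>, the two projections commute and \<open>P ** Q\<close> projects onto the slow part of the bundle. Its rank is \<open>d + q - m\<close>,
  which is less than \<open>d\<close>. It is invariant because \<open>B x *v v\<close>, started at \<open>T x\<close>, has the growth rate of \<open>v\<close>.
\<close>

lemma slow_subbundle:
  fixes B P Q :: "'a \<Rightarrow> real ^ 'n ^ 'n"
  assumes BP: "sub_cocycle B P d"
    and Q: "Q \<in> borel_measurable M" "\<And>x. orth_proj (Q x)" and lt: "l' < l"
    and ae: "AE x in M. trace (Q x) = real q
        \<and> splits_growth (\<lambda>n. matrix_iterate T B n x) l l' (Q x)"
    and q: "q < CARD('n)"
  shows "\<exists>P' d'. d' < d \<and> P' \<in> borel_measurable M \<and> (\<forall>x. orth_proj (P' x)) \<and>
    (AE x in M. trace (P' x) = real d' \<and> fibre (P' x) = fibre (P x) \<inter> fibre (Q x)) \<and>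
    (AE x in M. \<forall>v\<in>fibre (P' x). B x *v v \<in> fibre (P' (T x)))"
proof -
  have P: "P \<in> borel_measurable M" "\<And>x. orth_proj (P x)"
    "AE x in M. trace (P x) = real d \<and> B x ** P x = B x \<and> P (T x) ** B x = B x"
    using BP by (auto simp: sub_cocycle_def)
  define P' where "P' x = (if orth_proj (P x ** Q x) then P x ** Q x else 0)" for x
  have PQ: "(\<lambda>x. P x ** Q x) \<in> borel_measurable M" by (rule measurable_matrix_mult[OF P(1) Q(1)])
  have P'1: "P' \<in> borel_measurable M" unfolding P'_def by (rule measurable_orth_proj_or_0[OF PQ])
  have P'2: "orth_proj (P' x)" for x by (simp add: P'_def orth_proj_0)
  have key: "AE x in M. trace (P' x) = real q + real d - real CARD('n) \<and> fibre (P' x) = fibre (P x) \<inter> fibre (Q x)"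
    using ae P(3)
  proof eventually_elim
    case (elim x)
    have p: "transpose (P x) = P x" "P x ** P x = P x" "transpose (Q x) = Q x" "Q x ** Q x = Q x"
      using P(2)[of x] Q(2)[of x] by (auto simp: orth_proj_def)
    \<comment> \<open>Vectors orthogonal to the fibre are mapped to \<open>0\<close> in one step, so they cannot grow like \<open>exp (n l)\<close>.\<close>
    have ker: "Q x *v v = v" if v: "P x *v v = 0" for v
    proof (rule ccontr)
      assume "Q x *v v \<noteq> v"
      from splits_growth_fast[OF conjunct2[OF elim(1)] this zero_less_one]
      have "\<forall>\<^sub>F n in sequentially. exp (real n * (l - 1)) \<le> norm (matrix_iterate T B n x *v v)"
        by (rule eventually_mono) blast
      moreover have "matrix_iterate T B n x *v v = 0" if "n \<ge> 1" for n
        using that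
      proof (induction n rule: dec_induct)
        case base
        have "B x *v v = (B x ** P x) *v v" using elim(2) by simp
        then show ?case using v by (simp add: matrix_vector_mul_assoc[symmetric])
      qed (simp add: matrix_vector_mul_assoc[symmetric])
      then have "\<forall>\<^sub>F n in sequentially. norm (matrix_iterate T B n x *v v) = 0"
        by (auto simp: eventually_sequentially)
      ultimately have "\<forall>\<^sub>F n in sequentially. False"
      proof eventually_elim
        case (elim n)
        then show ?case using exp_gt_zero[of "real n * (l - 1)"] by linarith
      qed
      then show False by simp
    qed
    have "Q x ** (mat 1 - P x) = mat 1 - P x"
    proof (subst matrix_eq, intro allI)
      fix v
      have "P x *v ((mat 1 - P x) *v v) = 0"
        by (simp add: matrix_vector_mul_assoc matrix_diff_ldistrib p)
      from ker[OF this] show "(Q x ** (mat 1 - P x)) *v v = (mat 1 - P x) *v v"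
        by (simp add: matrix_vector_mul_assoc)
    qed
    then have qp: "Q x - Q x ** P x = mat 1 - P x" by (simp add: matrix_diff_ldistrib)
    from arg_cong[OF this, of transpose] have "Q x - P x ** Q x = mat 1 - P x"
      by (simp add: transpose_diff matrix_transpose_mul p)
    then have PQ_eq: "P x ** Q x = Q x + P x - mat 1" by (simp add: algebra_simps)
    moreover have QP_eq: "Q x ** P x = Q x + P x - mat 1" using qp by (simp add: algebra_simps)
    ultimately have comm: "Q x ** P x = P x ** Q x" by simp
    have "(P x ** Q x) ** (P x ** Q x) = P x ** (Q x ** P x) ** Q x" by (simp only: matrix_mul_assoc)
    also have "\<dots> = (P x ** P x) ** (Q x ** Q x)" by (simp only: comm matrix_mul_assoc)
    also have "\<dots> = P x ** Q x" by (simp only: p)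
    finally have "orth_proj (P x ** Q x)" using comm by (simp add: orth_proj_def matrix_transpose_mul p)
    then have P'x: "P' x = P x ** Q x" by (simp add: P'_def)
    have "trace (P' x) = real q + real d - real CARD('n)"
      unfolding P'x PQ_eq using elim by (simp add: trace_add trace_sub trace_I)
    moreover have "fibre (P' x) = fibre (P x) \<inter> fibre (Q x)"
    proof (intro set_eqI iffI)
      fix v assume "v \<in> fibre (P' x)"
      then have v: "(P x ** Q x) *v v = v" by (simp add: fibre_def P'x)
      have "P x *v v = (P x ** (P x ** Q x)) *v v" using v by (simp add: matrix_vector_mul_assoc[symmetric])
      also have "\<dots> = v" using v by (simp add: matrix_mul_assoc p)
      finally have 1: "P x *v v = v" .
      have "Q x ** (P x ** Q x) = (Q x ** P x) ** Q x" by (rule matrix_mul_assoc)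
      also have "\<dots> = P x ** (Q x ** Q x)" unfolding comm by (rule matrix_mul_assoc[symmetric])
      also have "\<dots> = P x ** Q x" by (simp only: p)
      finally have QPQ: "Q x ** (P x ** Q x) = P x ** Q x" .
      have "Q x *v v = Q x *v ((P x ** Q x) *v v)" by (simp only: v)
      also have "\<dots> = (Q x ** (P x ** Q x)) *v v" by (rule matrix_vector_mul_assoc)
      also have "\<dots> = v" by (simp only: QPQ v)
      finally show "v \<in> fibre (P x) \<inter> fibre (Q x)" using 1 by (simp add: fibre_def)
    qed (auto simp: fibre_def P'x matrix_vector_mul_assoc[symmetric])
    ultimately show ?case by blast
  qed
  obtain x0 where "trace (P' x0) = real q + real d - real CARD('n)"
    using AE_imp_ex_space[OF key] by blast
  then have ge: "real q + real d - real CARD('n) \<ge> 0" using trace_orth_proj_nonneg[OF P'2, of x0] zero_le_power2[of "norm (P' x0)"] by linarith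
  define d' where "d' = q + d - CARD('n)"
  have d': "real d' = real q + real d - real CARD('n)" using ge unfolding d'_def by linarith
  have "d' < d" using d' q by linarith
  moreover have "AE x in M. trace (P' x) = real d' \<and> fibre (P' x) = fibre (P x) \<inter> fibre (Q x)"
    using key unfolding d' .
  moreover have "AE x in M. \<forall>v\<in>fibre (P' x). B x *v v \<in> fibre (P' (T x))"
  proof -
    have 1: "AE x in M. fibre (P' (T x)) = fibre (P (T x)) \<inter> fibre (Q (T x))"
      using AE_comp_pow[OF key, of 1] by simp
    have 2: "AE x in M. splits_growth (\<lambda>n. matrix_iterate T B n (T x)) l l' (Q (T x))"
      using AE_comp_pow[OF ae, of 1] by (auto elim: eventually_mono)
    from 1 2 show ?thesis using key ae P(3)
    proof eventually_elim
      case (elim x)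
      show ?case
      proof
        fix v assume v: "v \<in> fibre (P' x)"
        let ?w = "B x *v v"
        have "P (T x) *v ?w = ?w" using elim(5) by (simp add: matrix_vector_mul_assoc)
        moreover have "Q (T x) *v ?w = ?w"
        proof (rule ccontr)
          define e where "e = (l - l') / 4"
          have e: "e > 0" "l' + e < l - e" using lt by (auto simp: e_def field_simps)
          assume "Q (T x) *v ?w \<noteq> ?w"
          from splits_growth_fast[OF elim(2) this e(1)]
          have "\<forall>\<^sub>F n in sequentially. exp (real n * (l - e)) \<le> norm (matrix_iterate T B n (T x) *v ?w)"
            by (rule eventually_mono) blast
          moreover have "\<forall>\<^sub>F n in sequentially. norm (matrix_iterate T B n x *v v) \<le> exp (real n * (l' + e))"
            using elim(3) v by (intro splits_growth_slow[OF conjunct2[OF elim(4)] _ e(1)]) (auto simp: fibre_def)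
          then have "\<forall>\<^sub>F n in sequentially. norm (matrix_iterate T B (Suc n) x *v v) \<le> exp (real (Suc n) * (l' + e))"
            by (subst eventually_sequentially_Suc)
          moreover have "\<forall>\<^sub>F n in sequentially. exp (l' + e) + 1 \<le> exp (real n * (l - e - (l' + e)))"
            by (rule eventually_le_exp) (use e in simp)
          ultimately have "\<forall>\<^sub>F n in sequentially. False"
          proof eventually_elim
            case (elim n)
            have eq: "matrix_iterate T B (Suc n) x *v v = matrix_iterate T B n (T x) *v ?w"
              using matrix_iterate_add[of T B 1 n x] by (simp add: matrix_vector_mul_assoc)
            have "exp (real n * (l - e)) \<le> exp (real (Suc n) * (l' + e))"
              by (rule order_trans[OF elim(1) elim(2)[unfolded eq]])
            also have "\<dots> = exp (real n * (l' + e)) * exp (l' + e)"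
              by (simp add: exp_add[symmetric] algebra_simps)
            also have "\<dots> < exp (real n * (l' + e)) * exp (real n * (l - e - (l' + e)))"
            proof (rule mult_strict_left_mono)
              show "exp (l' + e) < exp (real n * (l - e - (l' + e)))" using elim(3) by linarith
            qed simp
            also have "\<dots> = exp (real n * (l - e))" by (simp add: exp_add[symmetric] algebra_simps)
            finally show False by simp
          qed
          then show False by simp
        qed
        ultimately show "?w \<in> fibre (P' (T x))" using elim(1) by (simp add: fibre_def)
      qed
    qed
  qed
  ultimately show ?thesis using P'1 P'2 by blast
qed

lemma filtration_subset:
  assumes "filtration B k c Q x" "j \<le> k"
  shows "fibre (Q j x) \<subseteq> fibre (Q 0 x)"
  using assms(2)
proof (induction j)
  case (Suc j)
  then have "fibre (Q (Suc j) x) \<subset> fibre (Q j x)" using assms(1) by (auto simp: filtration_def)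
  then show ?case using Suc by auto
qed simp

text \<open>
  Induction on the dimension. One step removes the top exponent \<open>l\<close>. The restriction of the
  cocycle to the slow part has all its exponents at most \<open>l'\<close>, hence below \<open>l\<close>, since the iterates of the restricted
  cocycle and of \<open>B\<close> agree there.
\<close>

theorem filtration_exists:
  fixes B P :: "'a \<Rightarrow> real ^ 'n ^ 'n"
  assumes "sub_cocycle B P d" "d \<ge> 1"
  shows "\<exists>k c (Q :: nat \<Rightarrow> 'a \<Rightarrow> real ^ 'n ^ 'n). k \<ge> 1 \<and> (\<forall>j<k. c j < \<infinity>) \<and> (\<forall>j. Suc j < k \<longrightarrow> c (Suc j) < c j) \<and>
    (\<forall>j. Q j \<in> borel_measurable M) \<and> (\<forall>j x. orth_proj (Q j x)) \<and> Q 0 = P \<and> Q k = (\<lambda>_. 0) \<and>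
    (AE x in M. filtration B k c Q x)"
  using assms
proof (induction d arbitrary: B P rule: less_induct)
  case (less d)
  have BP: "B \<in> borel_measurable M" "integrable M (\<lambda>x. ln (max 1 (norm (B x))))"
    "P \<in> borel_measurable M" "\<And>x. orth_proj (P x)"
    "AE x in M. trace (P x) = real d \<and> B x ** P x = B x \<and> P (T x) ** B x = B x"
    using less.prems by (auto simp: sub_cocycle_def)
  interpret matrix_cocycle M T B by unfold_locales (use BP in auto)
  have inv: "B x *v v \<in> fibre (P (T x))" if "P (T x) ** B x = B x" for x v
    using that by (simp add: fibre_def matrix_vector_mul_assoc)
  have single: ?case if c: "c < \<infinity>" and grow: "AE x in M. \<forall>v\<in>fibre (P x) - {0}. grows B x v c" for c
  proof -
    define Q where "Q j = (if j = 0 then P else (\<lambda>_. 0))" for j :: nat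
    have "AE x in M. filtration B 1 (\<lambda>_. c) Q x"
      using grow BP(5)
    proof eventually_elim
      case (elim x)
      have "P x \<noteq> 0" using elim(2) less.prems(2) by (auto simp: trace_def)
      then obtain v where "P x *v v \<noteq> 0" by (metis matrix_eq matrix_vector_mult_0)
      then have "fibre (0 :: real ^ 'n ^ 'n) \<subset> fibre (P x)"
        using orth_proj_in_fibre[OF BP(4), of x v] subspace_0[OF subspace_fibre[of "P x"]] by (auto simp: fibre_0)
      then show ?case using elim inv[of x] by (auto simp: filtration_def Q_def fibre_0)
    qed
    moreover have "\<forall>j. Q j \<in> borel_measurable M" "\<forall>j x. orth_proj (Q j x)" "Q 0 = P" "Q 1 = (\<lambda>_. 0)"
      using BP orth_proj_0 by (auto simp: Q_def)
    ultimately show ?thesis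
      using c by (intro exI[of _ "1::nat"] exI[of _ "\<lambda>_. c"] exI[of _ Q]) simp
  qed
  from top_exponent show ?case
  proof
    assume dec: "AE x in M. \<forall>v K. \<forall>\<^sub>F n in sequentially. norm (iterate n x *v v) \<le> exp (- (real n * K))"
    show ?case
    proof (rule single[of "- \<infinity>"])
      show "AE x in M. \<forall>v\<in>fibre (P x) - {0}. grows B x v (- \<infinity>)"
        using dec by eventually_elim (auto simp: grows_def intro!: elog_tendsto_MInf)
    qed simp
  next
    assume "\<exists>l l' Q q. l' < l \<and> Q \<in> borel_measurable M \<and> (\<forall>x. orth_proj (Q x)) \<and> q < CARD('n) \<and>
      (AE x in M. trace (Q x) = real q
        \<and> splits_growth (\<lambda>n. iterate n x) l l' (Q x))"
    then obtain l l' Q q where Q: "l' < l" "Q \<in> borel_measurable M" "\<And>x. orth_proj (Q x)" "q < CARD('n)" and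
      ae: "AE x in M. trace (Q x) = real q
        \<and> splits_growth (\<lambda>n. iterate n x) l l' (Q x)"
      by blast
    obtain P' d' where d': "d' < d" and P': "P' \<in> borel_measurable M" "\<And>x. orth_proj (P' x)"
      "AE x in M. trace (P' x) = real d' \<and> fibre (P' x) = fibre (P x) \<inter> fibre (Q x)"
      "AE x in M. \<forall>v\<in>fibre (P' x). B x *v v \<in> fibre (P' (T x))"
      using slow_subbundle[OF less.prems(1) Q(2,3,1) ae Q(4)] by blast
    have fast: "AE x in M. \<forall>v\<in>fibre (P x) - fibre (P' x). grows B x v (ereal l)"
      using ae P'(3)
    proof eventually_elim
      case (elim x)
      show ?case
      proof
        fix v assume "v \<in> fibre (P x) - fibre (P' x)"
        then have "Q x *v v \<noteq> v" using elim(2) by (auto simp: fibre_def)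
        then show "grows B x v (ereal l)"
          unfolding grows_def by (intro elog_tendsto_real splits_growth_fast[OF conjunct2[OF elim(1)]])
      qed
    qed
    show ?case
    proof (cases "d' = 0")
      case True
      show ?thesis
      proof (rule single[of "ereal l"])
        show "AE x in M. \<forall>v\<in>fibre (P x) - {0}. grows B x v (ereal l)"
          using fast P'(3)
        proof eventually_elim
          case (elim x)
          have "P' x = 0" using elim(2) True trace_orth_proj_nonneg[OF P'(2), of x] by simp
          then show ?case using elim(1) by (simp add: fibre_0)
        qed
      qed simp
    next
      case False
      let ?B = "\<lambda>x. B x ** P' x"
      have tr: "AE x in M. trace (P' x) = real d'" using P'(3) by (auto elim: eventually_mono)
      note res = restrict_sub_cocycle[OF BP(1,2) P'(1,2) tr P'(4)]
      obtain k c R where k: "k \<ge> 1" and c: "\<forall>j<k. c j < \<infinity>" "\<forall>j. Suc j < k \<longrightarrow> c (Suc j) < c j"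
        and R: "\<forall>j. R j \<in> borel_measurable M" "\<forall>j x. orth_proj (R j x)" "R 0 = P'" "R k = (\<lambda>_. 0)"
        and fil: "AE x in M. filtration ?B k c R x"
        using less.IH[OF d' res(1)] False by auto
      have c0: "c 0 < ereal l"
      proof -
        have "AE x in M. c 0 \<le> ereal l'"
          using fil res(2) ae P'(3)
        proof eventually_elim
          case (elim x)
          have "0 < k" using k by simp
          note fil0 = elim(1)[unfolded filtration_def, rule_format, OF this, unfolded R(3)]
          then obtain v where v: "v \<in> fibre (P' x)" "v \<notin> fibre (R (Suc 0) x)" by blast
          then have "grows ?B x v (c 0)" using fil0 by blast
          then have "grows B x v (c 0)" using elim(2) v by (simp add: grows_def)
          moreover have "Q x *v v = v" using v elim(4) by (auto simp: fibre_def)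
          ultimately show ?case
            unfolding grows_def
            by (intro elog_limit_le[where a="\<lambda>n. norm (iterate n x *v v)"] splits_growth_slow[OF conjunct2[OF elim(3)]]) auto
        qed
        then have "c 0 \<le> ereal l'" using AE_imp_ex_space by blast
        also have "\<dots> < ereal l" using Q(1) by simp
        finally show ?thesis .
      qed
      define c' where "c' j = (case j of 0 \<Rightarrow> ereal l | Suc i \<Rightarrow> c i)" for j
      define R' where "R' j = (case j of 0 \<Rightarrow> P | Suc i \<Rightarrow> R i)" for j
      have "AE x in M. filtration B (Suc k) c' R' x"
        using fil res(2) fast P'(3) tr ae BP(5)
      proof eventually_elim
        case (elim x)
        have sub: "fibre (P' x) \<subseteq> fibre (P x)" using conjunct2[OF elim(4)] Int_lower1 by simp
        have "fibre (P' x) \<noteq> fibre (P x)"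
        proof
          assume "fibre (P' x) = fibre (P x)"
          from arg_cong[OF this, of proj_matrix] have "P' x = P x"
            unfolding proj_matrix_fibre[OF P'(2)] proj_matrix_fibre[OF BP(4)] .
          then have "real d' = real d" using elim(5) conjunct1[OF elim(7)] by simp
          then show False using d' by simp
        qed
        then have 0: "fibre (R' 1 x) \<subset> fibre (R' 0 x)" using sub R(3) by (auto simp: R'_def)
        have Rsub: "fibre (R j x) \<subseteq> fibre (P' x)" if "j < k" for j
          using filtration_subset[OF elim(1), of j] that R(3) by simp
        show ?case
          unfolding filtration_def
        proof (intro allI impI)
          fix j assume j: "j < Suc k"
          show "fibre (R' (Suc j) x) \<subset> fibre (R' j x) \<and>
            (\<forall>v\<in>fibre (R' j x). B x *v v \<in> fibre (R' j (T x))) \<and>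
            (\<forall>v\<in>fibre (R' j x) - fibre (R' (Suc j) x). grows B x v (c' j))"
          proof (cases j)
            case 0
            then show ?thesis using \<open>fibre (R' 1 x) \<subset> fibre (R' 0 x)\<close> elim(3,7) inv[of x] R(3)
              by (simp add: R'_def c'_def)
          next
            case (Suc i)
            then have i: "i < k" using j by simp
            have B_eq: "(B x ** P' x) *v v = B x *v v" if "v \<in> fibre (R i x)" for v
              using Rsub[OF i] that by (auto simp: fibre_def matrix_vector_mul_assoc[symmetric])
            have g_eq: "grows ?B x v a = grows B x v a" if "v \<in> fibre (R i x)" for v a
            proof -
              have "v \<in> fibre (P' x)" using Rsub[OF i] that by blast
              then have "matrix_iterate T ?B n x *v v = matrix_iterate T B n x *v v" for n using elim(2) by blast
              then show ?thesis unfolding grows_def by simp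
            qed
            note f = elim(1)[unfolded filtration_def, rule_format, OF i]
            have "\<forall>v\<in>fibre (R i x). B x *v v \<in> fibre (R i (T x))" using f B_eq by auto
            moreover have "\<forall>v\<in>fibre (R i x) - fibre (R (Suc i) x). grows B x v (c i)" using f g_eq by blast
            moreover have "fibre (R (Suc i) x) \<subset> fibre (R i x)" using f by blast
            ultimately show ?thesis by (simp add: Suc R'_def c'_def)
          qed
        qed
      qed
      moreover have "\<forall>j<Suc k. c' j < \<infinity>" using c(1) by (auto simp: c'_def split: nat.split)
      moreover have "\<forall>j. Suc j < Suc k \<longrightarrow> c' (Suc j) < c' j"
        using c(2) c0 by (auto simp: c'_def split: nat.split)
      moreover have "\<forall>j. R' j \<in> borel_measurable M" "\<forall>j x. orth_proj (R' j x)" "R' 0 = P" "R' (Suc k) = (\<lambda>_. 0)"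
        using R BP by (auto simp: R'_def split: nat.split)
      ultimately show ?thesis
        by (intro exI[of _ "Suc k"] exI[of _ c'] exI[of _ R']) auto
    qed
  qed
qed

end

section \<open>Bundles in the Grassmannian and cocycles on them\<close>

lemma fibre_measurable:
  assumes Q: "Q \<in> borel_measurable M" "\<And>x. orth_proj (Q x)"
  shows "(\<lambda>x. fibre (Q x)) \<in> measurable M grassmannian"
  unfolding grassmannian_def
proof (rule measurable_measure_of)
  show "{U. openin grassmann_topology U} \<subseteq> Pow {S :: (real ^ 'b) set. subspace S}"
    using openin_subset[of grassmann_topology] by auto
  show "(\<lambda>x. fibre (Q x)) \<in> space M \<rightarrow> {S. subspace S}" by (simp add: subspace_fibre)
  fix U :: "(real ^ 'b) set set" assume "U \<in> {U. openin grassmann_topology U}"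
  then obtain W where W: "open W" "U = (\<lambda>S. matrix (closest_point S)) -` W \<inter> {S. subspace S}"
    by (auto simp: grassmann_topology_def openin_pullback_topology)
  have "(\<lambda>x. fibre (Q x)) -` U \<inter> space M = Q -` W \<inter> space M"
    using proj_matrix_fibre[OF Q(2)] by (auto simp: W(2) subspace_fibre proj_matrix_def)
  then show "(\<lambda>x. fibre (Q x)) -` U \<inter> space M \<in> sets M"
    using measurable_sets[OF Q(1) borel_open[OF W(1)]] by simp
qed

lemma proj_matrix_measurable:
  assumes E: "E \<in> measurable M grassmannian"
  shows "(\<lambda>x. proj_matrix (E x)) \<in> borel_measurable M"
proof (rule borel_measurableI)
  fix W :: "(real ^ 'b ^ 'b) set" assume W: "open W"
  let ?U = "(\<lambda>S. matrix (closest_point S)) -` W \<inter> {S. subspace S}"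
  have "openin grassmann_topology ?U"
    unfolding grassmann_topology_def openin_pullback_topology using W by auto
  then have "?U \<in> sets grassmannian" unfolding sets_grassmannian by auto
  from measurable_sets[OF E this] have "E -` ?U \<inter> space M \<in> sets M" .
  also have "E -` ?U \<inter> space M = (\<lambda>x. proj_matrix (E x)) -` W \<inter> space M"
    using measurable_space[OF E] by (auto simp: proj_matrix_def)
  finally show "(\<lambda>x. proj_matrix (E x)) -` W \<inter> space M \<in> sets M" .
qed

definition cocycle_matrix :: "('a \<Rightarrow> (real ^ 'n) set) \<Rightarrow> ('a \<Rightarrow> real ^ 'n \<Rightarrow> real ^ 'n) \<Rightarrow> 'a \<Rightarrow> real ^ 'n ^ 'n" where
  "cocycle_matrix E A x = matrix (\<lambda>v. A x (proj_matrix (E x) *v v))"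

context
  fixes M :: "'a measure" and T :: "'a \<Rightarrow> 'a" and E :: "'a \<Rightarrow> (real ^ 'n) set"
    and A :: "'a \<Rightarrow> real ^ 'n \<Rightarrow> real ^ 'n"
  assumes E: "E \<in> measurable M grassmannian" and A: "linear_cocycle M T E A"
begin

lemma subspace_E: "x \<in> space M \<Longrightarrow> subspace (E x)"
  using measurable_space[OF E] by simp

lemma proj_E_in: "x \<in> space M \<Longrightarrow> proj_matrix (E x) *v v \<in> E x"
  using orth_proj_in_fibre[OF proj_matrix(1)[OF subspace_E]] proj_matrix(2)[OF subspace_E] by blast

lemma proj_E_fixed: "x \<in> space M \<Longrightarrow> v \<in> E x \<Longrightarrow> proj_matrix (E x) *v v = v"
  using proj_matrix(2)[OF subspace_E, of x] by (auto simp: fibre_def)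

lemma cocycle_matrix_apply:
  assumes x: "x \<in> space M"
  shows "cocycle_matrix E A x *v v = A x (proj_matrix (E x) *v v)"
proof -
  have "linear (\<lambda>v. A x (proj_matrix (E x) *v v))"
    using A x proj_E_in[OF x]
    by (intro linearI) (auto simp: linear_cocycle_def matrix_vector_right_distrib matrix_vector_mult_scaleR)
  then show ?thesis unfolding cocycle_matrix_def by (simp add: matrix_works)
qed

text \<open>
  The columns of the matrix are the values of \<open>A x\<close> at the projections of the basis vectors to the
  fibre, which are measurable sections of the bundle.
\<close>

lemma cocycle_matrix_measurable: "cocycle_matrix E A \<in> borel_measurable M"
proof -
  have "(\<lambda>x. A x (proj_matrix (E x) *v axis j 1) $ i) \<in> borel_measurable M" for i j
  proof -
    have P: "(\<lambda>x. proj_matrix (E x) *v axis j 1) \<in> borel_measurable M"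
    proof -
      have "(\<lambda>x. \<chi> i. proj_matrix (E x) $ i $ j) \<in> borel_measurable M"
        by (intro measurable_vec_lambda measurable_vec_nth proj_matrix_measurable[OF E])
      then show ?thesis by (simp add: matrix_vector_mult_basis column_def)
    qed
    have "(\<lambda>x. (x, proj_matrix (E x) *v axis j 1)) \<in> measurable M (restrict_space (M \<Otimes>\<^sub>M borel) (bundle_set M E))"
    proof (rule measurable_restrict_space2)
      show "(\<lambda>x. (x, proj_matrix (E x) *v axis j 1)) \<in> space M \<rightarrow> bundle_set M E"
        using proj_E_in by (auto simp: bundle_set_def)
      show "(\<lambda>x. (x, proj_matrix (E x) *v axis j 1)) \<in> measurable M (M \<Otimes>\<^sub>M borel)"
        by (rule measurable_Pair[OF measurable_ident P, unfolded id_def])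
    qed
    from measurable_compose[OF this, of "\<lambda>(x, v). A x v" borel] A
    have "(\<lambda>x. A x (proj_matrix (E x) *v axis j 1)) \<in> borel_measurable M"
      by (simp add: linear_cocycle_def)
    then show ?thesis by (rule measurable_vec_nth)
  qed
  then have "(\<lambda>x. \<chi> i j. A x (proj_matrix (E x) *v axis j 1) $ i) \<in> borel_measurable M"
    by (intro measurable_vec_lambda)
  then show ?thesis by (simp add: cocycle_matrix_def matrix_def fun_eq_iff[abs_def] cong: measurable_cong)
qed

text \<open>
  The norm of a matrix is the Hilbert-Schmidt norm, hence the factor.
\<close>

lemma norm_cocycle_matrix_le:
  assumes x: "x \<in> space M"
  shows "norm (cocycle_matrix E A x) \<le> real CARD('n) * norm_on (E x) (A x)"
proof (rule norm_le_of_apply)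
  fix v
  let ?w = "proj_matrix (E x) *v v"
  have bdd: "bdd_above ((\<lambda>v. norm (A x v)) ` {v \<in> E x. norm v \<le> 1})"
  proof (rule bdd_aboveI2)
    fix w assume w: "w \<in> {v \<in> E x. norm v \<le> 1}"
    then have "A x w = cocycle_matrix E A x *v w" by (simp add: cocycle_matrix_apply[OF x] proj_E_fixed[OF x])
    then have "norm (A x w) \<le> norm (cocycle_matrix E A x) * norm w" by (simp add: norm_matrix_vector_le)
    also have "\<dots> \<le> norm (cocycle_matrix E A x) * 1" using w by (intro mult_left_mono) auto
    finally show "norm (A x w) \<le> norm (cocycle_matrix E A x)" by simp
  qed
  have le: "norm (A x w) \<le> norm_on (E x) (A x)" if "w \<in> E x" "norm w \<le> 1" for w
    unfolding norm_on_def by (rule cSUP_upper[OF _ bdd]) (use that in auto)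
  have n0: "0 \<le> norm_on (E x) (A x)"
    using le[of 0] subspace_0[OF subspace_E[OF x]] norm_ge_zero[of "A x 0"] by (simp del: norm_ge_zero)
  have wv: "norm ?w \<le> norm v" by (rule orth_proj_norm_le[OF proj_matrix(1)[OF subspace_E[OF x]]])
  have "norm (A x ?w) \<le> norm_on (E x) (A x) * norm ?w"
  proof (cases "?w = 0")
    case True
    have "A x 0 = 0 *\<^sub>R A x 0"
      using A x subspace_0[OF subspace_E[OF x]] unfolding linear_cocycle_def by (metis scaleR_zero_left)
    then show ?thesis using True by simp
  next
    case False
    have mem: "(1 / norm ?w) *\<^sub>R ?w \<in> E x" by (rule subspace_scale[OF subspace_E[OF x] proj_E_in[OF x]])
    have "A x ((1 / norm ?w) *\<^sub>R ?w) = (1 / norm ?w) *\<^sub>R A x ?w"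
      using A x proj_E_in[OF x, of v] unfolding linear_cocycle_def by blast
    then have "norm (A x ?w) / norm ?w \<le> norm_on (E x) (A x)"
      using le[OF mem] False by simp
    then show ?thesis using False by (simp add: pos_divide_le_eq)
  qed
  also have "\<dots> \<le> norm_on (E x) (A x) * norm v" using wv n0 by (rule mult_left_mono)
  finally show "norm (cocycle_matrix E A x *v v) \<le> norm_on (E x) (A x) * norm v"
    by (simp add: cocycle_matrix_apply[OF x])
qed

text \<open>
  The hypothesis bounds an upper integral of \<open>norm_on (E x) (A x)\<close>, which transfers to the measurable function \<open>g\<close>
  below it.
\<close>

lemma cocycle_matrix_integrable:
  assumes prob: "prob_space M" and int: "integrable_cocycle M E A"
  shows "integrable M (\<lambda>x. ln (max 1 (norm (cocycle_matrix E A x))))"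
proof -
  interpret prob_space M by fact
  note [measurable] = cocycle_matrix_measurable
  let ?c = "ln (real CARD('n))"
  define g where "g x = max 0 (ln (max 1 (norm (cocycle_matrix E A x))) - ?c)" for x
  have [measurable]: "g \<in> borel_measurable M" unfolding g_def by measurable
  have c0: "?c \<ge> 0" by (simp add: Suc_leI)
  have g_le: "g x \<le> ln (max 1 (norm_on (E x) (A x)))" if x: "x \<in> space M" for x
  proof -
    have "max 1 (norm (cocycle_matrix E A x)) \<le> real CARD('n) * max 1 (norm_on (E x) (A x))"
    proof (rule max.boundedI)
      have "1 * 1 \<le> real CARD('n) * max 1 (norm_on (E x) (A x))" by (rule mult_mono) (auto simp: Suc_leI)
      then show "1 \<le> real CARD('n) * max 1 (norm_on (E x) (A x))" by simp
      show "norm (cocycle_matrix E A x) \<le> real CARD('n) * max 1 (norm_on (E x) (A x))"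
        by (rule order_trans[OF norm_cocycle_matrix_le[OF x]]) (auto intro: mult_left_mono)
    qed
    then have "ln (max 1 (norm (cocycle_matrix E A x))) \<le> ln (real CARD('n) * max 1 (norm_on (E x) (A x)))"
      by (subst ln_le_cancel_iff) (auto simp: less_max_iff_disj)
    also have "\<dots> = ?c + ln (max 1 (norm_on (E x) (A x)))" by (simp add: ln_mult)
    finally show ?thesis by (simp add: g_def)
  qed
  have "integrable M g"
  proof (rule integrableI_bounded)
    have "(\<integral>\<^sup>+ x. ennreal (norm (g x)) \<partial>M) \<le> (\<integral>\<^sup>+ x. ennreal (ln (max 1 (norm_on (E x) (A x)))) \<partial>M)"
      by (rule nn_integral_mono) (use g_le in \<open>auto simp: g_def intro!: ennreal_leI\<close>)
    also have "\<dots> < \<infinity>" using int by (simp add: integrable_cocycle_def)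
    finally show "(\<integral>\<^sup>+ x. ennreal (norm (g x)) \<partial>M) < \<infinity>" .
  qed measurable
  then have "integrable M (\<lambda>x. g x + ?c)" by (intro Bochner_Integration.integrable_add) auto
  then show ?thesis
  proof (rule Bochner_Integration.integrable_bound)
    show "AE x in M. norm (ln (max 1 (norm (cocycle_matrix E A x)))) \<le> norm (g x + ?c)"
      using c0 by (intro AE_I2) (simp add: g_def)
  qed measurable
qed

lemma cocycle_iterate_matrix:
  assumes T: "T \<in> measurable M M" and x: "x \<in> space M" and v: "v \<in> E x"
  shows "cocycle_iterate T A n x v = matrix_iterate T (cocycle_matrix E A) n x *v v"
    and "cocycle_iterate T A n x v \<in> E ((T ^^ n) x)"
proof -
  have Tn: "(T ^^ n) x \<in> space M" for n
    by (induction n) (use x measurable_space[OF T] in auto)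
  have "cocycle_iterate T A n x v = matrix_iterate T (cocycle_matrix E A) n x *v v \<and> cocycle_iterate T A n x v \<in> E ((T ^^ n) x)"
  proof (induction n)
    case (Suc n)
    then have w: "cocycle_iterate T A n x v \<in> E ((T ^^ n) x)"
      and eq: "cocycle_iterate T A n x v = matrix_iterate T (cocycle_matrix E A) n x *v v" by auto
    have "A ((T ^^ n) x) (cocycle_iterate T A n x v) \<in> E (T ((T ^^ n) x))"
      using A Tn[of n] w unfolding linear_cocycle_def by blast
    moreover have "cocycle_matrix E A ((T ^^ n) x) *v cocycle_iterate T A n x v = A ((T ^^ n) x) (cocycle_iterate T A n x v)"
      by (simp only: cocycle_matrix_apply[OF Tn] proj_E_fixed[OF Tn w])
    ultimately show ?case by (simp add: matrix_vector_mul_assoc[symmetric] eq[symmetric])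
  qed (use v in simp)
  then show "cocycle_iterate T A n x v = matrix_iterate T (cocycle_matrix E A) n x *v v"
    "cocycle_iterate T A n x v \<in> E ((T ^^ n) x)" by auto
qed

end

theorem theorem2p3:
  fixes M :: "'x measure"
    and T :: "'x \<Rightarrow> 'x"
    and E :: "'x \<Rightarrow> (real ^ 'm) set"
    and A :: "'x \<Rightarrow> real ^ 'm \<Rightarrow> real ^ 'm"
  assumes "prob_space M"
    and "ergodic_automorphism M T"
    and "measurable_bundle M E"
    and "linear_cocycle M T E A"
    and "integrable_cocycle M E A"
  shows "\<exists>(k::nat) (\<Lambda> :: nat \<Rightarrow> ereal) (F :: nat \<Rightarrow> 'x \<Rightarrow> (real ^ 'm) set).
    k \<ge> 1 \<and>
    (\<forall>j\<in>{1..k}. \<Lambda> j < \<infinity>) \<and>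
    (\<forall>i\<in>{1..k}. \<forall>j\<in>{1..k}. i < j \<longrightarrow> \<Lambda> j < \<Lambda> i) \<and>
    (\<forall>j\<in>{1..k}. F j \<in> measurable M grassmannian) \<and>
    (\<forall>x. F (k + 1) x = {0}) \<and>
    (AE x in M.
       (\<forall>j\<in>{1..k}. A x ` F j x \<subseteq> F j (T x)) \<and>
       F 1 x = E x \<and> (\<forall>j\<in>{1..k}. F (j + 1) x \<subset> F j x) \<and>
       (\<forall>j\<in>{1..k}. \<forall>v \<in> F j x - F (j + 1) x.
          (\<lambda>n. elog (norm (cocycle_iterate T A n x v)) / ereal (real n)) \<longlonglongrightarrow> \<Lambda> j))"
proof -
  have E: "E \<in> measurable M grassmannian" using assms(3) by (simp add: measurable_bundle_def)
  obtain d where d: "d \<ge> 1" "\<And>x. x \<in> space M \<Longrightarrow> dim (E x) = d" using assms(3) by (auto simp: measurable_bundle_def)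
  note A = assms(4)
  interpret prob_space M by (rule assms(1))
  interpret ergodic_map M T
    by unfold_locales (use assms(2) in \<open>unfold ergodic_automorphism_def, blast+\<close>)
  define B where "B = cocycle_matrix E A"
  \<comment> \<open>Outside the space of \<open>M\<close> the fibre \<open>E x\<close> may fail to be a subspace.\<close>
  define P where "P x = proj_matrix (if x \<in> space M then E x else {0})" for x
  have P_space: "P x = proj_matrix (E x)" if "x \<in> space M" for x using that by (simp add: P_def)
  have Pproj: "orth_proj (P x)" for x
    unfolding P_def using subspace_E[OF E A] by (intro proj_matrix) (auto simp: subspace_single_0)
  have Pfib: "fibre (P x) = E x" if "x \<in> space M" for x
    unfolding P_space[OF that] by (rule proj_matrix(2)[OF subspace_E[OF E A that]])
  have "P \<in> borel_measurable M"
    using proj_matrix_measurable[OF E] by (simp add: P_space cong: measurable_cong)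
  moreover have "trace (P x) = real d \<and> B x ** P x = B x \<and> P (T x) ** B x = B x" if x: "x \<in> space M" for x
  proof (intro conjI)
    show "trace (P x) = real d" using trace_orth_proj_dim[OF Pproj] by (simp add: Pfib[OF x] d(2)[OF x])
    have idem: "P x *v (P x *v v) = P x *v v" for v
      using Pproj[of x] by (simp add: orth_proj_def matrix_vector_mul_assoc)
    have Bv: "B x *v v = A x (P x *v v)" for v
      unfolding B_def P_space[OF x] by (rule cocycle_matrix_apply[OF E A x])
    show "B x ** P x = B x" by (simp add: matrix_eq matrix_vector_mul_assoc[symmetric] Bv idem)
    have Tx: "T x \<in> space M" by (rule measurable_space[OF T_measurable x])
    have "P x *v v \<in> E x" for v using orth_proj_in_fibre[OF Pproj, of x v] by (simp add: Pfib[OF x])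
    then have "B x *v v \<in> fibre (P (T x))" for v
      unfolding Bv Pfib[OF Tx] using A x unfolding linear_cocycle_def by blast
    then show "P (T x) ** B x = B x" by (simp add: matrix_eq matrix_vector_mul_assoc[symmetric] fibre_def)
  qed
  ultimately have "sub_cocycle B P d"
    unfolding sub_cocycle_def B_def
    using cocycle_matrix_measurable[OF E A] cocycle_matrix_integrable[OF E A assms(1,5)] Pproj by (auto intro!: AE_I2)
  from filtration_exists[OF this d(1)]
  obtain k c Q where k: "k \<ge> 1" and c: "\<And>j. j < k \<Longrightarrow> c j < \<infinity>" "\<And>j. Suc j < k \<Longrightarrow> c (Suc j) < c j"
    and Q: "\<And>j. Q j \<in> borel_measurable M" "\<And>j x. orth_proj (Q j x)" "Q 0 = P" "Q k = (\<lambda>_. 0)"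
    and fil: "AE x in M. filtration B k c Q x"
    by auto
  have mono: "c j < c i" if "i < j" "j < k" for i j
    using that
  proof (induction j)
    case (Suc j)
    then show ?case using c(2)[of j] by (cases "i = j") auto
  qed simp
  have cocycle: "A x v = B x *v v" "cocycle_iterate T A n x v = matrix_iterate T B n x *v v"
    if "x \<in> space M" "v \<in> E x" for x v n
    using cocycle_matrix_apply[OF E A that(1), of v] proj_E_fixed[OF E A that]
      cocycle_iterate_matrix(1)[OF E A T_measurable that] by (simp_all add: B_def)
  have "AE x in M. (\<forall>j\<in>{1..k}. A x ` fibre (Q (j - 1) x) \<subseteq> fibre (Q (j - 1) (T x))) \<and>
       fibre (Q (1 - 1) x) = E x \<and> (\<forall>j\<in>{1..k}. fibre (Q (j + 1 - 1) x) \<subset> fibre (Q (j - 1) x)) \<and>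
       (\<forall>j\<in>{1..k}. \<forall>v \<in> fibre (Q (j - 1) x) - fibre (Q (j + 1 - 1) x).
          (\<lambda>n. elog (norm (cocycle_iterate T A n x v)) / ereal (real n)) \<longlonglongrightarrow> c (j - 1))"
    using fil AE_space
  proof eventually_elim
    case (elim x)
    have step: "fibre (Q j x) \<subset> fibre (Q (j - 1) x)"
      "\<And>v. v \<in> fibre (Q (j - 1) x) \<Longrightarrow> B x *v v \<in> fibre (Q (j - 1) (T x))"
      "\<And>v. v \<in> fibre (Q (j - 1) x) - fibre (Q j x) \<Longrightarrow> grows B x v (c (j - 1))"
      "fibre (Q (j - 1) x) \<subseteq> E x" if "j \<in> {1..k}" for j
    proof -
      have j: "j - 1 < k" "Suc (j - 1) = j" using that by auto
      note f = elim(1)[unfolded filtration_def, rule_format, OF j(1), unfolded j(2)]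
      show "fibre (Q j x) \<subset> fibre (Q (j - 1) x)" using f by blast
      show "\<And>v. v \<in> fibre (Q (j - 1) x) \<Longrightarrow> B x *v v \<in> fibre (Q (j - 1) (T x))" using f by blast
      show "\<And>v. v \<in> fibre (Q (j - 1) x) - fibre (Q j x) \<Longrightarrow> grows B x v (c (j - 1))" using f by blast
      show "fibre (Q (j - 1) x) \<subseteq> E x"
        using filtration_subset[OF elim(1), of "j - 1"] j(1) Q(3) Pfib[OF elim(2)] by simp
    qed
    show ?case
    proof (intro conjI ballI)
      show "A x ` fibre (Q (j - 1) x) \<subseteq> fibre (Q (j - 1) (T x))" if j: "j \<in> {1..k}" for j
        using step(2,4)[OF j] cocycle(1)[OF elim(2)] by auto
      show "fibre (Q (1 - 1) x) = E x" using Q(3) Pfib[OF elim(2)] by simp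
      show "fibre (Q (j + 1 - 1) x) \<subset> fibre (Q (j - 1) x)" if j: "j \<in> {1..k}" for j
        using step(1)[OF j] by simp
      show "(\<lambda>n. elog (norm (cocycle_iterate T A n x v)) / ereal (real n)) \<longlonglongrightarrow> c (j - 1)"
        if j: "j \<in> {1..k}" and v: "v \<in> fibre (Q (j - 1) x) - fibre (Q (j + 1 - 1) x)" for j v
      proof -
        have "grows B x v (c (j - 1))" using step(3)[OF j] v by simp
        moreover have "v \<in> E x" using step(4)[OF j] v by auto
        ultimately show ?thesis unfolding grows_def by (simp add: cocycle(2)[OF elim(2)])
      qed
    qed
  qed
  moreover have "\<forall>j\<in>{1..k}. c (j - 1) < \<infinity>" using c(1) by auto
  moreover have "\<forall>i\<in>{1..k}. \<forall>j\<in>{1..k}. i < j \<longrightarrow> c (j - 1) < c (i - 1)" by (auto intro!: mono)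
  moreover have "\<forall>j\<in>{1..k}. (\<lambda>x. fibre (Q (j - 1) x)) \<in> measurable M grassmannian"
    by (intro ballI fibre_measurable Q)
  moreover have "\<forall>x. fibre (Q (k + 1 - 1) x) = {0}" by (simp add: Q(4) fibre_0)
  ultimately show ?thesis
    using k by (intro exI[of _ k] exI[of _ "\<lambda>j. c (j - 1)"] exI[of _ "\<lambda>j x. fibre (Q (j - 1) x)"] conjI)
qed

end
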